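(* Suppose $\Sigma\subset\mathbb{R}^d$ is compact and the loss function $\ell(x,\xi)$ is upper semicontinuous in $\xi$ for every $x\in X$. Let $r>0$. If $\hat c\in\mathcal{C}_u(X\times\mathcal{P}(\Sigma))$ is pointwise feasible at rate $r$ or uniformly feasible at rate $r$, then $$\lim_{\epsilon\downarrow0}\hat c^{\epsilon}_{\mathrm{KL},W,r}(x,\hat P)=\lim_{\epsilon\downarrow0}\hat c^{\epsilon}_{\mathrm{KL},\mathrm{LP},r}(x,\hat P)=\hat c_{\mathrm{KL},r}(x,\hat P)\le\hat c(x,\hat P)$$ for all $x\in X$, $\hat P\in\mathcal{P}(\Sigma)$. Consequently, with "feasible" meaning throughout either "pointwise feasible at rate $r$" or throughout "uniformly feasible at rate $r$" (the equivalence holds for each of the two notions), the following are equivalent: (1) There exists a least conservative feasible predictor in $\mathcal{C}_u(X\times\mathcal{P}(\Sigma))$, i.e. a feasible $\hat c\in\mathcal{C}_u(X\times\mathcal{P}(\Sigma))$ with $\hat c(x,\hat P)\le\hat c'(x,\hat P)$ for all $(x,\hat P)\in X\times\mathcal{P}(\Sigma)$ and every feasible $\hat c'\in\mathcal{C}_u(X\times\mathcal{P}(\Sigma))$. (2) $\hat c_{\mathrm{KL},r}$ is feasible, and $\hat c_{\mathrm{KL},r}$ is the least conservative feasible predictor in $\mathcal{C}_u(X\times\mathcal{P}(\Sigma))$.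
   Context: $X\subseteq\mathbb{R}^m$ is a nonempty set of decisions. $\mathcal{P}(\Sigma)$ is the set of Borel probability measures on $\Sigma$ with the weak topology. The loss $\ell:X\times\Sigma\to\mathbb{R}$ is bounded below, and $c(x,P):=\int\ell(x,\xi)\,\mathrm{d}P(\xi)$. For $P\in\mathcal{P}(\Sigma)$, $\xi_1,\xi_2,\dots$ are i.i.d. samples from $P$, $P_N:=\frac1N\sum_{i=1}^N\delta_{\xi_i}$, and $\mathrm{Prob}$ is the probability under this sampling; $\log0=-\infty$. A predictor is a function $\hat c:X\times\mathcal{P}(\Sigma)\to\mathbb{R}$; $\mathcal{C}_u(X\times\mathcal{P}(\Sigma))$ is the set of predictors with $\hat P\mapsto\hat c(x,\hat P)$ upper semicontinuous for each $x\in X$. $\hat c$ is uniformly feasible at rate $r$ if $\sup_{P\in\mathcal{P}(\Sigma)}\limsup_{N\to\infty}\frac1N\log\mathrm{Prob}[\exists x\in X:c(x,P)>\hat c(x,P_N)]\le-r$, and pointwise feasible at rate $r$ if $\sup_{P\in\mathcal{P}(\Sigma),\,x\in X}\limsup_{N\to\infty}\frac1N\log\mathrm{Prob}[c(x,P)>\hat c(x,P_N)]\le-r$. $W(P',P)=\inf\{\int\|\xi'-\xi\|\,\mathrm{d}\gamma(\xi',\xi):\gamma\in\Gamma(P',P)\}$ is the Wasserstein distance ($\Gamma(P',P)$: couplings of $P'$ and $P$). $\mathrm{LP}(P',P)=\inf\{\epsilon>0: P(S)\le P'(S^\epsilon)+\epsilon,\ P'(S)\le P(S^\epsilon)+\epsilon\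 \text{for all Borel } S\subseteq\Sigma\}$, with $S^\epsilon=\{\xi'\in\Sigma:\|\xi'-\xi\|\le\epsilon\text{ for some }\xi\in S\}$. $D_{\mathrm{KL}}(P',P)=\int\log\frac{\mathrm{d}P'}{\mathrm{d}P}\,\mathrm{d}P'$ if $P'\ll P$ and $+\infty$ otherwise. $D^{\epsilon}_{\mathrm{KL},W}(P',P)=\inf\{D_{\mathrm{KL}}(Q,P):Q\in\mathcal{P}(\Sigma),\ W(P',Q)\le\epsilon\}$, $D^{\epsilon}_{\mathrm{KL},\mathrm{LP}}(P',P)=\inf\{D_{\mathrm{KL}}(Q,P):Q\in\mathcal{P}(\Sigma),\ \mathrm{LP}(P',Q)\le\epsilon\}$. The predictors $\hat c_{\mathrm{KL},r}(x,\hat P)$, $\hat c^{\epsilon}_{\mathrm{KL},W,r}(x,\hat P)$, $\hat c^{\epsilon}_{\mathrm{KL},\mathrm{LP},r}(x,\hat P)$ are the suprema of $c(x,P)$ over $P\in\mathcal{P}(\Sigma)$ subject to $D_{\mathrm{KL}}(\hat P,P)\le r$, $D^{\epsilon}_{\mathrm{KL},W}(\hat P,P)\le r$, $D^{\epsilon}_{\mathrm{KL},\mathrm{LP}}(\hat P,P)\le r$ respectively. *)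

theory Defs
  imports "HOL-Probability.Probability"
begin

definition borel_probs :: "'a::topological_space set \<Rightarrow> 'a measure set" where
  "borel_probs \<Sigma> = {P. prob_space P \<and> sets P = sets (restrict_space borel \<Sigma>)}"

text \<open>The coarsest topology on \<open>borel_probs \<Sigma>\<close> for which the integrals of bounded
  continuous functions on \<open>\<Sigma>\<close> are continuous.\<close>

definition weak_topology :: "'a::topological_space set \<Rightarrow> 'a measure topology" where
  "weak_topology \<Sigma> = topology_generated_by
     {{P \<in> borel_probs \<Sigma>. (\<integral>\<xi>. f \<xi> \<partial>P) \<in> U} | (f :: 'a \<Rightarrow> real) U.
        continuous_on \<Sigma> f \<and> bounded (f ` \<Sigma>) \<and> open U}"

lemma topspace_weak_topology [simp]: "topspace (weak_topology \<Sigma>) = borel_probs \<Sigma>"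
proof -
  have "borel_probs \<Sigma> = {P \<in> borel_probs \<Sigma>. (\<integral>\<xi>. (\<lambda>_. 0 :: real) \<xi> \<partial>P) \<in> UNIV}
      \<and> continuous_on \<Sigma> (\<lambda>_. 0 :: real) \<and> bounded ((\<lambda>_. 0 :: real) ` \<Sigma>) \<and> open (UNIV :: real set)"
    by (auto intro!: boundedI)
  then show ?thesis
    unfolding weak_topology_def topology_generated_by_topspace by blast
qed

definition usc_map :: "'a topology \<Rightarrow> ('a \<Rightarrow> real) \<Rightarrow> bool" where
  "usc_map T f \<longleftrightarrow> (\<forall>a. openin T {x \<in> topspace T. f x < a})"

definition expected_loss :: "('x \<Rightarrow> 'a \<Rightarrow> real) \<Rightarrow> 'x \<Rightarrow> 'a measure \<Rightarrow> real" where
  "expected_loss loss x P = (\<integral>\<xi>. loss x \<xi> \<partial>P)"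

definition usc_predictors :: "'x set \<Rightarrow> 'a::topological_space set \<Rightarrow> ('x \<Rightarrow> 'a measure \<Rightarrow> real) set" where
  "usc_predictors X \<Sigma> = {c. \<forall>x\<in>X. usc_map (weak_topology \<Sigma>) (c x)}"


subsection \<open>Feasibility\<close>

text \<open>The empirical distribution is encoded as the law of \<open>\<omega> i\<close> for \<open>i\<close> uniform on \<open>{..<N}\<close>;
  the lemma below is the usual formula.\<close>

definition empirical :: "'a::topological_space set \<Rightarrow> nat \<Rightarrow> (nat \<Rightarrow> 'a) \<Rightarrow> 'a measure" where
  "empirical \<Sigma> N \<omega> = distr (uniform_count_measure {..<N}) (restrict_space borel \<Sigma>) \<omega>"

lemma emeasure_empirical:
  assumes "N > 0" "\<And>i. i < N \<Longrightarrow> \<omega> i \<in> \<Sigma>" "S \<in> sets (restrict_space borel \<Sigma>)"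
  shows "emeasure (empirical \<Sigma> N \<omega>) S = ennreal (1 / N * (\<Sum>i<N. indicator S (\<omega> i)))"
proof -
  have "emeasure (empirical \<Sigma> N \<omega>) S
      = emeasure (uniform_count_measure {..<N}) (\<omega> -` S \<inter> {..<N})"
    unfolding empirical_def using assms
    by (subst emeasure_distr) (auto simp: measurable_def space_uniform_count_measure
        sets_uniform_count_measure space_restrict_space)
  also have "\<dots> = ennreal (card (\<omega> -` S \<inter> {..<N}) / N)"
    using assms(1) by (subst emeasure_uniform_count_measure) auto
  also have "real (card (\<omega> -` S \<inter> {..<N})) = (\<Sum>i<N. indicator S (\<omega> i))"
    by (simp add: indicator_def sum.If_cases vimage_def Int_def conj_commute)
  finally show ?thesis by simp
qed

definition log_prob :: "real \<Rightarrow> ereal" where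
  "log_prob p = (if p = 0 then -\<infinity> else ereal (ln p))"

definition decay_rate :: "'a measure \<Rightarrow> (nat \<Rightarrow> (nat \<Rightarrow> 'a) set) \<Rightarrow> ereal" where
  "decay_rate P E = limsup (\<lambda>N. ereal (1 / N) *
     log_prob (measure (PiM UNIV (\<lambda>_::nat. P)) (E N)))"

text \<open>For predictors in \<open>usc_predictors X \<Sigma>\<close> the events below are measurable: the sets
  \<open>{Q. expected_loss loss x P > c x Q}\<close> are weakly open, so their union over \<open>x\<close> is open too,
  and \<open>empirical \<Sigma> N\<close> is continuous in the samples.\<close>

definition uniformly_feasible ::
    "'x set \<Rightarrow> 'a::topological_space set \<Rightarrow> ('x \<Rightarrow> 'a \<Rightarrow> real) \<Rightarrow> real \<Rightarrow> ('x \<Rightarrow> 'a measure \<Rightarrow> real) \<Rightarrow> bool" where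
  "uniformly_feasible X \<Sigma> loss r c \<longleftrightarrow>
     (SUP P\<in>borel_probs \<Sigma>. decay_rate P (\<lambda>N. {\<omega> \<in> space (PiM UNIV (\<lambda>_::nat. P)).
        \<exists>x\<in>X. expected_loss loss x P > c x (empirical \<Sigma> N \<omega>)})) \<le> ereal (- r)"

definition pointwise_feasible ::
    "'x set \<Rightarrow> 'a::topological_space set \<Rightarrow> ('x \<Rightarrow> 'a \<Rightarrow> real) \<Rightarrow> real \<Rightarrow> ('x \<Rightarrow> 'a measure \<Rightarrow> real) \<Rightarrow> bool" where
  "pointwise_feasible X \<Sigma> loss r c \<longleftrightarrow>
     (SUP (P, x)\<in>borel_probs \<Sigma> \<times> X. decay_rate P (\<lambda>N. {\<omega> \<in> space (PiM UNIV (\<lambda>_::nat. P)).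
        expected_loss loss x P > c x (empirical \<Sigma> N \<omega>)})) \<le> ereal (- r)"

text \<open>\<open>F\<close> is the notion of feasibility.\<close>

definition least_conservative ::
    "'x set \<Rightarrow> 'a::topological_space set \<Rightarrow> (('x \<Rightarrow> 'a measure \<Rightarrow> real) \<Rightarrow> bool) \<Rightarrow> ('x \<Rightarrow> 'a measure \<Rightarrow> real) \<Rightarrow> bool" where
  "least_conservative X \<Sigma> F c \<longleftrightarrow> c \<in> usc_predictors X \<Sigma> \<and> F c \<and>
     (\<forall>c'\<in>usc_predictors X \<Sigma>. F c' \<longrightarrow> (\<forall>x\<in>X. \<forall>Q\<in>borel_probs \<Sigma>. c x Q \<le> c' x Q))"


subsection \<open>Distances and divergences\<close>

definition couplings :: "'a measure \<Rightarrow> 'a measure \<Rightarrow> ('a \<times> 'a) measure set" where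
  "couplings P' P = {\<gamma>. sets \<gamma> = sets (P' \<Otimes>\<^sub>M P) \<and> distr \<gamma> P' fst = P' \<and> distr \<gamma> P snd = P}"

definition wasserstein :: "'a::real_normed_vector measure \<Rightarrow> 'a measure \<Rightarrow> ennreal" where
  "wasserstein P' P = (INF \<gamma>\<in>couplings P' P. \<integral>\<^sup>+ (\<xi>', \<xi>). ennreal (norm (\<xi>' - \<xi>)) \<partial>\<gamma>)"

definition enlarge :: "'a::real_normed_vector set \<Rightarrow> real \<Rightarrow> 'a set \<Rightarrow> 'a set" where
  "enlarge \<Sigma> \<epsilon> S = {\<xi>' \<in> \<Sigma>. \<exists>\<xi>\<in>S. norm (\<xi>' - \<xi>) \<le> \<epsilon>}"

text \<open>For a Borel set \<open>S\<close>, \<open>enlarge \<Sigma> \<epsilon> S\<close> need not be Borel, but it is analytic when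
  \<open>\<Sigma>\<close> is Borel, hence universally measurable. Its mass under the completion is its outer
  measure, whereas \<^const>\<open>emeasure\<close> would be 0 on a non-Borel set.\<close>

definition levy_prokhorov :: "'a::real_normed_vector set \<Rightarrow> 'a measure \<Rightarrow> 'a measure \<Rightarrow> real" where
  "levy_prokhorov \<Sigma> P' P = Inf {\<epsilon>. \<epsilon> > 0 \<and> (\<forall>S\<in>sets (restrict_space borel \<Sigma>).
     emeasure P S \<le> outer_measure_of P' (enlarge \<Sigma> \<epsilon> S) + ennreal \<epsilon> \<and>
     emeasure P' S \<le> outer_measure_of P (enlarge \<Sigma> \<epsilon> S) + ennreal \<epsilon>)}"

text \<open>In the library the reference measure is the first argument of
  \<^const>\<open>absolutely_continuous\<close>, \<^const>\<open>entropy_density\<close> and \<^const>\<open>KL_divergence\<close>.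
  The negative part of the log-density is always \<open>P'\<close>-integrable, so if the log-density is not
  integrable its extended integral is \<open>\<infinity>\<close>.\<close>

definition D_KL :: "'a measure \<Rightarrow> 'a measure \<Rightarrow> ereal" where
  "D_KL P' P = (if absolutely_continuous P P' \<and> integrable P' (entropy_density (exp 1) P P')
     then ereal (KL_divergence (exp 1) P P') else \<infinity>)"

definition D_KL_W :: "'a::real_normed_vector set \<Rightarrow> real \<Rightarrow> 'a measure \<Rightarrow> 'a measure \<Rightarrow> ereal" where
  "D_KL_W \<Sigma> \<epsilon> P' P = (INF Q\<in>{Q \<in> borel_probs \<Sigma>. wasserstein P' Q \<le> ennreal \<epsilon>}. D_KL Q P)"

definition D_KL_LP :: "'a::real_normed_vector set \<Rightarrow> real \<Rightarrow> 'a measure \<Rightarrow> 'a measure \<Rightarrow> ereal" where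
  "D_KL_LP \<Sigma> \<epsilon> P' P = (INF Q\<in>{Q \<in> borel_probs \<Sigma>. levy_prokhorov \<Sigma> P' Q \<le> \<epsilon>}. D_KL Q P)"


subsection \<open>Distributionally robust predictors\<close>

text \<open>The supremum is taken in the reals. For compact \<open>\<Sigma>\<close>, upper semicontinuous loss and
  \<open>r \<ge> 0\<close> it is over a nonempty set (it contains the expectation under \<open>Q\<close> itself) that is
  bounded above.\<close>

definition dro_predictor ::
    "'a::topological_space set \<Rightarrow> ('x \<Rightarrow> 'a \<Rightarrow> real) \<Rightarrow> ('a measure \<Rightarrow> 'a measure \<Rightarrow> ereal) \<Rightarrow> real \<Rightarrow> 'x \<Rightarrow> 'a measure \<Rightarrow> real" where
  "dro_predictor \<Sigma> loss D r x Q = (SUP P\<in>{P \<in> borel_probs \<Sigma>. D Q P \<le> ereal r}. expected_loss loss x P)"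

definition c_KL :: "'a::topological_space set \<Rightarrow> ('x \<Rightarrow> 'a \<Rightarrow> real) \<Rightarrow> real \<Rightarrow> 'x \<Rightarrow> 'a measure \<Rightarrow> real" where
  "c_KL \<Sigma> loss = dro_predictor \<Sigma> loss D_KL"

definition c_KL_W :: "'a::real_normed_vector set \<Rightarrow> ('x \<Rightarrow> 'a \<Rightarrow> real) \<Rightarrow> real \<Rightarrow> real \<Rightarrow> 'x \<Rightarrow> 'a measure \<Rightarrow> real" where
  "c_KL_W \<Sigma> loss \<epsilon> = dro_predictor \<Sigma> loss (D_KL_W \<Sigma> \<epsilon>)"

definition c_KL_LP :: "'a::real_normed_vector set \<Rightarrow> ('x \<Rightarrow> 'a \<Rightarrow> real) \<Rightarrow> real \<Rightarrow> real \<Rightarrow> 'x \<Rightarrow> 'a measure \<Rightarrow> real" where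
  "c_KL_LP \<Sigma> loss \<epsilon> = dro_predictor \<Sigma> loss (D_KL_LP \<Sigma> \<epsilon>)"

end

theory Submission
  imports Defs
begin

text \<open>Write \<open>l\<close> for the loss at a fixed decision and \<open>M\<close> for its maximum. The argument rests on the dual formula
  \<open>c_KL(Q) = inf {\<alpha> - exp (\<integral> ln (\<alpha> - l) dQ - r) | \<alpha> > M}\<close>, which replaces compactness of the space of measures
  and Sanov's upper bound.

  The function \<open>ln (\<alpha> - l)\<close> is lower semicontinuous, hence an increasing limit of Lipschitz functions, so
  each dual expression changes little in the unfavourable direction over a small Wasserstein or
  Levy-Prokhorov ball. As weak duality bounds the smoothed predictors by the dual expression over such a
  ball, they converge to \<open>c_KL\<close>.

  The inequality \<open>c_KL \<le> c\<close> is the lower bound of Sanov's theorem: if \<open>c(Q) < \<integral> l dP\<close> with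
  \<open>D_KL(Q, P) < r\<close>, then under \<open>P\<close> the empirical distribution falls into the open set
  \<open>{c < \<integral> l dP}\<close> around \<open>Q\<close> with probability decaying more slowly than \<open>exp (- r N)\<close>.

  Conversely, each dual expression is itself an upper semicontinuous feasible predictor, by Markov's
  inequality. A least conservative predictor therefore lies below all of them, that is, below \<open>c_KL\<close>, and
  so coincides with it.\<close>

subsection \<open>Relative entropy\<close>

text \<open>Weak duality is the Donsker-Varadhan inequality with the test function ln (\<alpha> -
  l). Equality asks for P proportional to Q / (\<alpha> - l), and the free parameter \<alpha> is
  then fixed by the stationarity of the dual expression. A stationary \<alpha> may fail to exist:
  the infimum is then approached as \<alpha> decreases to M, and the worst-case distribution has to
  carry an atom at a maximiser of the loss.

  The same expression fits Markov's inequality, because N times the empirical mean of ln (\<alpha> -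
  l) is the logarithm of the product of the \<alpha> - l (\<xi> i), whose expectation under P is the
  N-th power of \<alpha> - \<integral> l dP.

  This argument shows feasibility for one fixed \<alpha> only. In \<open>c_KL\<close> the best
  \<alpha> varies with the empirical distribution, so feasibility of \<open>c_KL\<close> does not
  follow directly from that of the single expressions. It is therefore extracted from the existence
  of a least conservative predictor.\<close>

lemma ln_le_id: "x > 0 \<Longrightarrow> ln x \<le> (x::real)"
  using ln_le_minus_one[of x] by simp

lemma AE_real_RN_deriv:
  assumes "prob_space P" "prob_space Q" "sets Q = sets P" "absolutely_continuous P Q"
  obtains f :: "'a \<Rightarrow> real" where "f \<in> borel_measurable P" "\<forall>x. 0 \<le> f x"
    "Q = density P (\<lambda>x. ennreal (f x))" "AE x in Q. 0 < f x"
    "AE x in Q. entropy_density (exp 1) P Q x = ln (f x)"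
    "integrable Q (\<lambda>x. 1 / f x)"
    "\<forall>A\<in>sets P. (\<integral>\<^sup>+x. ennreal (1 / f x) * indicator A x \<partial>Q) \<le> emeasure P A"
proof -
  interpret P: prob_space P by fact
  interpret Q: prob_space Q by fact
  obtain f where f: "f \<in> borel_measurable P" "AE x in P. RN_deriv P Q x = ennreal (f x)"
    "AE x in Q. 0 < f x" "\<forall>x. 0 \<le> f x"
    using P.real_RN_deriv[OF Q.finite_measure_axioms assms(4,3)] by auto
  note [measurable] = f(1) and [measurable_cong] = assms(3)
  have fQ: "f \<in> borel_measurable Q"
    by measurable
  have Q: "Q = density P (\<lambda>x. ennreal (f x))"
    using P.density_RN_deriv[OF assms(4,3)] density_cong[of "RN_deriv P Q" P "\<lambda>x. ennreal (f x)"] f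
    by simp
  have "AE x in Q. RN_deriv P Q x = ennreal (f x)"
    using absolutely_continuous_AE[OF assms(3,4) f(2)] .
  then have ln: "AE x in Q. entropy_density (exp 1) P Q x = ln (f x)"
    by eventually_elim (use f(4) in \<open>simp add: entropy_density_def log_def\<close>)
  have le: "(\<integral>\<^sup>+x. ennreal (1 / f x) * indicator A x \<partial>Q) \<le> emeasure P A" if A[measurable]: "A \<in> sets P" for A
  proof -
    have "(\<integral>\<^sup>+x. ennreal (1 / f x) * indicator A x \<partial>Q)
        = (\<integral>\<^sup>+x. ennreal (f x) * (ennreal (1 / f x) * indicator A x) \<partial>P)"
      by (subst Q, subst nn_integral_density) measurable
    also have "\<dots> \<le> (\<integral>\<^sup>+x. indicator A x \<partial>P)"
      using f(4) by (intro nn_integral_mono) (auto simp: indicator_def ennreal_mult[symmetric])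
    finally show ?thesis by simp
  qed
  have "(\<integral>\<^sup>+x. ennreal (1 / f x) \<partial>Q) = (\<integral>\<^sup>+x. ennreal (1 / f x) * indicator (space P) x \<partial>Q)"
    using sets_eq_imp_space_eq[OF assms(3)] by (intro nn_integral_cong) auto
  also have "\<dots> \<le> 1" using le[of "space P"] P.emeasure_space_1 by simp
  finally have "(\<integral>\<^sup>+x. ennreal (1 / f x) \<partial>Q) < \<infinity>"
    using ennreal_one_less_top by (metis infinity_ennreal_def le_less_trans)
  then have i: "integrable Q (\<lambda>x. 1 / f x)"
    by (intro integrableI_nonneg) (use f(4) in auto)
  have "\<forall>x. 0 \<le> f x" and "\<forall>A\<in>sets P. (\<integral>\<^sup>+x. ennreal (1 / f x) * indicator A x \<partial>Q) \<le> emeasure P A"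
    using f(4) le by auto
  from that[OF f(1) this(1) Q f(3) ln i this(2)] show ?thesis .
qed

text \<open>For \<open>f\<close> = dQ/dP the hypothesis \<open>le\<close> heuristically says f w
  \<le> 1, whence ln f \<le> - ln w. A minorant of \<open>P\<close> with respect to \<open>Q\<close>
  suffices, so divergences from mixtures and from measures with an extra atom are bounded without
  computing dQ/dP.\<close>

lemma D_KL_le:
  fixes w :: "'a \<Rightarrow> real"
  assumes "prob_space P" "prob_space Q" "sets Q = sets P"
    and w: "w \<in> borel_measurable Q" "AE x in Q. w x > 0" "integrable Q (\<lambda>x. ln (w x))"
    and le: "\<And>A. A \<in> sets P \<Longrightarrow> emeasure (density Q (\<lambda>x. ennreal (w x))) A \<le> emeasure P A"
  shows "D_KL Q P \<le> ereal (- (\<integral>x. ln (w x) \<partial>Q))"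
proof -
  interpret P: prob_space P by fact
  interpret Q: prob_space Q by fact
  note [measurable] = w(1) and [measurable_cong] = assms(3)
  have ac: "absolutely_continuous P Q"
    unfolding absolutely_continuous_def
  proof
    fix A assume A: "A \<in> null_sets P"
    then have [measurable]: "A \<in> sets P" by auto
    from A le[of A] have "emeasure (density Q (\<lambda>x. ennreal (w x))) A = 0" by auto
    then have "A \<in> null_sets (density Q (\<lambda>x. ennreal (w x)))" using assms(3) by auto
    then have "AE x in Q. x \<in> A \<longrightarrow> w x \<le> 0"
      using assms(3) by (auto simp: null_sets_density_iff ennreal_eq_0_iff)
    with w(2) have "AE x in Q. x \<notin> A" by eventually_elim auto
    then show "A \<in> null_sets Q" using assms(3) by (simp add: AE_iff_null_sets)
  qed
  obtain f where f: "f \<in> borel_measurable P" "\<forall>x. 0 \<le> f x"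
    "Q = density P (\<lambda>x. ennreal (f x))" "AE x in Q. 0 < f x"
    "AE x in Q. entropy_density (exp 1) P Q x = ln (f x)"
    "integrable Q (\<lambda>x. 1 / f x)"
    "\<forall>A\<in>sets P. (\<integral>\<^sup>+x. ennreal (1 / f x) * indicator A x \<partial>Q) \<le> emeasure P A"
    by (rule AE_real_RN_deriv[OF assms(1-3) ac])
  note [measurable] = f(1)
  have fm: "f \<in> borel_measurable Q" by measurable
  have "(\<integral>\<^sup>+x. ennreal (f x * w x) \<partial>Q) = (\<integral>\<^sup>+x. ennreal (w x) * ennreal (f x) \<partial>Q)"
    using w(2) f(2) by (intro nn_integral_cong_AE) (auto simp: ennreal_mult mult.commute)
  also have "\<dots> = (\<integral>\<^sup>+x. ennreal (f x) \<partial>density Q (\<lambda>x. ennreal (w x)))"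
    by (subst nn_integral_density) auto
  also have "\<dots> \<le> (\<integral>\<^sup>+x. ennreal (f x) \<partial>P)"
    using le assms(3) by (intro nn_integral_mono_measure) (auto simp: le_measure)
  also have "\<dots> = emeasure Q (space P)"
    unfolding arg_cong[OF f(3), of "\<lambda>M. emeasure M (space P)"]
    by (subst emeasure_density) (auto intro!: nn_integral_cong)
  also have "\<dots> = 1" using Q.emeasure_space_1 sets_eq_imp_space_eq[OF assms(3)] by simp
  finally have fw: "(\<integral>\<^sup>+x. ennreal (f x * w x) \<partial>Q) \<le> 1" .
  have nn: "AE x in Q. 0 \<le> f x * w x" using w(2) f(2) by (auto simp: mult_nonneg_nonneg)
  have int: "integrable Q (\<lambda>x. f x * w x)"
    using nn fw by (intro integrableI_nonneg) (auto intro: le_less_trans)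
  have "ennreal (\<integral>x. f x * w x \<partial>Q) \<le> 1"
    using fw nn_integral_eq_integral[OF int nn] by simp
  then have le1: "(\<integral>x. f x * w x \<partial>Q) \<le> 1" by simp
  \<comment> \<open>Both bounds are instances of ln y \<le> y - 1. With y = f w, the integral of f w
    - 1 is at most 0 by \<open>le1\<close>; with y = 1 / f, ln f is bounded below by an integrable
    function.\<close>
  have bd: "AE x in Q. ln (f x) \<le> f x * w x - 1 - ln (w x) \<and> - ln (f x) \<le> 1 / f x"
    using w(2) f(4)
  proof eventually_elim
    case (elim x)
    then show ?case using ln_le_minus_one[of "f x * w x"] ln_le_minus_one[of "1 / f x"]
      by (auto simp: ln_mult ln_div)
  qed
  have int_ln: "integrable Q (\<lambda>x. ln (f x))"
  proof (rule Bochner_Integration.integrable_bound)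
    show "integrable Q (\<lambda>x. \<bar>f x * w x - 1 - ln (w x)\<bar> + 1 / f x)"
      using int w(3) f(6) by auto
    show "AE x in Q. norm (ln (f x)) \<le> norm (\<bar>f x * w x - 1 - ln (w x)\<bar> + 1 / f x)"
      using bd f(4)
    proof eventually_elim
      case (elim x)
      then have "0 < 1 / f x" by simp
      with elim show ?case unfolding real_norm_def by linarith
    qed
  qed measurable
  have edm: "entropy_density (exp 1) P Q \<in> borel_measurable Q" by measurable
  have int_ed: "integrable Q (entropy_density (exp 1) P Q)"
    using integrable_cong_AE[OF edm _ f(5)] int_ln by simp
  have "KL_divergence (exp 1) P Q = (\<integral>x. ln (f x) \<partial>Q)"
    unfolding KL_divergence_def using f(5) by (intro integral_cong_AE) (use edm in auto)
  also have "\<dots> \<le> (\<integral>x. f x * w x - 1 - ln (w x) \<partial>Q)"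
    using bd int int_ln w(3) by (intro integral_mono_AE) auto
  also have "\<dots> \<le> - (\<integral>x. ln (w x) \<partial>Q)"
    using int w(3) le1 by (simp add: Q.prob_space)
  finally show ?thesis using ac int_ed by (simp add: D_KL_def)
qed

lemma D_KL_finiteE:
  assumes "prob_space P" "prob_space Q" "sets Q = sets P" "D_KL Q P \<le> ereal s"
  obtains f :: "'a \<Rightarrow> real" where "f \<in> borel_measurable P" "\<forall>x. 0 \<le> f x"
    "Q = density P (\<lambda>x. ennreal (f x))" "AE x in Q. 0 < f x"
    "integrable Q (\<lambda>x. ln (f x))" "(\<integral>x. ln (f x) \<partial>Q) \<le> s"
    "integrable Q (\<lambda>x. 1 / f x)"
    "\<forall>A\<in>sets P. (\<integral>\<^sup>+x. ennreal (1 / f x) * indicator A x \<partial>Q) \<le> emeasure P A"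
proof -
  from assms(4) have ac: "absolutely_continuous P Q"
    and i: "integrable Q (entropy_density (exp 1) P Q)"
    and s: "(\<integral>x. entropy_density (exp 1) P Q x \<partial>Q) \<le> s"
    unfolding D_KL_def KL_divergence_def by (auto split: if_splits)
  obtain f where f: "f \<in> borel_measurable P" "\<forall>x. 0 \<le> f x"
    "Q = density P (\<lambda>x. ennreal (f x))" "AE x in Q. 0 < f x"
    "AE x in Q. entropy_density (exp 1) P Q x = ln (f x)"
    "integrable Q (\<lambda>x. 1 / f x)"
    "\<forall>A\<in>sets P. (\<integral>\<^sup>+x. ennreal (1 / f x) * indicator A x \<partial>Q) \<le> emeasure P A"
    by (rule AE_real_RN_deriv[OF assms(1-3) ac])
  note [measurable] = f(1) and [measurable_cong] = assms(3)
  have m: "entropy_density (exp 1) P Q \<in> borel_measurable Q" "(\<lambda>x. ln (f x)) \<in> borel_measurable Q" by measurable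
  have "integrable Q (\<lambda>x. ln (f x))" "(\<integral>x. ln (f x) \<partial>Q) \<le> s"
    using i s integrable_cong_AE[OF m f(5)] integral_cong_AE[OF m f(5)] by auto
  from that[OF f(1-4) this f(6,7)] show ?thesis .
qed

text \<open>The Donsker-Varadhan inequality for the test function ln g, in exponential form. By
  Jensen, \<integral> ln (g / f) dQ \<le> ln \<integral> g / f dQ, and g / f has
  \<open>Q\<close>-integral at most \<integral> g dP because f (g / f) \<le> g, also where f =
  0.\<close>

lemma D_KL_dual_bound:
  fixes g :: "'a \<Rightarrow> real"
  assumes "prob_space P" "prob_space Q" "sets Q = sets P" "D_KL Q P \<le> ereal s"
    and g: "\<And>x. x \<in> space P \<Longrightarrow> g x > 0" "integrable P g" "integrable Q (\<lambda>x. ln (g x))"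
  shows "exp ((\<integral>x. ln (g x) \<partial>Q) - s) \<le> (\<integral>x. g x \<partial>P)"
proof -
  interpret P: prob_space P by fact
  interpret Q: prob_space Q by fact
  obtain f where f: "f \<in> borel_measurable P" "\<forall>x. 0 \<le> f x"
    "Q = density P (\<lambda>x. ennreal (f x))" "AE x in Q. 0 < f x"
    "integrable Q (\<lambda>x. ln (f x))" "(\<integral>x. ln (f x) \<partial>Q) \<le> s"
    "integrable Q (\<lambda>x. 1 / f x)"
    "\<forall>A\<in>sets P. (\<integral>\<^sup>+x. ennreal (1 / f x) * indicator A x \<partial>Q) \<le> emeasure P A"
    by (rule D_KL_finiteE[OF assms(1-4)])
  have [measurable]: "f \<in> borel_measurable P" "g \<in> borel_measurable P" using f g by auto
  define c where "c = (\<integral>x. g x \<partial>P)"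
  have "c > 0"
  proof -
    have "c \<noteq> 0"
    proof
      assume "c = 0"
      then have "AE x in P. g x = 0"
        unfolding c_def using g by (subst (asm) integral_nonneg_eq_0_iff_AE) (auto simp: less_imp_le)
      then have "AE x in P. False" by (rule AE_mp, intro AE_I2 impI) (use g(1) in fastforce)
      then show False by simp
    qed
    moreover have "c \<ge> 0" unfolding c_def using g(1) by (intro integral_nonneg_AE) (auto simp: less_imp_le)
    ultimately show ?thesis by simp
  qed
  have spQ: "space Q = space P" using sets_eq_imp_space_eq[OF assms(3)] .
  have "(\<lambda>x. f x * (g x / f x)) \<in> borel_measurable P" by measurable
  then have ifg: "integrable P (\<lambda>x. f x * (g x / f x))"
    by (rule Bochner_Integration.integrable_bound[OF g(2)]) (auto intro!: AE_I2)
  then have igf: "integrable Q (\<lambda>x. g x / f x)"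
    using ifg by (subst f(3), subst integrable_real_density) (auto simp: f(2))
  have "(\<integral>x. g x / f x \<partial>Q) = (\<integral>x. f x * (g x / f x) \<partial>P)"
    by (subst f(3), subst integral_real_density) (auto simp: f(2))
  also have "\<dots> \<le> c"
    unfolding c_def using ifg g by (intro integral_mono) (auto simp: less_imp_le)
  finally have le: "(\<integral>x. g x / f x \<partial>Q) \<le> c" .
  define u where "u x = g x / f x" for x
  have iu: "integrable Q u" and leu: "(\<integral>x. u x \<partial>Q) \<le> c" using igf le by (auto simp: u_def[abs_def])
  have "(\<integral>x. ln (g x) \<partial>Q) - (\<integral>x. ln (f x) \<partial>Q) = (\<integral>x. ln (g x) - ln (f x) \<partial>Q)"
    using g f by simp
  \<comment> \<open>Jensen's inequality through the tangent of ln at \<open>c\<close>: ln u \<le> u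
    / c - 1 + ln c.\<close>
  also have "\<dots> \<le> (\<integral>x. u x / c - 1 + ln c \<partial>Q)"
  proof (intro integral_mono_AE)
    show "AE x in Q. ln (g x) - ln (f x) \<le> u x / c - 1 + ln c"
      using f(4)
    proof (rule AE_mp, intro AE_I2 impI)
      fix x assume "x \<in> space Q" "0 < f x"
      then show "ln (g x) - ln (f x) \<le> u x / c - 1 + ln c"
        using ln_le_minus_one[of "g x / f x / c"] g(1)[of x] \<open>c > 0\<close> spQ by (simp add: ln_div ln_mult u_def)
    qed
    show "integrable Q (\<lambda>x. u x / c - 1 + ln c)"
      by (intro Bochner_Integration.integrable_add Bochner_Integration.integrable_diff
          integrable_divide iu) auto
  qed (use g f in auto)
  also have "\<dots> = (\<integral>x. u x \<partial>Q) / c - 1 + ln c"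
    using iu by (simp add: Q.prob_space)
  also have "\<dots> \<le> ln c" using leu \<open>c > 0\<close> by (simp add: divide_le_eq)
  finally have "(\<integral>x. ln (g x) \<partial>Q) - s \<le> ln c" using f(6) by linarith
  then have "exp ((\<integral>x. ln (g x) \<partial>Q) - s) \<le> exp (ln c)" by simp
  with \<open>c > 0\<close> show ?thesis by (simp add: c_def)
qed

subsection \<open>The weak law of large numbers\<close>

lemma indep_vars_PiM_coordinates:
  assumes "prob_space Q" "h \<in> borel_measurable Q"
  shows "prob_space.indep_vars (PiM UNIV (\<lambda>_::nat. Q)) (\<lambda>_. borel) (\<lambda>i \<omega>. h (\<omega> i)) {..<N}"
proof -
  interpret Q: prob_space Q by fact
  interpret product_prob_space "\<lambda>_::nat. Q" UNIV by unfold_locales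
  note [measurable] = assms(2)
  show ?thesis
  proof (cases "N = 0")
    case True
    then show ?thesis by (simp add: P.indep_vars_def P.indep_sets_def)
  next
    case False
    have "P.indep_vars (\<lambda>_. Q) (\<lambda>i \<omega>. \<omega> i) {..<N}"
    proof (subst P.indep_vars_iff_distr_eq_PiM')
      show "distr (Pi\<^sub>M UNIV (\<lambda>_. Q)) (Pi\<^sub>M {..<N} (\<lambda>_. Q)) (\<lambda>x. \<lambda>i\<in>{..<N}. x i) =
          Pi\<^sub>M {..<N} (\<lambda>i. distr (Pi\<^sub>M UNIV (\<lambda>_. Q)) Q (\<lambda>\<omega>. \<omega> i))"
        using distr_PiM_restrict_finite[of "{..<N}"] PiM_component by (simp add: restrict_def)
    qed (use False in auto)
    then show ?thesis by (rule P.indep_vars_compose2) measurable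
  qed
qed

lemma
  fixes h :: "'a \<Rightarrow> real"
  assumes "prob_space Q" "integrable Q h"
  shows integrable_PiM_coordinate: "integrable (PiM UNIV (\<lambda>_::nat. Q)) (\<lambda>\<omega>. h (\<omega> i))"
    and integral_PiM_coordinate: "(\<integral>\<omega>. h (\<omega> i) \<partial>PiM UNIV (\<lambda>_::nat. Q)) = (\<integral>x. h x \<partial>Q)"
proof -
  interpret Q: prob_space Q by fact
  interpret product_prob_space "\<lambda>_::nat. Q" UNIV by unfold_locales
  have [measurable]: "h \<in> borel_measurable Q" using assms by auto
  have d: "distr (PiM UNIV (\<lambda>_::nat. Q)) Q (\<lambda>\<omega>. \<omega> i) = Q" using PiM_component by simp
  have "integrable (distr (PiM UNIV (\<lambda>_::nat. Q)) Q (\<lambda>\<omega>. \<omega> i)) h" using assms d by simp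
  then show "integrable (PiM UNIV (\<lambda>_::nat. Q)) (\<lambda>\<omega>. h (\<omega> i))"
    by (subst (asm) integrable_distr_eq) auto
  have "(\<integral>x. h x \<partial>Q) = (\<integral>x. h x \<partial>distr (PiM UNIV (\<lambda>_::nat. Q)) Q (\<lambda>\<omega>. \<omega> i))" using d by simp
  also have "\<dots> = (\<integral>\<omega>. h (\<omega> i) \<partial>PiM UNIV (\<lambda>_::nat. Q))" by (subst integral_distr) auto
  finally show "(\<integral>\<omega>. h (\<omega> i) \<partial>PiM UNIV (\<lambda>_::nat. Q)) = (\<integral>x. h x \<partial>Q)" by simp
qed

lemma weak_law_bounded:
  fixes h :: "'a \<Rightarrow> real"
  assumes "prob_space Q" and [measurable]: "h \<in> borel_measurable Q"
    and B: "\<And>x. x \<in> space Q \<Longrightarrow> \<bar>h x\<bar> \<le> B" and "\<delta> > 0"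
  shows "(\<lambda>N. measure (PiM UNIV (\<lambda>_::nat. Q)) {\<omega> \<in> space (PiM UNIV (\<lambda>_::nat. Q)).
      \<delta> \<le> \<bar>(\<Sum>i<N. h (\<omega> i)) / real N - (\<integral>x. h x \<partial>Q)\<bar>}) \<longlonglongrightarrow> 0" (is "(\<lambda>N. ?m N) \<longlonglongrightarrow> 0")
proof -
  interpret Q: prob_space Q by fact
  interpret product_prob_space "\<lambda>_::nat. Q" UNIV by unfold_locales
  \<comment> \<open>The summand 1 gives the interval in Hoeffding's inequality positive length even
    if \<open>h\<close> vanishes.\<close>
  define C where "C = \<bar>B\<bar> + 1"
  have C: "C > 0" "\<And>x. x \<in> space Q \<Longrightarrow> \<bar>h x\<bar> \<le> C" unfolding C_def using B by fastforce+
  have int: "integrable Q h"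
    using C by (intro Q.integrable_const_bound[where B=C]) auto
  have le: "?m N \<le> 2 * exp (- 2 * real N * \<delta>\<^sup>2 / (C - - C)\<^sup>2)" if "N > 0" for N
  proof -
    interpret Hoeffding_ineq_iid "PiM UNIV (\<lambda>_::nat. Q)" "{..<N}" "\<lambda>i \<omega>. h (\<omega> i)" "\<lambda>\<omega>. h (\<omega> 0)" "-C" C
      "\<integral>\<omega>. h (\<omega> 0) \<partial>PiM UNIV (\<lambda>_::nat. Q)"
    proof unfold_locales
      show "P.indep_vars (\<lambda>_. borel) (\<lambda>i \<omega>. h (\<omega> i)) {..<N}"
        by (rule indep_vars_PiM_coordinates) fact+
      have "distr (PiM UNIV (\<lambda>_::nat. Q)) borel (\<lambda>\<omega>. h (\<omega> i)) = distr Q borel h" for i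
      proof -
        have "distr (PiM UNIV (\<lambda>_::nat. Q)) borel (\<lambda>\<omega>. h (\<omega> i))
            = distr (distr (PiM UNIV (\<lambda>_::nat. Q)) Q (\<lambda>\<omega>. \<omega> i)) borel h"
          by (subst distr_distr) (auto simp: comp_def)
        then show ?thesis using PiM_component by simp
      qed
      then show "distr (PiM UNIV (\<lambda>_::nat. Q)) borel (\<lambda>\<omega>. h (\<omega> i)) = distr (PiM UNIV (\<lambda>_::nat. Q)) borel (\<lambda>\<omega>. h (\<omega> 0))" for i
        by simp
      show "AE x in Pi\<^sub>M UNIV (\<lambda>_::nat. Q). h (x 0) \<in> {- C..C}"
      proof (intro AE_I2)
        fix x assume "x \<in> space (Pi\<^sub>M UNIV (\<lambda>_::nat. Q))"
        then have "x 0 \<in> space Q" by (auto simp: space_PiM)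
        from C(2)[OF this] show "h (x 0) \<in> {- C..C}" by auto
      qed
    qed auto
    show ?thesis
    proof -
      have "{..<N} \<noteq> {}" using that by auto
      from Hoeffding_ineq_abs_ge'[OF _ _ this, of \<delta>] show ?thesis
        using C(1) \<open>\<delta> > 0\<close> by (simp only: integral_PiM_coordinate[OF assms(1) int] card_lessThan)
    qed
  qed
  have "(\<lambda>N. 2 * exp (- 2 * real N * \<delta>\<^sup>2 / (C - - C)\<^sup>2)) = (\<lambda>N. 2 * exp (- (2 * \<delta>\<^sup>2 / (C - - C)\<^sup>2)) ^ N)"
  proof
    fix N
    have "- 2 * real N * \<delta>\<^sup>2 / (C - - C)\<^sup>2 = real N * (- (2 * \<delta>\<^sup>2 / (C - - C)\<^sup>2))" by simp
    then show "2 * exp (- 2 * real N * \<delta>\<^sup>2 / (C - - C)\<^sup>2) = 2 * exp (- (2 * \<delta>\<^sup>2 / (C - - C)\<^sup>2)) ^ N"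
      by (simp only: exp_of_nat_mult)
  qed
  also have "\<dots> \<longlonglongrightarrow> 2 * 0"
    using C \<open>\<delta> > 0\<close> by (intro tendsto_mult tendsto_const LIMSEQ_power_zero) auto
  finally have lim: "(\<lambda>N. 2 * exp (- 2 * real N * \<delta>\<^sup>2 / (C - - C)\<^sup>2)) \<longlonglongrightarrow> 0" by simp
  show ?thesis
  proof (rule tendsto_sandwich[OF _ _ tendsto_const lim])
    show "\<forall>\<^sub>F N in sequentially. ?m N \<le> 2 * exp (- 2 * real N * \<delta>\<^sup>2 / (C - - C)\<^sup>2)"
      using eventually_gt_at_top[of 0] by eventually_elim (rule le)
  qed auto
qed

text \<open>Meant for log-likelihood ratios, which are integrable but possibly unbounded. The
  truncation of \<open>h\<close> at a high level \<open>k\<close> obeys the bounded weak law, and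
  Markov's inequality controls the empirical mean of the remainder.\<close>

lemma weak_law:
  fixes h :: "'a \<Rightarrow> real"
  assumes "prob_space Q" and h: "integrable Q h" and "\<delta> > 0"
  shows "(\<lambda>N. measure (PiM UNIV (\<lambda>_::nat. Q)) {\<omega> \<in> space (PiM UNIV (\<lambda>_::nat. Q)).
      \<delta> \<le> \<bar>(\<Sum>i<N. h (\<omega> i)) / real N - (\<integral>x. h x \<partial>Q)\<bar>}) \<longlonglongrightarrow> 0" (is "(\<lambda>N. ?m N) \<longlonglongrightarrow> 0")
proof (rule order_tendstoI)
  fix \<eta> :: real assume "0 < \<eta>"
  interpret Q: prob_space Q by fact
  interpret product_prob_space "\<lambda>_::nat. Q" UNIV by unfold_locales
  have [measurable]: "h \<in> borel_measurable Q" using h by auto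
  define c where "c k x = max (- real k) (min (real k) (h x))" for k x
  have [measurable]: "c k \<in> borel_measurable Q" for k unfolding c_def by measurable
  have cb: "\<bar>c k x\<bar> \<le> real k" for k x unfolding c_def by auto
  have ci: "integrable Q (c k)" for k
    by (rule Q.integrable_const_bound[where B="real k"]) (use cb in auto)
  have "(\<lambda>k. \<integral>x. \<bar>h x - c k x\<bar> \<partial>Q) \<longlonglongrightarrow> (\<integral>x. 0 \<partial>Q)"
  proof (rule integral_dominated_convergence)
    show "integrable Q (\<lambda>x. \<bar>h x\<bar>)" using h by simp
    show "AE x in Q. (\<lambda>k. \<bar>h x - c k x\<bar>) \<longlonglongrightarrow> 0"
    proof (intro AE_I2)
      fix x
      obtain n where "\<bar>h x\<bar> \<le> real n" using real_arch_simple by blast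
      then have "\<forall>\<^sub>F k in sequentially. \<bar>h x - c k x\<bar> = 0"
        by (intro eventually_sequentiallyI[of n]) (auto simp: c_def)
      then show "(\<lambda>k. \<bar>h x - c k x\<bar>) \<longlonglongrightarrow> 0" by (rule tendsto_eventually)
    qed
    show "AE x in Q. norm \<bar>h x - c k x\<bar> \<le> \<bar>h x\<bar>" for k
      by (auto simp: c_def)
  qed measurable
  \<comment> \<open>The first bound keeps the means of \<open>h\<close> and of its truncation within
    \<delta> / 3; by the second, Markov's inequality at level \<delta> / 3 gives the remainder event
    probability at most \<eta> / 2.\<close>
  then have "\<forall>\<^sub>F k in sequentially. (\<integral>x. \<bar>h x - c k x\<bar> \<partial>Q) < min (\<delta> / 3) (\<eta> * \<delta> / 6)"
    using \<open>\<delta> > 0\<close> \<open>\<eta> > 0\<close> by (intro order_tendstoD) auto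
  then obtain k where k: "(\<integral>x. \<bar>h x - c k x\<bar> \<partial>Q) < \<delta> / 3" "(\<integral>x. \<bar>h x - c k x\<bar> \<partial>Q) < \<eta> * \<delta> / 6"
    by (auto dest!: eventually_happens)
  define u where "u x = \<bar>h x - c k x\<bar>" for x
  have ui: "integrable Q u" unfolding u_def using h ci by auto
  have [measurable]: "u \<in> borel_measurable Q" using ui by auto
  have "\<bar>(\<integral>x. h x \<partial>Q) - (\<integral>x. c k x \<partial>Q)\<bar> = \<bar>\<integral>x. h x - c k x \<partial>Q\<bar>" using h ci by simp
  also have "\<dots> \<le> (\<integral>x. u x \<partial>Q)" unfolding u_def by (rule integral_abs_bound)
  finally have dE: "\<bar>(\<integral>x. h x \<partial>Q) - (\<integral>x. c k x \<partial>Q)\<bar> < \<delta> / 3" using k(1) by (simp add: u_def)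
  let ?P = "PiM UNIV (\<lambda>_::nat. Q)"
  let ?A = "\<lambda>N. {\<omega> \<in> space ?P. \<delta> / 3 \<le> \<bar>(\<Sum>i<N. c k (\<omega> i)) / real N - (\<integral>x. c k x \<partial>Q)\<bar>}"
  let ?B = "\<lambda>N. {\<omega> \<in> space ?P. \<delta> / 3 \<le> (\<Sum>i<N. u (\<omega> i)) / real N}"
  have mB: "measure ?P (?B N) \<le> \<eta> / 2" if "N > 0" for N
  proof -
    have i: "integrable ?P (\<lambda>\<omega>. u (\<omega> i))" for i by (rule integrable_PiM_coordinate) fact+
    have "measure ?P (?B N) \<le> (\<integral>\<omega>. (\<Sum>i<N. u (\<omega> i)) / real N \<partial>?P) / (\<delta> / 3)"
      using i \<open>\<delta> > 0\<close> by (intro integral_Markov_inequality_measure[where A="{}"])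
        (auto intro!: AE_I2 divide_nonneg_nonneg sum_nonneg simp: u_def)
    also have "(\<integral>\<omega>. (\<Sum>i<N. u (\<omega> i)) / real N \<partial>?P) = (\<integral>x. u x \<partial>Q)"
      using i that by (simp add: integral_PiM_coordinate[OF assms(1) ui] Bochner_Integration.integral_sum)
    also have "\<dots> / (\<delta> / 3) \<le> \<eta> / 2" using k(2) \<open>\<delta> > 0\<close> by (simp add: u_def field_simps)
    finally show ?thesis .
  qed
  have "\<forall>\<^sub>F N in sequentially. measure ?P (?A N) < \<eta> / 2"
    using weak_law_bounded[OF assms(1), of "c k" "real k" "\<delta> / 3"] cb \<open>\<delta> > 0\<close> \<open>\<eta> > 0\<close>
    by (intro order_tendstoD) auto
  then show "\<forall>\<^sub>F N in sequentially. ?m N < \<eta>"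
    using eventually_gt_at_top[of 0]
  proof eventually_elim
    case (elim N)
    have sub: "{\<omega> \<in> space ?P. \<delta> \<le> \<bar>(\<Sum>i<N. h (\<omega> i)) / real N - (\<integral>x. h x \<partial>Q)\<bar>} \<subseteq> ?A N \<union> ?B N"
    proof (rule subsetI, rule ccontr)
      fix \<omega> assume "\<omega> \<in> {\<omega> \<in> space ?P. \<delta> \<le> \<bar>(\<Sum>i<N. h (\<omega> i)) / real N - (\<integral>x. h x \<partial>Q)\<bar>}" "\<omega> \<notin> ?A N \<union> ?B N"
      then have *: "\<delta> \<le> \<bar>(\<Sum>i<N. h (\<omega> i)) / real N - (\<integral>x. h x \<partial>Q)\<bar>"
        "(\<Sum>i<N. u (\<omega> i)) / real N < \<delta> / 3"
        "\<bar>(\<Sum>i<N. c k (\<omega> i)) / real N - (\<integral>x. c k x \<partial>Q)\<bar> < \<delta> / 3"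
        by (simp_all add: not_le)
      have "\<bar>(\<Sum>i<N. h (\<omega> i)) / real N - (\<Sum>i<N. c k (\<omega> i)) / real N\<bar> = \<bar>\<Sum>i<N. h (\<omega> i) - c k (\<omega> i)\<bar> / real N"
        by (simp add: sum_subtractf diff_divide_distrib[symmetric])
      also have "\<dots> \<le> (\<Sum>i<N. u (\<omega> i)) / real N"
        unfolding u_def by (intro divide_right_mono sum_abs) auto
      finally show False using * dE by linarith
    qed
    have "?m N \<le> measure ?P (?A N \<union> ?B N)"
      by (rule P.finite_measure_mono[OF sub]) measurable
    also have "\<dots> \<le> measure ?P (?A N) + measure ?P (?B N)"
      by (rule measure_Un_le) measurable
    finally show ?case using elim mB[of N] by auto
  qed
next
  fix a :: real assume "a < 0"
  then show "\<forall>\<^sub>F N in sequentially. a < ?m N"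
    by (intro always_eventually allI less_le_trans[OF _ measure_nonneg])
qed

lemma PiM_density_change:
  fixes f :: "'a \<Rightarrow> real"
  assumes "prob_space P" "prob_space Q" "f \<in> borel_measurable P" "\<forall>x. 0 \<le> f x"
    and Q: "Q = density P (\<lambda>x. ennreal (f x))" and "finite J"
  shows "PiM J (\<lambda>_. Q) = density (PiM J (\<lambda>_. P)) (\<lambda>\<omega>. \<Prod>i\<in>J. ennreal (f (\<omega> i)))" (is "_ = ?D")
proof -
  interpret P: prob_space P by fact
  interpret Q: prob_space Q by fact
  interpret P: product_sigma_finite "\<lambda>_. P" by unfold_locales
  interpret Q: product_sigma_finite "\<lambda>_. Q" by unfold_locales
  note [measurable] = assms(3)
  have s: "sets Q = sets P" using Q by simp
  show ?thesis
  proof (rule Q.PiM_eqI[symmetric, OF \<open>finite J\<close>])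
    show "sets ?D = sets (PiM J (\<lambda>_. Q))" using s by (simp cong: sets_PiM_cong)
    fix A assume "\<And>i. i \<in> J \<Longrightarrow> A i \<in> sets Q"
    then have A[measurable]: "\<And>i. i \<in> J \<Longrightarrow> A i \<in> sets P" using s by simp
    have m: "Pi\<^sub>E J A \<in> sets (PiM J (\<lambda>_. P))" using A \<open>finite J\<close> by (intro sets_PiM_I_finite) auto
    have "emeasure ?D (Pi\<^sub>E J A)
        = (\<integral>\<^sup>+\<omega>. (\<Prod>i\<in>J. ennreal (f (\<omega> i))) * indicator (Pi\<^sub>E J A) \<omega> \<partial>PiM J (\<lambda>_. P))"
      using m by (subst emeasure_density) auto
    also have "\<dots> = (\<integral>\<^sup>+\<omega>. (\<Prod>i\<in>J. ennreal (f (\<omega> i)) * indicator (A i) (\<omega> i)) \<partial>PiM J (\<lambda>_. P))"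
    proof (intro nn_integral_cong)
      fix \<omega> assume \<omega>: "\<omega> \<in> space (PiM J (\<lambda>_. P))"
      have "(\<Prod>i\<in>J. indicator (A i) (\<omega> i)) = (indicator (Pi\<^sub>E J A) \<omega> :: ennreal)"
      proof (cases "\<omega> \<in> Pi\<^sub>E J A")
        case True
        then have "(\<Prod>i\<in>J. indicator (A i) (\<omega> i)) = (1 :: ennreal)"
          by (intro prod.neutral) (auto simp: PiE_iff)
        with True show ?thesis by simp
      next
        case False
        with \<omega> obtain i where "i \<in> J" "\<omega> i \<notin> A i" by (auto simp: space_PiM PiE_iff)
        then have "\<exists>i\<in>J. indicator (A i) (\<omega> i) = (0 :: ennreal)"
          by (intro bexI[of _ i]) (simp_all add: indicator_def)
        then have "(\<Prod>i\<in>J. indicator (A i) (\<omega> i)) = (0 :: ennreal)"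
          by (rule prod_zero[OF \<open>finite J\<close>])
        with False show ?thesis by simp
      qed
      then show "(\<Prod>i\<in>J. ennreal (f (\<omega> i))) * indicator (Pi\<^sub>E J A) \<omega>
          = (\<Prod>i\<in>J. ennreal (f (\<omega> i)) * indicator (A i) (\<omega> i))"
        by (simp add: prod.distrib)
    qed
    also have "\<dots> = (\<Prod>i\<in>J. \<integral>\<^sup>+x. ennreal (f x) * indicator (A i) x \<partial>P)"
      by (rule P.product_nn_integral_prod) (use \<open>finite J\<close> in auto)
    also have "\<dots> = (\<Prod>i\<in>J. emeasure Q (A i))"
      using A by (intro prod.cong refl) (simp add: Q emeasure_density)
    finally show "emeasure ?D (Pi\<^sub>E J A) = (\<Prod>i\<in>J. emeasure Q (A i))" .
  qed
qed

subsection \<open>Change of measure\<close>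

text \<open>The event \<open>E\<close> has to be determined by the first \<open>N\<close> samples, since the infinite powers
  of \<open>P\<close> and \<open>Q\<close> are mutually singular when \<open>P \<noteq> Q\<close>.\<close>

lemma PiM_change_of_measure_le:
  fixes f :: "'a \<Rightarrow> real"
  assumes "prob_space P" "prob_space Q" "f \<in> borel_measurable P" "\<forall>x. 0 \<le> f x"
    and Q: "Q = density P (\<lambda>x. ennreal (f x))"
    and E: "E \<in> sets (PiM UNIV (\<lambda>_::nat. P))"
    and dep: "\<And>\<omega> \<omega>'. \<omega> \<in> E \<Longrightarrow> \<omega>' \<in> space (PiM UNIV (\<lambda>_::nat. P)) \<Longrightarrow> (\<And>i. i < N \<Longrightarrow> \<omega> i = \<omega>' i) \<Longrightarrow> \<omega>' \<in> E"
  shows "measure (PiM UNIV (\<lambda>_::nat. Q)) E \<le> exp (real N * s) * measure (PiM UNIV (\<lambda>_::nat. P)) E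
    + measure (PiM UNIV (\<lambda>_::nat. Q)) {\<omega> \<in> space (PiM UNIV (\<lambda>_::nat. Q)). real N * s < (\<Sum>i<N. ln (f (\<omega> i)))}"
proof -
  interpret P: prob_space P by fact
  interpret Q: prob_space Q by fact
  interpret PP: product_prob_space "\<lambda>_::nat. P" UNIV by unfold_locales
  interpret QQ: product_prob_space "\<lambda>_::nat. Q" UNIV by unfold_locales
  note [measurable] = assms(3)
  have s: "sets Q = sets P" using Q by simp
  have [simp]: "space Q = space P" using sets_eq_imp_space_eq[OF s] .
  have sN: "sets (PiM J (\<lambda>_::nat. Q)) = sets (PiM J (\<lambda>_::nat. P))" for J using s by (simp cong: sets_PiM_cong)
  obtain x0 where x0: "x0 \<in> space P" using P.not_empty by blast
  \<comment> \<open>\<open>m\<close> prolongs a sample of length \<open>N\<close> by the fixed point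
    \<open>x0\<close>, which exhibits \<open>E\<close> as a cylinder over a measurable set
    \<open>A\<close> of finite samples.\<close>
  define m where "m x = (\<lambda>i. if i < N then x i else x0)" for x :: "nat \<Rightarrow> 'a"
  have m[measurable]: "m \<in> measurable (PiM {..<N} (\<lambda>_. P)) (PiM UNIV (\<lambda>_. P))"
    unfolding m_def
  proof (rule measurable_PiM_single')
    fix i
    show "(\<lambda>x. if i < N then x i else x0) \<in> measurable (PiM {..<N} (\<lambda>_. P)) P"
      using x0 by (cases "i < N") auto
  qed (use x0 in \<open>auto simp: space_PiM PiE_iff\<close>)
  define A where "A = m -` E \<inter> space (PiM {..<N} (\<lambda>_. P))"
  have A[measurable]: "A \<in> sets (PiM {..<N} (\<lambda>_. P))" unfolding A_def using m E by (rule measurable_sets)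
  have emb: "E = prod_emb UNIV (\<lambda>_. P) {..<N} A"
  proof (intro set_eqI iffI)
    fix \<omega> assume \<omega>: "\<omega> \<in> E"
    then have sp: "\<omega> \<in> space (PiM UNIV (\<lambda>_::nat. P))" using sets.sets_into_space[OF E] by blast
    then have r: "restrict \<omega> {..<N} \<in> space (PiM {..<N} (\<lambda>_. P))" by (auto simp: space_PiM)
    then have "m (restrict \<omega> {..<N}) \<in> E"
      by (intro dep[OF \<omega> measurable_space[OF m]]) (auto simp: m_def)
    with r sp show "\<omega> \<in> prod_emb UNIV (\<lambda>_. P) {..<N} A" by (simp add: prod_emb_def A_def space_PiM)
  next
    fix \<omega> assume "\<omega> \<in> prod_emb UNIV (\<lambda>_. P) {..<N} A"
    then have \<omega>: "m (restrict \<omega> {..<N}) \<in> E" "\<omega> \<in> space (PiM UNIV (\<lambda>_::nat. P))"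
      by (auto simp: prod_emb_def A_def space_PiM)
    show "\<omega> \<in> E" by (rule dep[OF \<omega>]) (simp add: m_def)
  qed
  define B where "B = {x \<in> space (PiM {..<N} (\<lambda>_. P)). exp (real N * s) < (\<Prod>i<N. f (x i))}"
  have B[measurable]: "B \<in> sets (PiM {..<N} (\<lambda>_. P))" unfolding B_def by measurable
  let ?f = "\<lambda>\<omega>. \<Prod>i<N. ennreal (f (\<omega> i))"
  have D: "PiM {..<N} (\<lambda>_. Q) = density (PiM {..<N} (\<lambda>_. P)) ?f"
    by (rule PiM_density_change) (use assms in auto)
  have "emeasure (PiM {..<N} (\<lambda>_. Q)) A = (\<integral>\<^sup>+\<omega>. ?f \<omega> * indicator A \<omega> \<partial>PiM {..<N} (\<lambda>_. P))"
    unfolding D by (rule emeasure_density) measurable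
  \<comment> \<open>Outside \<open>B\<close> the likelihood ratio is at most exp (N s). On
    \<open>B\<close> the full density is kept and becomes a \<open>Q\<close>-probability
    again.\<close>
  also have "\<dots> \<le> (\<integral>\<^sup>+\<omega>. ennreal (exp (real N * s)) * indicator A \<omega> + ?f \<omega> * indicator B \<omega> \<partial>PiM {..<N} (\<lambda>_. P))"
    using assms(4) by (intro nn_integral_mono)
      (auto simp: indicator_def B_def prod_ennreal prod_nonneg not_less intro!: ennreal_leI)
  also have "\<dots> = ennreal (exp (real N * s)) * emeasure (PiM {..<N} (\<lambda>_. P)) A + emeasure (PiM {..<N} (\<lambda>_. Q)) B"
    unfolding D by (subst nn_integral_add) (auto simp: nn_integral_cmult emeasure_density)
  finally have le: "emeasure (PiM {..<N} (\<lambda>_. Q)) A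
      \<le> ennreal (exp (real N * s)) * emeasure (PiM {..<N} (\<lambda>_. P)) A + emeasure (PiM {..<N} (\<lambda>_. Q)) B" .
  have "emeasure (PiM {..<N} (\<lambda>_. Q)) B = emeasure (PiM UNIV (\<lambda>_. Q)) (prod_emb UNIV (\<lambda>_. Q) {..<N} B)"
    using B by (subst QQ.emeasure_PiM_emb') (auto simp: sN)
  also have "\<dots> \<le> emeasure (PiM UNIV (\<lambda>_. Q)) {\<omega> \<in> space (PiM UNIV (\<lambda>_::nat. Q)). real N * s < (\<Sum>i<N. ln (f (\<omega> i)))}"
  proof (rule emeasure_mono)
    show "prod_emb UNIV (\<lambda>_. Q) {..<N} B \<subseteq> {\<omega> \<in> space (PiM UNIV (\<lambda>_::nat. Q)). real N * s < (\<Sum>i<N. ln (f (\<omega> i)))}"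
    proof
      fix \<omega> assume "\<omega> \<in> prod_emb UNIV (\<lambda>_. Q) {..<N} B"
      then have sp: "\<omega> \<in> space (PiM UNIV (\<lambda>_::nat. Q))" and p: "exp (real N * s) < (\<Prod>i<N. f (\<omega> i))"
        by (auto simp: prod_emb_def B_def space_PiM)
      have pos: "0 < (\<Prod>i<N. f (\<omega> i))" using p by (rule less_trans[rotated]) simp
      have "f (\<omega> i) \<noteq> 0" if "i < N" for i
      proof
        assume "f (\<omega> i) = 0"
        then have "(\<Prod>i<N. f (\<omega> i)) = 0" using that by (intro prod_zero) auto
        with pos show False by simp
      qed
      then have "(\<Sum>i<N. ln (f (\<omega> i))) = ln (\<Prod>i<N. f (\<omega> i))"
        using assms(4) by (intro ln_prod[symmetric]) (auto simp: less_le)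
      moreover have "real N * s < ln (\<Prod>i<N. f (\<omega> i))"
        using p pos ln_less_cancel_iff[of "exp (real N * s)" "\<Prod>i<N. f (\<omega> i)"] by simp
      ultimately show "\<omega> \<in> {\<omega> \<in> space (PiM UNIV (\<lambda>_::nat. Q)). real N * s < (\<Sum>i<N. ln (f (\<omega> i)))}"
        using sp by simp
    qed
    show "{\<omega> \<in> space (PiM UNIV (\<lambda>_::nat. Q)). real N * s < (\<Sum>i<N. ln (f (\<omega> i)))} \<in> sets (PiM UNIV (\<lambda>_::nat. Q))"
    proof -
      have [measurable]: "f \<in> borel_measurable Q" using s by (simp cong: measurable_cong_sets)
      show ?thesis by measurable
    qed
  qed
  finally have leB: "emeasure (PiM {..<N} (\<lambda>_. Q)) B \<le> \<dots>" .
  have "prod_emb UNIV (\<lambda>_. Q) {..<N} A = prod_emb UNIV (\<lambda>_. P) {..<N} A" by (simp add: prod_emb_def)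
  then have e1: "emeasure (PiM UNIV (\<lambda>_. Q)) E = emeasure (PiM {..<N} (\<lambda>_. Q)) A"
    unfolding emb using QQ.emeasure_PiM_emb'[of "{..<N}" A] A by (simp add: sN)
  have e2: "emeasure (PiM UNIV (\<lambda>_. P)) E = emeasure (PiM {..<N} (\<lambda>_. P)) A"
    unfolding emb using PP.emeasure_PiM_emb'[of "{..<N}" A] A by simp
  have "emeasure (PiM UNIV (\<lambda>_. Q)) E \<le> ennreal (exp (real N * s)) * emeasure (PiM UNIV (\<lambda>_. P)) E
    + emeasure (PiM UNIV (\<lambda>_. Q)) {\<omega> \<in> space (PiM UNIV (\<lambda>_::nat. Q)). real N * s < (\<Sum>i<N. ln (f (\<omega> i)))}"
    unfolding e1 e2 by (rule order_trans[OF le add_left_mono[OF leB]])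
  then show ?thesis
    by (simp add: PP.P.emeasure_eq_measure QQ.P.emeasure_eq_measure ennreal_mult[symmetric] ennreal_plus[symmetric] del: ennreal_plus)
qed

text \<open>The mean of ln f under \<open>Q\<close> is at most d < s. By the weak law with deviation
  s - d, the likelihood ratio of the first N samples exceeds exp (N s) with vanishing
  \<open>Q\<close>-probability, and the change of measure leaves at least 3/4 - 1/4 for exp (N s)
  times the \<open>P\<close>-probability of the event.\<close>

lemma eventually_prob_ge_exp_D_KL:
  assumes "prob_space P" "prob_space Q" and s: "sets Q = sets P" and D: "D_KL Q P < ereal s"
    and E: "\<And>N. N > 0 \<Longrightarrow> E N \<in> sets (PiM UNIV (\<lambda>_::nat. P))"
    and dep: "\<And>N \<omega> \<omega>'. \<omega> \<in> E N \<Longrightarrow> \<omega>' \<in> space (PiM UNIV (\<lambda>_::nat. P)) \<Longrightarrow> (\<And>i. i < N \<Longrightarrow> \<omega> i = \<omega>' i) \<Longrightarrow> \<omega>' \<in> E N"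
    and lim: "(\<lambda>N. measure (PiM UNIV (\<lambda>_::nat. Q)) (E N)) \<longlonglongrightarrow> 1"
  shows "\<forall>\<^sub>F N in sequentially. exp (- (real N * s)) / 2 \<le> measure (PiM UNIV (\<lambda>_::nat. P)) (E N)"
proof -
  interpret Q: prob_space Q by fact
  interpret QQ: product_prob_space "\<lambda>_::nat. Q" UNIV by unfold_locales
  obtain d where d: "D_KL Q P < ereal d" "d < s"
    using ereal_dense2[OF D] by auto
  obtain f :: "'a \<Rightarrow> real" where f: "f \<in> borel_measurable P" "\<forall>x. 0 \<le> f x"
    "Q = density P (\<lambda>x. ennreal (f x))" "AE x in Q. 0 < f x"
    "integrable Q (\<lambda>x. ln (f x))" "(\<integral>x. ln (f x) \<partial>Q) \<le> d"
    "integrable Q (\<lambda>x. 1 / f x)"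
    "\<forall>A\<in>sets P. (\<integral>\<^sup>+x. ennreal (1 / f x) * indicator A x \<partial>Q) \<le> emeasure P A"
    by (rule D_KL_finiteE[OF assms(1-3) less_imp_le[OF d(1)]])
  have [measurable]: "f \<in> borel_measurable Q" using f(1) s by (simp cong: measurable_cong_sets)
  let ?B = "\<lambda>N. {\<omega> \<in> space (PiM UNIV (\<lambda>_::nat. Q)). real N * s < (\<Sum>i<N. ln (f (\<omega> i)))}"
  let ?C = "\<lambda>N. {\<omega> \<in> space (PiM UNIV (\<lambda>_::nat. Q)). s - d \<le> \<bar>(\<Sum>i<N. ln (f (\<omega> i))) / real N - (\<integral>x. ln (f x) \<partial>Q)\<bar>}"
  have "\<forall>\<^sub>F N in sequentially. measure (PiM UNIV (\<lambda>_::nat. Q)) (?C N) < 1 / 4"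
    using weak_law[OF assms(2) f(5), of "s - d"] d(2) by (intro order_tendstoD) auto
  moreover have "\<forall>\<^sub>F N in sequentially. 3 / 4 < measure (PiM UNIV (\<lambda>_::nat. Q)) (E N)"
    using lim by (rule order_tendstoD) auto
  ultimately show ?thesis using eventually_gt_at_top[of 0]
  proof eventually_elim
    case (elim N)
    have "?B N \<subseteq> ?C N"
    proof
      fix \<omega> assume "\<omega> \<in> ?B N"
      then have "\<omega> \<in> space (PiM UNIV (\<lambda>_::nat. Q))" "s < (\<Sum>i<N. ln (f (\<omega> i))) / real N"
        using elim(3) by (auto simp: field_simps)
      with f(6) show "\<omega> \<in> ?C N" by auto
    qed
    then have "measure (PiM UNIV (\<lambda>_::nat. Q)) (?B N) \<le> measure (PiM UNIV (\<lambda>_::nat. Q)) (?C N)"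
      by (rule QQ.P.finite_measure_mono) measurable
    moreover have "measure (PiM UNIV (\<lambda>_::nat. Q)) (E N) \<le> exp (real N * s) * measure (PiM UNIV (\<lambda>_::nat. P)) (E N)
        + measure (PiM UNIV (\<lambda>_::nat. Q)) (?B N)"
      by (rule PiM_change_of_measure_le[OF assms(1,2) f(1,2,3) E[OF elim(3)] dep])
    ultimately have "1 / 2 \<le> exp (real N * s) * measure (PiM UNIV (\<lambda>_::nat. P)) (E N)" using elim by linarith
    then show ?case by (simp add: exp_minus field_simps)
  qed
qed

lemma decay_rate_ge_of_D_KL_less:
  assumes "prob_space P" "prob_space Q" "sets Q = sets P" "D_KL Q P < ereal s"
    and "\<And>N. N > 0 \<Longrightarrow> E N \<in> sets (PiM UNIV (\<lambda>_::nat. P))"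
    and "\<And>N \<omega> \<omega>'. \<omega> \<in> E N \<Longrightarrow> \<omega>' \<in> space (PiM UNIV (\<lambda>_::nat. P)) \<Longrightarrow> (\<And>i. i < N \<Longrightarrow> \<omega> i = \<omega>' i) \<Longrightarrow> \<omega>' \<in> E N"
    and "(\<lambda>N. measure (PiM UNIV (\<lambda>_::nat. Q)) (E N)) \<longlonglongrightarrow> 1"
  shows "ereal (- s) \<le> decay_rate P E"
proof -
  have ev: "\<forall>\<^sub>F N in sequentially. exp (- (real N * s)) / 2 \<le> measure (PiM UNIV (\<lambda>_::nat. P)) (E N)"
    by (rule eventually_prob_ge_exp_D_KL[OF assms(1-5)]) (use assms(6,7) in blast)+
  have "(\<lambda>N. - s - ln 2 * (1 / real N)) \<longlonglongrightarrow> - s - ln 2 * 0"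
    by (intro tendsto_intros lim_1_over_n)
  then have "(\<lambda>N. ereal (- s - ln 2 * (1 / real N))) \<longlonglongrightarrow> ereal (- s)" by simp
  then have "ereal (- s) = limsup (\<lambda>N. ereal (- s - ln 2 * (1 / real N)))"
    by (intro lim_imp_Limsup[symmetric]) auto
  also have "\<dots> \<le> decay_rate P E"
    unfolding decay_rate_def
  proof (rule Limsup_mono)
    show "\<forall>\<^sub>F N in sequentially. ereal (- s - ln 2 * (1 / real N))
        \<le> ereal (1 / real N) * log_prob (measure (PiM UNIV (\<lambda>_::nat. P)) (E N))"
      using ev eventually_gt_at_top[of 0]
    proof eventually_elim
      case (elim N)
      let ?p = "measure (PiM UNIV (\<lambda>_::nat. P)) (E N)"
      have p: "?p > 0" using elim(1) by (rule less_le_trans[rotated]) simp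
      have "ln (exp (- (real N * s)) / 2) \<le> ln ?p" using elim(1) p by (subst ln_le_cancel_iff) auto
      then have "- (real N * s) - ln 2 \<le> ln ?p" by (simp add: ln_div)
      then have "(1 / real N) * (- (real N * s) - ln 2) \<le> (1 / real N) * ln ?p"
        by (intro mult_left_mono) auto
      also have "(1 / real N) * (- (real N * s) - ln 2) = - s - ln 2 * (1 / real N)"
        using elim(2) by (simp add: field_simps)
      finally show ?case using p by (simp add: log_prob_def)
    qed
  qed
  finally show ?thesis .
qed

subsection \<open>Semicontinuous functions and the weak topology\<close>

lemma borel_probsD:
  assumes "P \<in> borel_probs \<Sigma>"
  shows "prob_space P" "sets P = sets (restrict_space borel \<Sigma>)" "space P = \<Sigma>"
  using assms sets_eq_imp_space_eq[of P "restrict_space borel \<Sigma>"]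
  by (auto simp: borel_probs_def space_restrict_space)

lemma integrable_borel_probs:
  fixes f :: "'a::topological_space \<Rightarrow> real"
  assumes P: "P \<in> borel_probs \<Sigma>" and "f \<in> borel_measurable (restrict_space borel \<Sigma>)"
    and "\<And>x. x \<in> \<Sigma> \<Longrightarrow> a \<le> f x" "\<And>x. x \<in> \<Sigma> \<Longrightarrow> f x \<le> b"
  shows "integrable P f"
proof -
  interpret P: prob_space P using borel_probsD[OF P] by simp
  have m: "f \<in> borel_measurable P"
    using assms(2) borel_probsD(2)[OF P] by (simp cong: measurable_cong_sets)
  have "\<bar>f x\<bar> \<le> max \<bar>a\<bar> \<bar>b\<bar>" if "x \<in> \<Sigma>" for x using assms(3,4)[OF that] by linarith
  then show ?thesis
    using borel_probsD(3)[OF P] m by (intro P.integrable_const_bound[where B="max \<bar>a\<bar> \<bar>b\<bar>"]) auto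
qed

lemma usc_map_borel_measurable:
  fixes l :: "'a::topological_space \<Rightarrow> real"
  assumes "usc_map (top_of_set \<Sigma>) l"
  shows "l \<in> borel_measurable (restrict_space borel \<Sigma>)"
  unfolding borel_measurable_iff_less
proof
  fix a
  have "openin (top_of_set \<Sigma>) {x \<in> \<Sigma>. l x < a}" using assms by (simp add: usc_map_def)
  then obtain T where "open T" "{x \<in> \<Sigma>. l x < a} = \<Sigma> \<inter> T" by (auto simp: openin_open)
  then show "{w \<in> space (restrict_space borel \<Sigma>). l w < a} \<in> sets (restrict_space borel \<Sigma>)"
    by (auto simp: sets_restrict_space space_restrict_space)
qed

text \<open>Were there no maximiser, each point would lie in some relatively open set {l < l y} with
  y in \<Sigma>. Among the finitely many y of a subcover, one with the largest value of
  \<open>l\<close> lies in none of these sets.\<close>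

lemma usc_map_attains_sup:
  fixes l :: "'a::topological_space \<Rightarrow> real"
  assumes "compact \<Sigma>" "\<Sigma> \<noteq> {}" and u: "usc_map (top_of_set \<Sigma>) l"
  obtains x where "x \<in> \<Sigma>" "\<And>y. y \<in> \<Sigma> \<Longrightarrow> l y \<le> l x"
proof -
  have "\<exists>x\<in>\<Sigma>. \<forall>y\<in>\<Sigma>. l y \<le> l x"
  proof (rule ccontr)
    assume "\<not> ?thesis"
    then have *: "\<And>x. x \<in> \<Sigma> \<Longrightarrow> \<exists>y\<in>\<Sigma>. l x < l y" by (auto simp: not_le)
    have "\<exists>T. open T \<and> {x \<in> \<Sigma>. l x < l y} = \<Sigma> \<inter> T" for y
      using u by (auto simp: usc_map_def openin_open)
    then obtain T where T: "\<And>y. open (T y)" "\<And>y. {x \<in> \<Sigma>. l x < l y} = \<Sigma> \<inter> T y" by metis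
    have cover: "\<Sigma> \<subseteq> (\<Union>y\<in>\<Sigma>. T y)" using * T(2) by blast
    obtain C where C: "C \<subseteq> \<Sigma>" "finite C" "\<Sigma> \<subseteq> (\<Union>y\<in>C. T y)"
      by (rule compactE_image[OF assms(1) T(1) cover])
    have "C \<noteq> {}" using C(3) assms(2) by auto
    then have "Max (l ` C) \<in> l ` C" using C(2) by (intro Max_in) auto
    then obtain z where z: "z \<in> C" "l z = Max (l ` C)" by auto
    then have z: "z \<in> C" "\<And>y. y \<in> C \<Longrightarrow> l y \<le> l z" using C(2) by auto
    then obtain y where "y \<in> C" "z \<in> T y" using C by blast
    then have "l z < l y" using T(2)[of y] z C by blast
    with z(2)[OF \<open>y \<in> C\<close>] show False by simp
  qed
  with that show ?thesis by blast
qed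

section \<open>Lipschitz regularisation of lower semicontinuous functions\<close>

definition lsc_on :: "'a::real_normed_vector set \<Rightarrow> ('a \<Rightarrow> real) \<Rightarrow> bool" where
  "lsc_on \<Sigma> g \<longleftrightarrow> (\<forall>x\<in>\<Sigma>. \<forall>a<g x. \<exists>\<delta>>0. \<forall>y\<in>\<Sigma>. norm (x - y) < \<delta> \<longrightarrow> a < g y)"

lemma usc_map_ln_diff:
  fixes l :: "'a::real_normed_vector \<Rightarrow> real"
  assumes u: "usc_map (top_of_set \<Sigma>) l" and \<alpha>: "\<And>x. x \<in> \<Sigma> \<Longrightarrow> l x < \<alpha>"
  shows "lsc_on \<Sigma> (\<lambda>x. ln (\<alpha> - l x))"
  unfolding lsc_on_def
proof (intro ballI allI impI)
  fix x a assume x: "x \<in> \<Sigma>" and a: "a < ln (\<alpha> - l x)"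
  then have "exp a < exp (ln (\<alpha> - l x))" by (subst exp_less_cancel_iff)
  then have "l x < \<alpha> - exp a" using \<alpha>[OF x] by simp
  moreover obtain T where T: "open T" "{y \<in> \<Sigma>. l y < \<alpha> - exp a} = \<Sigma> \<inter> T"
    using u by (auto simp: usc_map_def openin_open)
  ultimately have "x \<in> T" using x by blast
  with T(1) obtain \<delta> where \<delta>: "\<delta> > 0" "ball x \<delta> \<subseteq> T" by (auto simp: open_contains_ball)
  have "a < ln (\<alpha> - l y)" if "y \<in> \<Sigma>" "norm (x - y) < \<delta>" for y
  proof -
    have "y \<in> T" using \<delta> that by (auto simp: dist_norm subset_iff)
    then have "y \<in> {y \<in> \<Sigma>. l y < \<alpha> - exp a}" using T(2) that by simp
    then have "exp a < \<alpha> - l y" by simp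
    then have "ln (exp a) < ln (\<alpha> - l y)" using \<alpha>[OF that(1)] by (subst ln_less_cancel_iff) auto
    then show ?thesis by simp
  qed
  with \<delta>(1) show "\<exists>\<delta>>0. \<forall>y\<in>\<Sigma>. norm (x - y) < \<delta> \<longrightarrow> a < ln (\<alpha> - l y)" by blast
qed

text \<open>The Pasch-Hausdorff envelope: for \<open>g\<close> bounded below and k \<ge> 0, the
  largest \<open>k\<close>-Lipschitz minorant of \<open>g\<close> on \<Sigma>.\<close>

definition inf_conv :: "'a::real_normed_vector set \<Rightarrow> ('a \<Rightarrow> real) \<Rightarrow> real \<Rightarrow> 'a \<Rightarrow> real" where
  "inf_conv \<Sigma> g k x = (INF y\<in>\<Sigma>. g y + k * norm (x - y))"

context
  fixes \<Sigma> :: "'a::real_normed_vector set" and g :: "'a \<Rightarrow> real" and m :: real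
  assumes m: "\<And>x. x \<in> \<Sigma> \<Longrightarrow> m \<le> g x"
begin

lemma bdd_below_inf_conv: "k \<ge> 0 \<Longrightarrow> bdd_below ((\<lambda>y. g y + k * norm (x - y)) ` \<Sigma>)"
  using m by (intro bdd_belowI2[where m=m]) (meson add_increasing2 mult_nonneg_nonneg norm_ge_zero)

lemma inf_conv_le: "k \<ge> 0 \<Longrightarrow> y \<in> \<Sigma> \<Longrightarrow> inf_conv \<Sigma> g k x \<le> g y + k * norm (x - y)"
  unfolding inf_conv_def by (intro cINF_lower bdd_below_inf_conv)

lemma inf_conv_le_self: "k \<ge> 0 \<Longrightarrow> x \<in> \<Sigma> \<Longrightarrow> inf_conv \<Sigma> g k x \<le> g x"
  using inf_conv_le[of k x x] by simp

lemma inf_conv_ge: "k \<ge> 0 \<Longrightarrow> \<Sigma> \<noteq> {} \<Longrightarrow> m \<le> inf_conv \<Sigma> g k x"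
  unfolding inf_conv_def
  using m by (intro cINF_greatest) (auto intro: add_increasing2 mult_nonneg_nonneg)

lemma inf_conv_Lipschitz:
  assumes "k \<ge> 0" "\<Sigma> \<noteq> {}"
  shows "inf_conv \<Sigma> g k x \<le> inf_conv \<Sigma> g k x' + k * norm (x - x')"
proof -
  have "inf_conv \<Sigma> g k x - k * norm (x - x') \<le> inf_conv \<Sigma> g k x'"
    unfolding inf_conv_def[of _ _ _ x']
  proof (intro cINF_greatest)
    fix y assume "y \<in> \<Sigma>"
    then have "inf_conv \<Sigma> g k x \<le> g y + k * norm (x - y)" using assms by (intro inf_conv_le)
    moreover have "k * norm (x - y) \<le> k * (norm (x - x') + norm (x' - y))"
      using assms(1) norm_triangle_ineq[of "x - x'" "x' - y"] by (intro mult_left_mono) auto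
    ultimately show "inf_conv \<Sigma> g k x - k * norm (x - x') \<le> g y + k * norm (x' - y)"
      by (simp add: algebra_simps)
  qed fact
  then show ?thesis by simp
qed

text \<open>Within distance \<delta> of \<open>x\<close>, lower semicontinuity keeps
  \<open>g\<close> above \<open>b\<close>. Farther away the penalty is at least k \<delta>, which
  reaches b - m once \<open>k\<close> is large, so distant points cannot bring the infimum below
  \<open>b\<close> either.\<close>

lemma inf_conv_tendsto:
  assumes "lsc_on \<Sigma> g" and x: "x \<in> \<Sigma>"
  shows "(\<lambda>k. inf_conv \<Sigma> g (real k) x) \<longlonglongrightarrow> g x"
proof (rule order_tendstoI)
  fix a assume "g x < a"
  then show "\<forall>\<^sub>F k in sequentially. inf_conv \<Sigma> g (real k) x < a"
    using inf_conv_le_self[OF _ x] by (intro always_eventually allI) (meson le_less_trans of_nat_0_le_iff)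
next
  fix a assume a: "a < g x"
  obtain b where b: "a < b" "b < g x" using dense[OF a] by blast
  obtain \<delta> where \<delta>: "\<delta> > 0" "\<And>y. y \<in> \<Sigma> \<Longrightarrow> norm (x - y) < \<delta> \<Longrightarrow> b < g y"
    using assms b(2) unfolding lsc_on_def by meson
  obtain n where n: "(b - m) / \<delta> \<le> real n" using real_arch_simple by blast
  show "\<forall>\<^sub>F k in sequentially. a < inf_conv \<Sigma> g (real k) x"
  proof (rule eventually_sequentiallyI[of n])
    fix k assume "n \<le> k"
    have "b \<le> inf_conv \<Sigma> g (real k) x"
      unfolding inf_conv_def
    proof (rule cINF_greatest)
      fix y assume y: "y \<in> \<Sigma>"
      show "b \<le> g y + real k * norm (x - y)"
      proof (cases "norm (x - y) < \<delta>")
        case True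
        then show ?thesis using \<delta>(2)[OF y True] by (simp add: add_increasing2 less_imp_le)
      next
        case False
        have "(b - m) / \<delta> \<le> real k" using n \<open>n \<le> k\<close> by linarith
        then have "b - m \<le> real k * \<delta>" using \<delta>(1) by (simp add: pos_divide_le_eq)
        also have "\<dots> \<le> real k * norm (x - y)" using False by (intro mult_left_mono) auto
        finally show ?thesis using m[OF y] by linarith
      qed
    qed (use x in auto)
    with b show "a < inf_conv \<Sigma> g (real k) x" by simp
  qed
qed

end

lemma Lipschitz_continuous_on:
  fixes f :: "'a::real_normed_vector \<Rightarrow> real"
  assumes "\<And>x y. x \<in> \<Sigma> \<Longrightarrow> y \<in> \<Sigma> \<Longrightarrow> f x \<le> f y + k * norm (x - y)" "k \<ge> 0"
  shows "continuous_on \<Sigma> f"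
proof -
  have "k-lipschitz_on \<Sigma> f"
  proof (rule lipschitz_onI)
    fix x y assume "x \<in> \<Sigma>" "y \<in> \<Sigma>"
    then show "dist (f x) (f y) \<le> k * dist x y"
      using assms(1)[of x y] assms(1)[of y x] by (auto simp: dist_norm norm_minus_commute abs_le_iff)
  qed fact
  then show ?thesis by (rule lipschitz_on_continuous_on)
qed

text \<open>Dominated convergence along the envelopes. The gain is that one constant
  \<open>k\<close> serves the given \<eta>: both metrics on measures control integrals of Lipschitz
  functions with explicit constants.\<close>

lemma lsc_Lipschitz_minorant:
  fixes g :: "'a::real_normed_vector \<Rightarrow> real"
  assumes Q: "Q \<in> borel_probs \<Sigma>" and g: "lsc_on \<Sigma> g" "g \<in> borel_measurable (restrict_space borel \<Sigma>)"
    "\<And>x. x \<in> \<Sigma> \<Longrightarrow> a \<le> g x" "\<And>x. x \<in> \<Sigma> \<Longrightarrow> g x \<le> b" and "\<eta> > 0"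
  obtains f k where "k \<ge> 0" "\<forall>x\<in>\<Sigma>. a \<le> f x" "\<forall>x\<in>\<Sigma>. f x \<le> g x"
    "\<forall>x\<in>\<Sigma>. \<forall>y\<in>\<Sigma>. f x \<le> f y + k * norm (x - y)"
    "f \<in> borel_measurable (restrict_space borel \<Sigma>)"
    "(\<integral>x. g x \<partial>Q) - \<eta> < (\<integral>x. f x \<partial>Q)"
proof -
  interpret prob_space Q using borel_probsD[OF Q] by simp
  have "\<Sigma> \<noteq> {}" using not_empty borel_probsD[OF Q] by simp
  let ?f = "\<lambda>k. inf_conv \<Sigma> g (real k)"
  have c: "continuous_on \<Sigma> (?f k)" for k
    by (rule Lipschitz_continuous_on[of _ _ "real k"]) (auto intro!: inf_conv_Lipschitz[OF g(3)] \<open>\<Sigma> \<noteq> {}\<close>)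
  have meas: "?f k \<in> borel_measurable (restrict_space borel \<Sigma>)" for k
    by (rule borel_measurable_continuous_on_restrict[OF c])
  have mQ: "measurable Q borel = measurable (restrict_space borel \<Sigma>) (borel :: real measure)"
    using borel_probsD(2)[OF Q] by (rule measurable_cong_sets) simp
  have bd: "a \<le> ?f k x" "?f k x \<le> g x" "?f k x \<le> b" if "x \<in> \<Sigma>" for k x
    using inf_conv_ge[of \<Sigma> a g "real k" x] inf_conv_le_self[of \<Sigma> a g "real k" x] g(3,4) \<open>\<Sigma> \<noteq> {}\<close> that
    by (auto intro: order_trans)
  have "(\<lambda>k. \<integral>x. ?f k x \<partial>Q) \<longlonglongrightarrow> (\<integral>x. g x \<partial>Q)"
  proof (rule integral_dominated_convergence[where w="\<lambda>_. max \<bar>a\<bar> \<bar>b\<bar>"])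
    show "AE x in Q. (\<lambda>k. ?f k x) \<longlonglongrightarrow> g x"
    proof (rule AE_I2)
      fix x assume "x \<in> space Q"
      then have "x \<in> \<Sigma>" using borel_probsD(3)[OF Q] by simp
      with g(3,1) show "(\<lambda>k. ?f k x) \<longlonglongrightarrow> g x" by (rule inf_conv_tendsto)
    qed
    show "AE x in Q. norm (?f k x) \<le> max \<bar>a\<bar> \<bar>b\<bar>" for k
    proof (rule AE_I2)
      fix x assume "x \<in> space Q"
      then have "x \<in> \<Sigma>" using borel_probsD(3)[OF Q] by simp
      from bd(1)[OF this, of k] bd(3)[OF this, of k] show "norm (?f k x) \<le> max \<bar>a\<bar> \<bar>b\<bar>" by auto
    qed
  qed (use g meas in \<open>auto simp: mQ\<close>)
  then have "\<forall>\<^sub>F k in sequentially. (\<integral>x. g x \<partial>Q) - \<eta> < (\<integral>x. ?f k x \<partial>Q)"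
    using \<open>\<eta> > 0\<close> by (intro order_tendstoD) auto
  then obtain k where k: "(\<integral>x. g x \<partial>Q) - \<eta> < (\<integral>x. ?f k x \<partial>Q)" by (auto dest!: eventually_happens)
  show ?thesis
  proof (rule that[of "real k" "?f k"])
    have "?f k x \<le> ?f k y + real k * norm (x - y)" for x y
      using g(3) by (rule inf_conv_Lipschitz) (use \<open>\<Sigma> \<noteq> {}\<close> in auto)
    then show "\<forall>x\<in>\<Sigma>. \<forall>y\<in>\<Sigma>. ?f k x \<le> ?f k y + real k * norm (x - y)" by blast
  qed (use bd(1,2) meas k in auto)
qed

text \<open>One half of the portmanteau theorem. A bounded Lipschitz minorant \<open>f\<close> whose
  integral still exceeds \<open>t\<close> supplies a generating open set around \<open>Q\<close>,
  and monotonicity of the integral puts it inside.\<close>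

lemma openin_weak_topology_lsc:
  fixes g :: "'a::real_normed_vector \<Rightarrow> real"
  assumes g: "lsc_on \<Sigma> g" "g \<in> borel_measurable (restrict_space borel \<Sigma>)"
    "\<And>x. x \<in> \<Sigma> \<Longrightarrow> a \<le> g x" "\<And>x. x \<in> \<Sigma> \<Longrightarrow> g x \<le> b"
  shows "openin (weak_topology \<Sigma>) {Q \<in> borel_probs \<Sigma>. t < (\<integral>x. g x \<partial>Q)}"
proof (subst openin_subopen, intro ballI)
  fix Q assume "Q \<in> {Q \<in> borel_probs \<Sigma>. t < (\<integral>x. g x \<partial>Q)}"
  then have Q: "Q \<in> borel_probs \<Sigma>" "0 < (\<integral>x. g x \<partial>Q) - t" by auto
  obtain f k where f: "k \<ge> 0" "\<forall>x\<in>\<Sigma>. a \<le> f x" "\<forall>x\<in>\<Sigma>. f x \<le> g x"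
    "\<forall>x\<in>\<Sigma>. \<forall>y\<in>\<Sigma>. f x \<le> f y + k * norm (x - y)"
    "f \<in> borel_measurable (restrict_space borel \<Sigma>)"
    "(\<integral>x. g x \<partial>Q) - ((\<integral>x. g x \<partial>Q) - t) < (\<integral>x. f x \<partial>Q)"
    by (rule lsc_Lipschitz_minorant[OF Q(1) g Q(2)])
  let ?T = "{Q \<in> borel_probs \<Sigma>. (\<integral>x. f x \<partial>Q) \<in> {t<..}}"
  have "bounded (f ` \<Sigma>)"
    using f(2,3) g(4) by (intro boundedI[of _ "max \<bar>a\<bar> \<bar>b\<bar>"]) force
  then have "openin (weak_topology \<Sigma>) ?T"
    unfolding weak_topology_def using Lipschitz_continuous_on[of \<Sigma> f k] f(1,4)
    by (intro topology_generated_by_Basis CollectI exI[of _ f] exI[of _ "{t<..}"]) auto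
  moreover have "?T \<subseteq> {Q \<in> borel_probs \<Sigma>. t < (\<integral>x. g x \<partial>Q)}"
  proof clarsimp
    fix P assume P: "P \<in> borel_probs \<Sigma>" "t < (\<integral>x. f x \<partial>P)"
    have "(\<integral>x. f x \<partial>P) \<le> (\<integral>x. g x \<partial>P)"
    proof (intro integral_mono integrable_borel_probs[OF P(1), of _ a b])
      show "f x \<le> b" if "x \<in> \<Sigma>" for x using f(3) g(4)[OF that] that by fastforce
    qed (use f g borel_probsD(3)[OF P(1)] in auto)
    with P show "t < (\<integral>x. g x \<partial>P)" by simp
  qed
  moreover have "Q \<in> ?T" using Q f(6) by simp
  ultimately show "\<exists>T. openin (weak_topology \<Sigma>) T \<and> Q \<in> T \<and> T \<subseteq> {Q \<in> borel_probs \<Sigma>. t < (\<integral>x. g x \<partial>Q)}"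
    by blast
qed

subsection \<open>Wasserstein and Levy-Prokhorov neighbourhoods\<close>

text \<open>The easy half of Kantorovich-Rubinstein duality: integrate the Lipschitz inequality
  against a coupling. A coupling of cost below \<epsilon> + e is used, as the infimum over couplings
  need not be known to be attained.\<close>

lemma wasserstein_Lipschitz_bound:
  fixes f :: "'a::euclidean_space \<Rightarrow> real"
  assumes Q: "Q \<in> borel_probs \<Sigma>" and Q': "Q' \<in> borel_probs \<Sigma>"
    and W: "wasserstein Q Q' \<le> ennreal \<epsilon>" and "\<epsilon> \<ge> 0"
    and f: "f \<in> borel_measurable (restrict_space borel \<Sigma>)" "\<And>x. x \<in> \<Sigma> \<Longrightarrow> a \<le> f x" "\<And>x. x \<in> \<Sigma> \<Longrightarrow> f x \<le> b"
    and lip: "\<And>x y. x \<in> \<Sigma> \<Longrightarrow> y \<in> \<Sigma> \<Longrightarrow> f x \<le> f y + k * norm (x - y)" and "k \<ge> 0"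
  shows "(\<integral>x. f x \<partial>Q) \<le> (\<integral>x. f x \<partial>Q') + k * \<epsilon>"
proof -
  have [measurable_cong]: "sets Q = sets (restrict_space borel \<Sigma>)" "sets Q' = sets (restrict_space borel \<Sigma>)"
    using borel_probsD(2)[OF Q] borel_probsD(2)[OF Q'] by simp_all
  note [measurable] = f(1)
  have key: "(\<integral>x. f x \<partial>Q) \<le> (\<integral>x. f x \<partial>Q') + k * (\<epsilon> + e)" if "e > 0" for e
  proof -
    have "wasserstein Q Q' < ennreal (\<epsilon> + e)"
      using W that \<open>\<epsilon> \<ge> 0\<close> by (intro le_less_trans[OF W]) (simp add: ennreal_less_iff)
    then obtain \<gamma> where \<gamma>: "\<gamma> \<in> couplings Q Q'"
      "(\<integral>\<^sup>+ (\<xi>', \<xi>). ennreal (norm (\<xi>' - \<xi>)) \<partial>\<gamma>) < ennreal (\<epsilon> + e)"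
      unfolding wasserstein_def by (auto simp: INF_less_iff)
    from \<gamma>(1) have s[measurable_cong]: "sets \<gamma> = sets (Q \<Otimes>\<^sub>M Q')"
      and d: "distr \<gamma> Q fst = Q" "distr \<gamma> Q' snd = Q'" by (auto simp: couplings_def)
    have sp: "space \<gamma> = \<Sigma> \<times> \<Sigma>"
      using sets_eq_imp_space_eq[OF s] borel_probsD(3)[OF Q] borel_probsD(3)[OF Q'] by (simp add: space_pair_measure)
    have [measurable]: "fst \<in> measurable \<gamma> borel" "snd \<in> measurable \<gamma> (borel :: 'a measure)"
      using measurable_compose[of fst \<gamma> "restrict_space borel \<Sigma>" "\<lambda>x. x" borel]
        measurable_compose[of snd \<gamma> "restrict_space borel \<Sigma>" "\<lambda>x. x" borel]
      by (auto simp: measurable_restrict_space1)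
    define n where "n z = norm (fst z - snd z)" for z :: "'a \<times> 'a"
    have [measurable]: "n \<in> borel_measurable \<gamma>" unfolding n_def by measurable
    have nn: "(\<integral>\<^sup>+z. ennreal (n z) \<partial>\<gamma>) < ennreal (\<epsilon> + e)" using \<gamma>(2) by (simp add: n_def case_prod_unfold)
    then have ni: "integrable \<gamma> n"
      by (intro integrableI_nonneg) (auto simp: n_def intro: less_trans)
    have n0: "0 \<le> n z" for z by (simp add: n_def)
    then have "(\<integral>\<^sup>+z. ennreal (n z) \<partial>\<gamma>) = ennreal (\<integral>z. n z \<partial>\<gamma>)"
      by (intro nn_integral_eq_integral[OF ni]) simp
    then have "ennreal (\<integral>z. n z \<partial>\<gamma>) < ennreal (\<epsilon> + e)"
      using nn by simp
    moreover have "0 \<le> (\<integral>z. n z \<partial>\<gamma>)" using n0 by simp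
    ultimately have nle: "(\<integral>z. n z \<partial>\<gamma>) \<le> \<epsilon> + e" by (simp add: ennreal_less_iff)
    have i1: "integrable \<gamma> (\<lambda>z. f (fst z))"
      using integrable_borel_probs[OF Q f] d(1) integrable_distr_eq[of fst \<gamma> Q f] by simp
    have i2: "integrable \<gamma> (\<lambda>z. f (snd z))"
      using integrable_borel_probs[OF Q' f] d(2) integrable_distr_eq[of snd \<gamma> Q' f] by simp
    have "(\<integral>x. f x \<partial>Q) = (\<integral>z. f (fst z) \<partial>\<gamma>)"
      using d(1) integral_distr[of fst \<gamma> Q f] by simp
    also have "\<dots> \<le> (\<integral>z. f (snd z) + k * n z \<partial>\<gamma>)"
    proof (rule integral_mono[OF i1])
      show "integrable \<gamma> (\<lambda>z. f (snd z) + k * n z)" using i2 ni by simp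
    qed (use lip in \<open>auto simp: sp n_def\<close>)
    also have "\<dots> = (\<integral>z. f (snd z) \<partial>\<gamma>) + k * (\<integral>z. n z \<partial>\<gamma>)" using i2 ni by simp
    also have "(\<integral>z. f (snd z) \<partial>\<gamma>) = (\<integral>x. f x \<partial>Q')"
      using d(2) integral_distr[of snd \<gamma> Q' f] by simp
    also have "k * (\<integral>z. n z \<partial>\<gamma>) \<le> k * (\<epsilon> + e)" using nle \<open>k \<ge> 0\<close> by (rule mult_left_mono)
    finally show ?thesis by simp
  qed
  show ?thesis
  proof (rule field_le_epsilon)
    fix e :: real assume "e > 0"
    \<comment> \<open>Dividing by k + 1 covers the case k = 0.\<close>
    then have "(\<integral>x. f x \<partial>Q) \<le> (\<integral>x. f x \<partial>Q') + k * (\<epsilon> + e / (k + 1))"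
      using \<open>k \<ge> 0\<close> by (intro key) simp
    also have "k * (e / (k + 1)) \<le> e"
      using \<open>k \<ge> 0\<close> \<open>e > 0\<close> by (simp add: divide_le_eq mult.commute mult_left_mono)
    then have "(\<integral>x. f x \<partial>Q') + k * (\<epsilon> + e / (k + 1)) \<le> (\<integral>x. f x \<partial>Q') + k * \<epsilon> + e"
      by (simp add: distrib_left)
    finally show "(\<integral>x. f x \<partial>Q) \<le> (\<integral>x. f x \<partial>Q') + k * \<epsilon> + e" .
  qed
qed

text \<open>The strict inequality produces an admissible radius below \<epsilon> whether or not the
  infimum is attained. Radius 1 is always admissible between probability measures, so the real
  infimum is not taken over the empty set, where it would be unspecified.\<close>

lemma levy_prokhorov_less:
  assumes Q: "Q \<in> borel_probs \<Sigma>" and Q': "Q' \<in> borel_probs \<Sigma>" and "levy_prokhorov \<Sigma> Q Q' < \<epsilon>"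
  obtains \<delta> where "0 < \<delta>" "\<delta> < \<epsilon>" "\<forall>S\<in>sets (restrict_space borel \<Sigma>).
    emeasure Q S \<le> outer_measure_of Q' (enlarge \<Sigma> \<delta> S) + ennreal \<delta>"
proof -
  define A where "A = {\<epsilon>. \<epsilon> > 0 \<and> (\<forall>S\<in>sets (restrict_space borel \<Sigma>).
     emeasure Q' S \<le> outer_measure_of Q (enlarge \<Sigma> \<epsilon> S) + ennreal \<epsilon> \<and>
     emeasure Q S \<le> outer_measure_of Q' (enlarge \<Sigma> \<epsilon> S) + ennreal \<epsilon>)}"
  have one: "emeasure P S \<le> R + ennreal 1" if "P \<in> borel_probs \<Sigma>" for P :: "'a measure" and S R
  proof -
    interpret P: prob_space P using borel_probsD[OF that] by simp
    have "emeasure P S \<le> 1" using P.emeasure_space_1 emeasure_space[of P S] by simp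
    then show ?thesis by (simp add: add_increasing)
  qed
  have "1 \<in> A" unfolding A_def using one[OF Q] one[OF Q'] by simp
  then have "A \<noteq> {}" by blast
  moreover have "Inf A < \<epsilon>" using assms(3) by (simp add: levy_prokhorov_def A_def conj_commute)
  ultimately obtain \<delta> where \<delta>: "\<delta> \<in> A" "\<delta> < \<epsilon>" using cInf_lessD[of A \<epsilon>] by blast
  show ?thesis by (rule that[of \<delta>]) (use \<delta> in \<open>auto simp: A_def\<close>)
qed

text \<open>A discrete layer-cake formula: the sum counts the levels j B / n up to \<open>y\<close>,
  so B / n times it is \<open>y\<close> rounded down to a grid of mesh B / n.\<close>

lemma layer_sum_bounds:
  fixes y B :: real and n :: nat
  assumes "0 \<le> y" "y \<le> B" "n > 0"
  shows "B / n * (\<Sum>j=1..n. indicator {j * B / n..} y) \<le> y"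
    and "y \<le> B / n + B / n * (\<Sum>j=1..n. indicator {j * B / n..} y)"
proof -
  have "B \<ge> 0" using assms by simp
  consider "B = 0" | "B > 0" using \<open>B \<ge> 0\<close> by linarith
  then have "B / n * (\<Sum>j=1..n. indicator {j * B / n..} y) \<le> y \<and>
    y \<le> B / n + B / n * (\<Sum>j=1..n. indicator {j * B / n..} y)"
  proof cases
    case 2
    define k where "k = nat \<lfloor>y * n / B\<rfloor>"
    have k: "real k \<le> y * n / B" "y * n / B < real k + 1"
      unfolding k_def using assms 2 by (auto simp: floor_less_iff)
    have "y * n / B \<le> n" using assms 2 by (simp add: divide_le_eq mult_right_mono mult.commute)
    then have "k \<le> n" using k(1) by linarith
    have "(\<Sum>j=1..n. indicator {j * B / n..} y) = (\<Sum>j=1..n. if j \<le> k then 1 else (0::real))"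
    proof (intro sum.cong refl)
      fix j
      have "real j * B / n \<le> y \<longleftrightarrow> real j \<le> y * n / B" using assms 2 by (simp add: field_simps)
      also have "\<dots> \<longleftrightarrow> j \<le> k" using k by linarith
      finally show "indicator {j * B / n..} y = (if j \<le> k then 1 else (0::real))" by (simp add: indicator_def)
    qed
    also have "\<dots> = real (card {j\<in>{1..n}. j \<le> k})" by (simp add: sum.If_cases Int_def)
    also have "{j\<in>{1..n}. j \<le> k} = {1..k}" using \<open>k \<le> n\<close> by auto
    finally have s: "(\<Sum>j=1..n. indicator {j * B / n..} y) = real k" by simp
    show ?thesis unfolding s using k assms 2 by (simp add: field_simps)
  qed (use assms in auto)
  then show "B / n * (\<Sum>j=1..n. indicator {j * B / n..} y) \<le> y"
    and "y \<le> B / n + B / n * (\<Sum>j=1..n. indicator {j * B / n..} y)" by auto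
qed

text \<open>Both integrals are discretised by superlevel sets. As k \<epsilon> is at most one mesh B
  / n, enlarging a superlevel set by \<delta> < \<epsilon> descends at most one level. Rounding and
  this shift cost B / n each, and n levels of weight B / n with error \<epsilon> each cost B
  \<epsilon>.\<close>

lemma levy_prokhorov_Lipschitz_bound:
  fixes f :: "'a::euclidean_space \<Rightarrow> real" and n :: nat
  assumes Q: "Q \<in> borel_probs \<Sigma>" and Q': "Q' \<in> borel_probs \<Sigma>"
    and LP: "levy_prokhorov \<Sigma> Q Q' < \<epsilon>"
    and f: "f \<in> borel_measurable (restrict_space borel \<Sigma>)" "\<And>x. x \<in> \<Sigma> \<Longrightarrow> 0 \<le> f x" "\<And>x. x \<in> \<Sigma> \<Longrightarrow> f x \<le> B"
    and lip: "\<And>x y. x \<in> \<Sigma> \<Longrightarrow> y \<in> \<Sigma> \<Longrightarrow> f x \<le> f y + k * norm (x - y)" and "k \<ge> 0"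
    and n: "n > 0" "k * \<epsilon> \<le> B / n" and "B \<ge> 0"
  shows "(\<integral>x. f x \<partial>Q) \<le> (\<integral>x. f x \<partial>Q') + 2 * B / n + B * \<epsilon>"
proof -
  obtain \<delta> where \<delta>: "0 < \<delta>" "\<delta> < \<epsilon>" "\<forall>S\<in>sets (restrict_space borel \<Sigma>).
    emeasure Q S \<le> outer_measure_of Q' (enlarge \<Sigma> \<delta> S) + ennreal \<delta>"
    by (rule levy_prokhorov_less[OF Q Q' LP])
  interpret Q: prob_space Q using borel_probsD[OF Q] by simp
  interpret Q': prob_space Q' using borel_probsD[OF Q'] by simp
  note sQ = borel_probsD(2)[OF Q] and sQ' = borel_probsD(2)[OF Q']
  note spQ = borel_probsD(3)[OF Q] and spQ' = borel_probsD(3)[OF Q']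
  define L where "L t = {x \<in> \<Sigma>. t \<le> f x}" for t
  have Lm: "L t \<in> sets (restrict_space borel \<Sigma>)" for t
    using borel_measurable_iff_ge[of f "restrict_space borel \<Sigma>"] f(1)
    by (simp add: L_def space_restrict_space)
  have LQ: "L t \<in> sets Q" "L t \<in> sets Q'" for t using Lm sQ sQ' by auto
  have step: "measure Q (L (real j * B / n)) \<le> measure Q' (L ((real j - 1) * B / n)) + \<epsilon>" for j :: nat
  proof -
    have "enlarge \<Sigma> \<delta> (L (real j * B / n)) \<subseteq> L ((real j - 1) * B / n)"
    proof
      fix y assume "y \<in> enlarge \<Sigma> \<delta> (L (real j * B / n))"
      then obtain x where x: "y \<in> \<Sigma>" "x \<in> \<Sigma>" "real j * B / n \<le> f x" "norm (y - x) \<le> \<delta>"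
        by (auto simp: enlarge_def L_def)
      have "k * norm (x - y) \<le> k * \<epsilon>"
        using x(4) \<delta>(2) \<open>k \<ge> 0\<close> by (intro mult_left_mono) (auto simp: norm_minus_commute)
      then have "real j * B / n \<le> f y + B / n" using lip[OF x(2,1)] x(3) n(2) by linarith
      then show "y \<in> L ((real j - 1) * B / n)"
        using x(1) by (simp add: L_def left_diff_distrib diff_divide_distrib)
    qed
    then have "outer_measure_of Q' (enlarge \<Sigma> \<delta> (L (real j * B / n))) \<le> emeasure Q' (L ((real j - 1) * B / n))"
      unfolding outer_measure_of_eq[OF LQ(2), symmetric] by (rule outer_measure_of_mono)
    moreover have "ennreal \<delta> \<le> ennreal \<epsilon>" using \<delta> by (intro ennreal_leI) simp
    ultimately have "emeasure Q (L (real j * B / n)) \<le> emeasure Q' (L ((real j - 1) * B / n)) + ennreal \<epsilon>"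
      by (rule order_trans[OF bspec[OF \<delta>(3) Lm] add_mono])
    then show ?thesis using \<delta>
      by (simp add: Q.emeasure_eq_measure Q'.emeasure_eq_measure ennreal_plus[symmetric] del: ennreal_plus)
  qed
  have ind: "indicator {t..} (f x) = (indicator (L t) x :: real)" if "x \<in> \<Sigma>" for t x
    using that by (auto simp: L_def indicator_def)
  have int_sum: "(\<integral>x. (\<Sum>j=1..n. indicator (L (real j * B / n)) x) \<partial>P) = (\<Sum>j=1..n. measure P (L (real j * B / n)))"
    "integrable P (\<lambda>x. (\<Sum>j=1..n. indicator (L (real j * B / n)) x) :: real)"
    if P: "P \<in> borel_probs \<Sigma>" for P
  proof -
    interpret P: prob_space P using borel_probsD[OF P] by simp
    have i: "integrable P (\<lambda>x. indicator (L t) x :: real)" "L t \<in> sets P" for t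
      using Lm borel_probsD(2)[OF P] by (auto intro!: integrable_real_indicator simp: P.emeasure_eq_measure)
    have "L t \<inter> space P = L t" for t using borel_probsD(3)[OF P] by (auto simp: L_def)
    then show "(\<integral>x. (\<Sum>j=1..n. indicator (L (real j * B / n)) x) \<partial>P) = (\<Sum>j=1..n. measure P (L (real j * B / n)))"
      using i by (subst Bochner_Integration.integral_sum) auto
    show "integrable P (\<lambda>x. (\<Sum>j=1..n. indicator (L (real j * B / n)) x) :: real)" using i by auto
  qed
  have "(\<integral>x. f x \<partial>Q) \<le> (\<integral>x. B / n + B / n * (\<Sum>j=1..n. indicator (L (real j * B / n)) x) \<partial>Q)"
  proof (rule integral_mono)
    show "integrable Q (\<lambda>x. B / n + B / n * (\<Sum>j=1..n. indicator (L (real j * B / n)) x))"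
      using int_sum(2)[OF Q] by auto
    fix x assume "x \<in> space Q"
    then have x: "x \<in> \<Sigma>" using spQ by simp
    show "f x \<le> B / n + B / n * (\<Sum>j=1..n. indicator (L (real j * B / n)) x)"
      using layer_sum_bounds(2)[OF f(2,3)[OF x] n(1)] by (simp add: ind[OF x])
  qed (rule integrable_borel_probs[OF Q f])
  also have "\<dots> = B / n + B / n * (\<Sum>j=1..n. measure Q (L (real j * B / n)))"
    using int_sum[OF Q] by (simp add: Q.prob_space)
  also have "\<dots> \<le> B / n + B / n * (\<Sum>j=1..n. measure Q' (L ((real j - 1) * B / n)) + \<epsilon>)"
    using step \<open>B \<ge> 0\<close> by (intro add_left_mono mult_left_mono sum_mono) auto
  also have "\<dots> = B / n + B / n * (\<Sum>j=1..n. measure Q' (L ((real j - 1) * B / n))) + B * \<epsilon>"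
    using n(1) by (simp add: sum.distrib field_simps)
  \<comment> \<open>The shifted sum runs over the levels 0 to n - 1. Level 0 has probability at most
    1, and adding level n restores the layer sum for \<open>Q'\<close>.\<close>
  also have "(\<Sum>j=1..n. measure Q' (L ((real j - 1) * B / n))) = (\<Sum>j<n. measure Q' (L (real j * B / n)))"
    by (rule sum.reindex_bij_witness[of _ Suc "\<lambda>j. j - 1"]) (auto simp: of_nat_diff)
  also have "\<dots> \<le> (\<Sum>j\<in>insert 0 {1..n}. measure Q' (L (real j * B / n)))"
    by (rule sum_mono2) auto
  also have "\<dots> \<le> 1 + (\<Sum>j=1..n. measure Q' (L (real j * B / n)))" by simp
  finally have 1: "(\<integral>x. f x \<partial>Q) \<le> B / n + B / n * (1 + (\<Sum>j=1..n. measure Q' (L (real j * B / n)))) + B * \<epsilon>"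
    using \<open>B \<ge> 0\<close> by (simp add: mult_left_mono divide_right_mono)
  have "B / n * (\<Sum>j=1..n. measure Q' (L (real j * B / n))) = (\<integral>x. B / n * (\<Sum>j=1..n. indicator (L (real j * B / n)) x) \<partial>Q')"
    using int_sum[OF Q'] by simp
  also have "\<dots> \<le> (\<integral>x. f x \<partial>Q')"
  proof (rule integral_mono)
    show "integrable Q' (\<lambda>x. B / n * (\<Sum>j=1..n. indicator (L (real j * B / n)) x))"
      using int_sum(2)[OF Q'] by auto
    fix x assume "x \<in> space Q'"
    then have x: "x \<in> \<Sigma>" using spQ' by simp
    show "B / n * (\<Sum>j=1..n. indicator (L (real j * B / n)) x) \<le> f x"
      using layer_sum_bounds(1)[OF f(2,3)[OF x] n(1)] by (simp add: ind[OF x])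
  qed (rule integrable_borel_probs[OF Q' f])
  finally show ?thesis using 1 by (simp add: distrib_left)
qed

subsection \<open>Mixtures\<close>

text \<open>The measure t P + (1 - t) Q, as the law of a draw from \<open>P\<close> or
  \<open>Q\<close> decided by a coin, so that its masses and integrals come from the rules for
  \<open>\<bind>\<close>.\<close>

definition mixture :: "real \<Rightarrow> 'a measure \<Rightarrow> 'a measure \<Rightarrow> 'a measure" where
  "mixture t P Q = measure_pmf (bernoulli_pmf t) \<bind> (\<lambda>b. if b then P else Q)"

context
  fixes t :: real and P Q :: "'a measure" and M :: "'a measure"
  assumes t: "0 \<le> t" "t \<le> 1" and P: "prob_space P" "sets P = sets M" and Q: "prob_space Q" "sets Q = sets M"
begin

lemma mixture_kernel:
  "(\<lambda>b. if b then P else Q) \<in> measurable (measure_pmf (bernoulli_pmf t)) (subprob_algebra M)"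
proof -
  have "P \<in> space (subprob_algebra M)" "Q \<in> space (subprob_algebra M)"
    using P Q by (simp_all add: space_subprob_algebra prob_space_imp_subprob_space)
  then show ?thesis by simp
qed

lemma sets_mixture: "sets (mixture t P Q) = sets M"
  unfolding mixture_def using P(2) Q(2) by (intro sets_bind) auto

lemma emeasure_mixture:
  assumes "A \<in> sets M"
  shows "emeasure (mixture t P Q) A = ennreal t * emeasure P A + ennreal (1 - t) * emeasure Q A"
  unfolding mixture_def using assms t
  by (subst emeasure_bind[OF _ mixture_kernel]) (auto simp: mult.commute)

lemma prob_space_mixture: "prob_space (mixture t P Q)"
proof
  interpret P: prob_space P by fact
  interpret Q: prob_space Q by fact
  have "space P = space M" "space Q = space M" "space (mixture t P Q) = space M"
    using sets_eq_imp_space_eq[OF P(2)] sets_eq_imp_space_eq[OF Q(2)] sets_eq_imp_space_eq[OF sets_mixture]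
    by simp_all
  then show "emeasure (mixture t P Q) (space (mixture t P Q)) = 1"
    using emeasure_mixture[of "space M"] P.emeasure_space_1 Q.emeasure_space_1 t
    by (simp add: ennreal_plus[symmetric] del: ennreal_plus)
qed

lemma integral_mixture:
  fixes f :: "'a \<Rightarrow> real"
  assumes "f \<in> borel_measurable M" "\<And>x. x \<in> space M \<Longrightarrow> \<bar>f x\<bar> \<le> B"
  shows "(\<integral>x. f x \<partial>mixture t P Q) = t * (\<integral>x. f x \<partial>P) + (1 - t) * (\<integral>x. f x \<partial>Q)"
proof -
  interpret P: prob_space P by fact
  interpret Q: prob_space Q by fact
  show ?thesis
    unfolding mixture_def using t P.emeasure_space_1 Q.emeasure_space_1
    by (subst integral_bind[OF assms mixture_kernel, where B'=1])
      (auto simp: mult.commute measure_pmf.finite_measure_axioms)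
qed

end

text \<open>With \<open>f = dQ/dP\<close>, the density of the mixture with respect to \<open>Q\<close> is \<open>w = (1 - t) / f + t\<close>, and
  \<open>ln w \<ge> - (1 - t) ln f\<close> by concavity.\<close>

lemma D_KL_mixture_le:
  assumes P: "prob_space P" and Q: "prob_space Q" and s: "sets Q = sets P"
    and D: "D_KL Q P \<le> ereal d" and t: "0 < t" "t < 1"
  shows "D_KL Q (mixture t Q P) \<le> ereal ((1 - t) * d)"
proof -
  interpret P: prob_space P by fact
  interpret Q: prob_space Q by fact
  obtain f :: "'a \<Rightarrow> real" where f: "f \<in> borel_measurable P" "\<forall>x. 0 \<le> f x"
    "Q = density P (\<lambda>x. ennreal (f x))" "AE x in Q. 0 < f x"
    "integrable Q (\<lambda>x. ln (f x))" "(\<integral>x. ln (f x) \<partial>Q) \<le> d"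
    "integrable Q (\<lambda>x. 1 / f x)"
    "\<forall>A\<in>sets P. (\<integral>\<^sup>+x. ennreal (1 / f x) * indicator A x \<partial>Q) \<le> emeasure P A"
    by (rule D_KL_finiteE[OF P Q s D])
  have t': "0 \<le> t" "t \<le> 1" using t by auto
  have [measurable]: "f \<in> borel_measurable Q" using f(1) s by (simp cong: measurable_cong_sets)
  define w where "w x = (1 - t) * (1 / f x) + t" for x
  have wm[measurable]: "w \<in> borel_measurable Q" unfolding w_def by measurable
  \<comment> \<open>The summand \<open>t\<close> keeps \<open>w\<close> away from 0, which makes ln
    w integrable.\<close>
  have wt: "w x \<ge> t" for x unfolding w_def using f(2) t by simp
  have w0: "w x > 0" for x using wt[of x] t by simp
  have wi: "integrable Q w" unfolding w_def by (intro Bochner_Integration.integrable_add integrable_mult_right f(7)) auto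
  have lni: "integrable Q (\<lambda>x. ln (w x))"
  proof (rule Bochner_Integration.integrable_bound)
    show "integrable Q (\<lambda>x. \<bar>ln t\<bar> + w x)" using wi by auto
    show "AE x in Q. norm (ln (w x)) \<le> norm (\<bar>ln t\<bar> + w x)"
    proof (rule AE_I2)
      fix x
      have "ln t \<le> ln (w x)" using wt[of x] w0[of x] t by simp
      moreover have "ln (w x) \<le> w x" using ln_le_id[OF w0] .
      ultimately show "norm (ln (w x)) \<le> norm (\<bar>ln t\<bar> + w x)" using w0[of x] by auto
    qed
  qed measurable
  \<comment> \<open>\<open>density Q w\<close> misses the mass that (1 - t) P puts on the
    \<open>Q\<close>-null set where \<open>f = 0\<close>. It is a minorant of the mixture, which is
    what \<open>D_KL_le\<close> asks for.\<close>
  have "D_KL Q (mixture t Q P) \<le> ereal (- (\<integral>x. ln (w x) \<partial>Q))"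
  proof (rule D_KL_le)
    show "prob_space (mixture t Q P)" by (rule prob_space_mixture[OF t' Q s P refl])
    show "sets Q = sets (mixture t Q P)" using sets_mixture[OF t' Q s P refl] s by simp
    fix A assume "A \<in> sets (mixture t Q P)"
    then have A: "A \<in> sets P" using sets_mixture[OF t' Q s P refl] by simp
    then have [measurable]: "A \<in> sets Q" using s by simp
    have "emeasure (density Q (\<lambda>x. ennreal (w x))) A = (\<integral>\<^sup>+x. ennreal (w x) * indicator A x \<partial>Q)"
      by (rule emeasure_density) measurable
    also have "\<dots> = (\<integral>\<^sup>+x. ennreal (1 - t) * (ennreal (1 / f x) * indicator A x) + ennreal t * indicator A x \<partial>Q)"
    proof (intro nn_integral_cong)
      fix x
      have "ennreal (w x) = ennreal (1 - t) * ennreal (1 / f x) + ennreal t"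
        unfolding w_def using f(2) t
        by (simp add: ennreal_mult[symmetric] ennreal_plus[symmetric] del: ennreal_plus)
      then show "ennreal (w x) * indicator A x
          = ennreal (1 - t) * (ennreal (1 / f x) * indicator A x) + ennreal t * indicator A x"
        by (simp add: distrib_right mult.assoc)
    qed
    also have "\<dots> = ennreal (1 - t) * (\<integral>\<^sup>+x. ennreal (1 / f x) * indicator A x \<partial>Q) + ennreal t * emeasure Q A"
      by (subst nn_integral_add) (auto simp: nn_integral_cmult)
    also have "\<dots> \<le> ennreal (1 - t) * emeasure P A + ennreal t * emeasure Q A"
      using bspec[OF f(8) A] by (intro add_right_mono mult_left_mono) auto
    also have "\<dots> = emeasure (mixture t Q P) A"
      using emeasure_mixture[OF t' Q s P refl A] by (simp add: add.commute)
    finally show "emeasure (density Q (\<lambda>x. ennreal (w x))) A \<le> emeasure (mixture t Q P) A" .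
  qed (use w0 Q wm lni in auto)
  also have "- (\<integral>x. ln (w x) \<partial>Q) \<le> (1 - t) * (\<integral>x. ln (f x) \<partial>Q)"
  proof -
    have "(\<integral>x. - (1 - t) * ln (f x) \<partial>Q) \<le> (\<integral>x. ln (w x) \<partial>Q)"
    proof (rule integral_mono_AE)
      show "AE x in Q. - (1 - t) * ln (f x) \<le> ln (w x)"
        using f(4)
      proof eventually_elim
        case (elim x)
        have "(1 - t) * ln (1 / f x) + t * ln 1 \<le> ln ((1 - t) * (1 / f x) + t * 1)"
          using concave_onD[OF ln_concave, of t "1 / f x" 1] elim t by simp
        then show ?case using elim by (simp add: w_def ln_div algebra_simps)
      qed
    qed (use f(5) lni in auto)
    moreover have "(\<integral>x. - (1 - t) * ln (f x) \<partial>Q) = - ((1 - t) * (\<integral>x. ln (f x) \<partial>Q))"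
      by (subst integral_mult_right_zero) (rule mult_minus_left)
    ultimately show ?thesis by linarith
  qed
  also have "\<dots> \<le> (1 - t) * d" using f(6) t by (intro mult_left_mono) auto
  finally show ?thesis by simp
qed

subsection \<open>Duality for the worst-case expectation\<close>

lemma D_KL_self:
  assumes "prob_space Q"
  shows "D_KL Q Q \<le> 0"
proof -
  interpret prob_space Q by fact
  have "D_KL Q Q \<le> ereal (- (\<integral>x. ln 1 \<partial>Q))"
    by (rule D_KL_le[OF assms assms refl]) (auto simp: density_1)
  then show ?thesis by (simp add: zero_ereal_def)
qed

text \<open>The loss at one fixed decision. The maximiser is a parameter because the worst-case
  distributions constructed below put their missing mass on it.\<close>

locale usc_loss =
  fixes \<Sigma> :: "'a::euclidean_space set" and l :: "'a \<Rightarrow> real" and b M :: real and \<xi>\<^sub>0 :: 'a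
  assumes usc: "usc_map (top_of_set \<Sigma>) l"
    and lb: "\<And>\<xi>. \<xi> \<in> \<Sigma> \<Longrightarrow> b \<le> l \<xi>" and ub: "\<And>\<xi>. \<xi> \<in> \<Sigma> \<Longrightarrow> l \<xi> \<le> M"
    and max: "\<xi>\<^sub>0 \<in> \<Sigma>" "l \<xi>\<^sub>0 = M"
begin

definition "mean_ln Q \<alpha> = (\<integral>\<xi>. ln (\<alpha> - l \<xi>) \<partial>Q)"

definition "dual r Q \<alpha> = \<alpha> - exp (mean_ln Q \<alpha> - r)"

lemma l_meas: "l \<in> borel_measurable (restrict_space borel \<Sigma>)"
  by (rule usc_map_borel_measurable[OF usc])

lemma bM: "b \<le> M" using lb ub max(1) by (meson order_trans)

lemma integrable_l: "P \<in> borel_probs \<Sigma> \<Longrightarrow> integrable P l"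
  by (rule integrable_borel_probs[OF _ l_meas lb ub])

lemma integral_l_le: 
  assumes "P \<in> borel_probs \<Sigma>" shows "(\<integral>\<xi>. l \<xi> \<partial>P) \<le> M"
proof -
  interpret prob_space P using borel_probsD[OF assms] by simp
  show ?thesis using borel_probsD(3)[OF assms] ub by (intro integral_le_const integrable_l assms) auto
qed

lemma ln_bounds:
  assumes "\<alpha> > M" "\<xi> \<in> \<Sigma>"
  shows "ln (\<alpha> - M) \<le> ln (\<alpha> - l \<xi>)" "ln (\<alpha> - l \<xi>) \<le> ln (\<alpha> - b)"
  using lb[OF assms(2)] ub[OF assms(2)] assms(1) by auto

lemma ln_meas: "(\<lambda>\<xi>. ln (\<alpha> - l \<xi>)) \<in> borel_measurable (restrict_space borel \<Sigma>)"
  using l_meas by measurable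

lemma integrable_ln:
  assumes "P \<in> borel_probs \<Sigma>" "\<alpha> > M"
  shows "integrable P (\<lambda>\<xi>. ln (\<alpha> - l \<xi>))"
  by (rule integrable_borel_probs[OF assms(1) ln_meas ln_bounds[OF assms(2)]])

lemma lsc_ln: "\<alpha> > M \<Longrightarrow> lsc_on \<Sigma> (\<lambda>\<xi>. ln (\<alpha> - l \<xi>))"
  using ub by (intro usc_map_ln_diff[OF usc]) (auto intro: le_less_trans)

lemma openin_mean_ln:
  assumes "\<alpha> > M"
  shows "openin (weak_topology \<Sigma>) {Q \<in> borel_probs \<Sigma>. t < mean_ln Q \<alpha>}"
  unfolding mean_ln_def by (rule openin_weak_topology_lsc[OF lsc_ln[OF assms] ln_meas ln_bounds[OF assms]])

lemma usc_map_dual: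
  assumes "\<alpha> > M"
  shows "usc_map (weak_topology \<Sigma>) (\<lambda>Q. dual r Q \<alpha>)"
  unfolding usc_map_def
proof
  fix a
  show "openin (weak_topology \<Sigma>) {Q \<in> topspace (weak_topology \<Sigma>). dual r Q \<alpha> < a}"
  \<comment> \<open>The dual expression is always below \<alpha>, so for a \<ge> \<alpha> the set is
    the whole space; for a < \<alpha> it is a strict superlevel set of
    \<open>mean_ln\<close>.\<close>
  proof (cases "a < \<alpha>")
    case True
    have "dual r Q \<alpha> < a \<longleftrightarrow> ln (\<alpha> - a) + r < mean_ln Q \<alpha>" for Q
    proof -
      have "dual r Q \<alpha> < a \<longleftrightarrow> exp (ln (\<alpha> - a)) < exp (mean_ln Q \<alpha> - r)" using True by (auto simp: dual_def)
      then show ?thesis by (simp only: exp_less_cancel_iff) linarith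
    qed
    then show ?thesis using openin_mean_ln[OF assms] by simp
  next
    case False
    have "dual r Q \<alpha> < a" for Q
    proof -
      have "0 < exp (mean_ln Q \<alpha> - r)" by simp
      with False show ?thesis unfolding dual_def by linarith
    qed
    then show ?thesis by (simp add: topspace_weak_topology[symmetric] del: topspace_weak_topology)
  qed
qed

text \<open>Weak duality, with \<open>S\<close> standing for a small ball around \<open>Q\<close>.\<close>

lemma integral_l_le_dual:
  assumes P: "P \<in> borel_probs \<Sigma>" and S: "S \<subseteq> borel_probs \<Sigma>"
    and D: "(INF Q'\<in>S. D_KL Q' P) \<le> ereal r" and "\<alpha> > M" "\<eta> > 0"
    and A: "\<And>Q'. Q' \<in> S \<Longrightarrow> mean_ln Q \<alpha> - \<eta> < mean_ln Q' \<alpha>"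
  shows "(\<integral>\<xi>. l \<xi> \<partial>P) \<le> dual (r + 2 * \<eta>) Q \<alpha>"
proof -
  \<comment> \<open>One \<eta> pays for a near-minimiser \<open>Q'\<close>, as the infimum may not
    be attained; the other pays for replacing \<open>Q'\<close> by \<open>Q\<close> in
    \<open>mean_ln\<close>.\<close>
  have "(INF Q'\<in>S. D_KL Q' P) < ereal (r + \<eta>)" using D \<open>\<eta> > 0\<close> by (intro le_less_trans[OF D]) simp
  then obtain Q' where Q': "Q' \<in> S" "D_KL Q' P < ereal (r + \<eta>)" by (auto simp: INF_less_iff)
  then have Q'S: "Q' \<in> borel_probs \<Sigma>" using S by auto
  interpret P: prob_space P using borel_probsD[OF P] by simp
  have "exp ((\<integral>\<xi>. ln (\<alpha> - l \<xi>) \<partial>Q') - (r + \<eta>)) \<le> (\<integral>\<xi>. \<alpha> - l \<xi> \<partial>P)"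
  proof (rule D_KL_dual_bound)
    show "0 < \<alpha> - l \<xi>" if "\<xi> \<in> space P" for \<xi>
      using ub[of \<xi>] that borel_probsD(3)[OF P] \<open>\<alpha> > M\<close> by simp
  qed (use borel_probsD[OF P] borel_probsD[OF Q'S] Q' integrable_l[OF P] integrable_ln[OF Q'S \<open>\<alpha> > M\<close>] in auto)
  also have "\<dots> = \<alpha> - (\<integral>\<xi>. l \<xi> \<partial>P)" using integrable_l[OF P] by (simp add: P.prob_space)
  finally have "exp (mean_ln Q' \<alpha> - (r + \<eta>)) \<le> \<alpha> - (\<integral>\<xi>. l \<xi> \<partial>P)" by (simp add: mean_ln_def)
  moreover have "exp (mean_ln Q \<alpha> - (r + 2 * \<eta>)) \<le> exp (mean_ln Q' \<alpha> - (r + \<eta>))" using A[OF Q'(1)] by simp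
  ultimately show ?thesis unfolding dual_def by linarith
qed

text \<open>The derivative of \<open>mean_ln Q\<close> at \<alpha>, and the total mass of the
  measure with density 1 / (\<alpha> - l) with respect to \<open>Q\<close>.\<close>

definition "mean_inv Q \<alpha> = (\<integral>\<xi>. 1 / (\<alpha> - l \<xi>) \<partial>Q)"

lemma inv_bounds:
  assumes "\<alpha> > M" "\<xi> \<in> \<Sigma>"
  shows "1 / (\<alpha> - b) \<le> 1 / (\<alpha> - l \<xi>)" "1 / (\<alpha> - l \<xi>) \<le> 1 / (\<alpha> - M)"
  using lb[OF assms(2)] ub[OF assms(2)] assms(1) by (auto intro!: divide_left_mono)

lemma inv_meas: "(\<lambda>\<xi>. 1 / (\<alpha> - l \<xi>)) \<in> borel_measurable (restrict_space borel \<Sigma>)"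
  using l_meas by measurable

lemma integrable_inv:
  assumes "P \<in> borel_probs \<Sigma>" "\<alpha> > M"
  shows "integrable P (\<lambda>\<xi>. 1 / (\<alpha> - l \<xi>))"
  by (rule integrable_borel_probs[OF assms(1) inv_meas inv_bounds[OF assms(2)]])

context
  fixes Q assumes Q: "Q \<in> borel_probs \<Sigma>"
begin

interpretation Q: prob_space Q using borel_probsD[OF Q] by simp

lemma mean_inv_bounds:
  assumes "\<alpha> > M"
  shows "1 / (\<alpha> - b) \<le> mean_inv Q \<alpha>" "mean_inv Q \<alpha> \<le> 1 / (\<alpha> - M)" "0 < mean_inv Q \<alpha>"
proof -
  show l: "1 / (\<alpha> - b) \<le> mean_inv Q \<alpha>" unfolding mean_inv_def
    using borel_probsD(3)[OF Q] inv_bounds[OF assms]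
    by (intro Q.integral_ge_const integrable_inv[OF Q assms]) auto
  show "mean_inv Q \<alpha> \<le> 1 / (\<alpha> - M)" unfolding mean_inv_def
    using borel_probsD(3)[OF Q] inv_bounds[OF assms]
    by (intro Q.integral_le_const integrable_inv[OF Q assms]) auto
  have "0 < 1 / (\<alpha> - b)" using assms bM by simp
  with l show "0 < mean_inv Q \<alpha>" by linarith
qed

lemma mean_ln_le:
  assumes "\<alpha> > M" shows "mean_ln Q \<alpha> \<le> ln (\<alpha> - b)"
  unfolding mean_ln_def
  using borel_probsD(3)[OF Q] ln_bounds[OF assms]
  by (intro Q.integral_le_const integrable_ln[OF Q assms]) auto

text \<open>Together with the bound for \<open>mean_inv\<close>, this makes \<open_phi> continuous
  for the intermediate value argument. The constant blows up as \<open>c\<close> approaches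
  \<open>M\<close>, so continuity is obtained on each half-line {c..} separately.\<close>

lemma mean_ln_Lipschitz:
  assumes "c > M" "c \<le> \<alpha>" "c \<le> \<beta>"
  shows "mean_ln Q \<alpha> \<le> mean_ln Q \<beta> + 1 / (c - M) * norm (\<alpha> - \<beta>)"
proof -
  have "mean_ln Q \<alpha> \<le> (\<integral>\<xi>. ln (\<beta> - l \<xi>) + 1 / (c - M) * norm (\<alpha> - \<beta>) \<partial>Q)"
    unfolding mean_ln_def
  proof (rule integral_mono)
    show "integrable Q (\<lambda>\<xi>. ln (\<alpha> - l \<xi>))" using assms by (intro integrable_ln[OF Q]) simp
    show "integrable Q (\<lambda>\<xi>. ln (\<beta> - l \<xi>) + 1 / (c - M) * norm (\<alpha> - \<beta>))"
      using assms by (intro Bochner_Integration.integrable_add integrable_ln[OF Q]) auto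
    fix \<xi> assume "\<xi> \<in> space Q"
    then have u: "l \<xi> \<le> M" using ub borel_probsD(3)[OF Q] by simp
    define u v where "u = \<alpha> - l \<xi>" and "v = \<beta> - l \<xi>"
    have uv: "u > 0" "v > 0" "c - M \<le> v" "u - v = \<alpha> - \<beta>" using u assms by (auto simp: u_def v_def)
    have "ln u - ln v \<le> u / v - 1" using ln_le_minus_one[of "u / v"] uv by (simp add: ln_div)
    also have "\<dots> = (u - v) / v" using uv by (simp add: field_simps)
    also have "\<dots> \<le> \<bar>u - v\<bar> / v" using uv by (intro divide_right_mono) auto
    also have "\<dots> \<le> \<bar>u - v\<bar> / (c - M)" using uv assms by (intro divide_left_mono) auto
    finally have "ln u \<le> ln v + \<bar>u - v\<bar> / (c - M)" by simp
    then show "ln (\<alpha> - l \<xi>) \<le> ln (\<beta> - l \<xi>) + 1 / (c - M) * norm (\<alpha> - \<beta>)"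
      unfolding uv(4) by (simp add: u_def v_def)
  qed
  also have "\<dots> = mean_ln Q \<beta> + 1 / (c - M) * norm (\<alpha> - \<beta>)"
    unfolding mean_ln_def using integrable_ln[OF Q, of \<beta>] assms by (subst Bochner_Integration.integral_add) (auto simp: Q.prob_space)
  finally show ?thesis .
qed

lemma mean_inv_Lipschitz:
  assumes "c > M" "c \<le> \<alpha>" "c \<le> \<beta>"
  shows "mean_inv Q \<alpha> \<le> mean_inv Q \<beta> + 1 / (c - M)\<^sup>2 * norm (\<alpha> - \<beta>)"
proof -
  have "mean_inv Q \<alpha> \<le> (\<integral>\<xi>. 1 / (\<beta> - l \<xi>) + 1 / (c - M)\<^sup>2 * norm (\<alpha> - \<beta>) \<partial>Q)"
    unfolding mean_inv_def
  proof (rule integral_mono)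
    show "integrable Q (\<lambda>\<xi>. 1 / (\<alpha> - l \<xi>))" using assms by (intro integrable_inv[OF Q]) simp
    show "integrable Q (\<lambda>\<xi>. 1 / (\<beta> - l \<xi>) + 1 / (c - M)\<^sup>2 * norm (\<alpha> - \<beta>))"
      using assms by (intro Bochner_Integration.integrable_add integrable_inv[OF Q]) auto
    fix \<xi> assume "\<xi> \<in> space Q"
    then have u: "l \<xi> \<le> M" using ub borel_probsD(3)[OF Q] by simp
    define u v where "u = \<alpha> - l \<xi>" and "v = \<beta> - l \<xi>"
    have uv: "u > 0" "v > 0" "c - M \<le> v" "c - M \<le> u" "u - v = \<alpha> - \<beta>" using u assms by (auto simp: u_def v_def)
    have "1 / u - 1 / v = (v - u) / (u * v)" using uv by (simp add: field_simps)
    also have "\<dots> \<le> \<bar>u - v\<bar> / (u * v)" using uv by (intro divide_right_mono) auto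
    also have "\<dots> \<le> \<bar>u - v\<bar> / (c - M)\<^sup>2"
      unfolding power2_eq_square using uv assms by (intro divide_left_mono mult_mono) auto
    finally have "1 / u \<le> 1 / v + \<bar>u - v\<bar> / (c - M)\<^sup>2" by simp
    then show "1 / (\<alpha> - l \<xi>) \<le> 1 / (\<beta> - l \<xi>) + 1 / (c - M)\<^sup>2 * norm (\<alpha> - \<beta>)"
      unfolding uv(5) by (simp add: u_def v_def)
  qed
  also have "\<dots> = mean_inv Q \<beta> + 1 / (c - M)\<^sup>2 * norm (\<alpha> - \<beta>)"
    unfolding mean_inv_def using integrable_inv[OF Q, of \<beta>] assms by (subst Bochner_Integration.integral_add) (auto simp: Q.prob_space)
  finally show ?thesis .
qed

text \<open>The derivative of \<open>dual r Q\<close> at \<alpha> is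
  \<open>1 - exp (\<phi> \<alpha> - r)\<close>, so \<open>\<phi> \<alpha> = r\<close> is the
  stationarity condition of the dual problem.\<close>

definition "\<phi> \<alpha> = mean_ln Q \<alpha> + ln (mean_inv Q \<alpha>)"

lemma continuous_on_\<phi>:
  assumes "c > M" shows "continuous_on {c..} \<phi>"
proof -
  have "continuous_on {c..} (mean_ln Q)"
    by (rule Lipschitz_continuous_on[of _ _ "1 / (c - M)"]) (use assms mean_ln_Lipschitz in auto)
  moreover have "continuous_on {c..} (mean_inv Q)"
    by (rule Lipschitz_continuous_on[of _ _ "1 / (c - M)\<^sup>2"]) (use assms mean_inv_Lipschitz in auto)
  moreover have "mean_inv Q \<alpha> \<noteq> 0" if "\<alpha> \<in> {c..}" for \<alpha> using mean_inv_bounds(3)[of \<alpha>] assms that by auto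
  ultimately have "continuous_on {c..} (\<lambda>\<alpha>. mean_ln Q \<alpha> + ln (mean_inv Q \<alpha>))" by (intro continuous_intros) auto
  then show ?thesis by (simp add: \<phi>_def[abs_def])
qed

lemma \<phi>_le_at_large:
  assumes "r > 0"
  obtains \<alpha> where "\<alpha> > M" "\<phi> \<alpha> \<le> r"
proof
  \<comment> \<open>\<phi> is bounded by ln ((\<alpha> - b) / (\<alpha> - M)), and this \<alpha>
    makes the quotient at most exp r. The summand 1 keeps \<alpha> above \<open>M\<close> when b =
    M.\<close>
  define \<alpha> where "\<alpha> = M + (M - b) / (exp r - 1) + 1"
  have e: "exp r - 1 > 0" using assms by simp
  then have "(M - b) / (exp r - 1) \<ge> 0" using bM by simp
  then show \<alpha>: "\<alpha> > M" by (simp add: \<alpha>_def)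
  have "(M - b) / (exp r - 1) \<le> \<alpha> - M" by (simp add: \<alpha>_def)
  then have "M - b \<le> (\<alpha> - M) * (exp r - 1)" using e by (simp add: pos_divide_le_eq)
  then have "\<alpha> - b \<le> exp r * (\<alpha> - M)" by (simp add: algebra_simps)
  then have "ln (\<alpha> - b) \<le> ln (exp r * (\<alpha> - M))" using \<alpha> bM by (subst ln_le_cancel_iff) auto
  also have "\<dots> = r + ln (\<alpha> - M)" using \<alpha> by (simp add: ln_mult)
  finally have "mean_ln Q \<alpha> \<le> r + ln (\<alpha> - M)" using mean_ln_le[OF \<alpha>] by simp
  moreover have "ln (mean_inv Q \<alpha>) \<le> ln (1 / (\<alpha> - M))" using mean_inv_bounds[OF \<alpha>] \<alpha> by (subst ln_le_cancel_iff) auto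
  ultimately show "\<phi> \<alpha> \<le> r" using \<alpha> by (simp add: \<phi>_def ln_div)
qed

text \<open>The adversarial distribution has density \<open>\<kappa> / (\<alpha> - l)\<close> with respect to \<open>Q\<close>, and the missing mass
  \<open>1 - s\<close> is put on the maximiser \<open>\<xi>\<^sub>0\<close> of the loss.\<close>

lemma ex_adversarial_distribution:
  assumes \<alpha>: "\<alpha> > M" and "\<phi> \<alpha> \<le> r"
  obtains P where "P \<in> borel_probs \<Sigma>" "D_KL Q P \<le> ereal r"
    "(\<integral>\<xi>. l \<xi> \<partial>P) = dual r Q \<alpha> - (1 - exp (\<phi> \<alpha> - r)) * (\<alpha> - M)"
proof -
  note [measurable_cong] = borel_probsD(2)[OF Q]
  note spQ = borel_probsD(3)[OF Q]
  have lm[measurable]: "l \<in> borel_measurable Q"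
    using l_meas borel_probsD(2)[OF Q] by (simp cong: measurable_cong_sets)
  define i where "i = mean_inv Q \<alpha>"
  \<comment> \<open>\<open>s\<close> is the mass of the measure with density \<kappa> / (\<alpha> -
    l) with respect to \<open>Q\<close>, and \<open>\<phi> \<alpha> \<le> r\<close> says exactly
    that this mass is at most 1. The factor \<kappa> is chosen so that ln (\<kappa> / (\<alpha> -
    l)) has \<open>Q\<close>-integral - r, which makes the divergence bound equal to r.\<close>
  define s where "s = exp (\<phi> \<alpha> - r)"
  define \<kappa> where "\<kappa> = exp (mean_ln Q \<alpha> - r)"
  have i: "i > 0" unfolding i_def by (rule mean_inv_bounds(3)[OF \<alpha>])
  have s: "0 < s" "s \<le> 1" unfolding s_def using assms by auto
  have s_eq: "s = \<kappa> * i" unfolding s_def \<kappa>_def \<phi>_def i_def[symmetric] using i by (simp add: exp_add exp_diff)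
  have s': "0 \<le> s" "s \<le> 1" using s by auto
  have pos: "0 < \<alpha> - l \<xi>" if "\<xi> \<in> \<Sigma>" for \<xi> using ub[OF that] \<alpha> by simp
  define P0 where "P0 = density Q (\<lambda>\<xi>. ennreal (1 / (i * (\<alpha> - l \<xi>))))"
  have nn: "AE \<xi> in Q. 0 \<le> 1 / (i * (\<alpha> - l \<xi>))"
  proof (rule AE_I2)
    fix \<xi> assume "\<xi> \<in> space Q"
    then show "0 \<le> 1 / (i * (\<alpha> - l \<xi>))" using pos[of \<xi>] spQ i by simp
  qed
  have eq: "(\<lambda>\<xi>. 1 / (i * (\<alpha> - l \<xi>))) = (\<lambda>\<xi>. 1 / i * (1 / (\<alpha> - l \<xi>)))" by (rule ext) simp
  have int: "integrable Q (\<lambda>\<xi>. 1 / (i * (\<alpha> - l \<xi>)))"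
    unfolding eq by (intro integrable_mult_right integrable_inv[OF Q \<alpha>])
  have int1: "(\<integral>\<xi>. 1 / (i * (\<alpha> - l \<xi>)) \<partial>Q) = 1"
    unfolding eq using i by (subst integral_mult_right_zero) (simp add: i_def mean_inv_def)
  have P0: "prob_space P0"
  proof
    have "emeasure P0 (space P0) = (\<integral>\<^sup>+\<xi>. ennreal (1 / (i * (\<alpha> - l \<xi>))) \<partial>Q)"
      unfolding P0_def by (subst emeasure_density) (auto intro!: nn_integral_cong)
    also have "\<dots> = 1" using nn_integral_eq_integral[OF int nn] int1 by simp
    finally show "emeasure P0 (space P0) = 1" .
  qed
  have sP0: "sets P0 = sets Q" by (simp add: P0_def)
  let ?R = "return Q \<xi>\<^sub>0"
  have R: "prob_space ?R" "sets ?R = sets Q" using max(1) spQ by (auto intro: prob_space_return)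
  define P where "P = mixture s P0 ?R"
  note mix = s' P0 sP0 R
  have sP: "sets P = sets Q" unfolding P_def by (rule sets_mixture[OF mix])
  have prP: "prob_space P" unfolding P_def by (rule prob_space_mixture[OF mix])
  have P: "P \<in> borel_probs \<Sigma>" using prP sP borel_probsD(2)[OF Q] by (simp add: borel_probs_def)
  have "(\<integral>\<xi>. l \<xi> \<partial>P0) = (\<integral>\<xi>. 1 / (i * (\<alpha> - l \<xi>)) * l \<xi> \<partial>Q)"
    unfolding P0_def using nn by (subst integral_real_density) auto
  also have "\<dots> = (\<integral>\<xi>. \<alpha> * (1 / (i * (\<alpha> - l \<xi>))) - 1 / i \<partial>Q)"
  proof (rule Bochner_Integration.integral_cong[OF refl])
    fix \<xi> assume "\<xi> \<in> space Q"
    then have "0 < \<alpha> - l \<xi>" using pos spQ by simp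
    then show "1 / (i * (\<alpha> - l \<xi>)) * l \<xi> = \<alpha> * (1 / (i * (\<alpha> - l \<xi>))) - 1 / i"
      using i by (simp add: field_simps)
  qed
  also have "\<dots> = \<alpha> * (\<integral>\<xi>. 1 / (i * (\<alpha> - l \<xi>)) \<partial>Q) - 1 / i"
    by (subst Bochner_Integration.integral_diff, intro integrable_mult_right int, simp,
        subst integral_mult_right_zero) (simp add: Q.prob_space)
  finally have lP0: "(\<integral>\<xi>. l \<xi> \<partial>P0) = \<alpha> - 1 / i" unfolding int1 by simp
  have lR: "(\<integral>\<xi>. l \<xi> \<partial>?R) = M" using max spQ by (subst integral_return) auto
  have "(\<integral>\<xi>. l \<xi> \<partial>P) = s * (\<alpha> - 1 / i) + (1 - s) * M"
    unfolding P_def lP0[symmetric] lR[symmetric]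
  proof (rule integral_mixture[OF mix])
    show "\<bar>l \<xi>\<bar> \<le> \<bar>b\<bar> + \<bar>M\<bar>" if "\<xi> \<in> space Q" for \<xi>
      using lb[of \<xi>] ub[of \<xi>] that spQ by auto
  qed measurable
  also have "\<dots> = dual r Q \<alpha> - (1 - s) * (\<alpha> - M)"
    using i by (simp add: dual_def \<kappa>_def[symmetric] s_eq field_simps)
  finally have lP: "(\<integral>\<xi>. l \<xi> \<partial>P) = dual r Q \<alpha> - (1 - exp (\<phi> \<alpha> - r)) * (\<alpha> - M)" by (simp add: s_def)
  define w where "w \<xi> = \<kappa> / (\<alpha> - l \<xi>)" for \<xi>
  have ln_w: "ln (w \<xi>) = mean_ln Q \<alpha> - r - ln (\<alpha> - l \<xi>)" if "\<xi> \<in> space Q" for \<xi>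
    using pos[of \<xi>] that spQ by (simp add: w_def \<kappa>_def ln_div)
  \<comment> \<open>Here \<open>density Q w\<close> is s times \<open>P0\<close>, that is,
    \<open>P\<close> without the contribution of the atom.\<close>
  have "D_KL Q P \<le> ereal (- (\<integral>\<xi>. ln (w \<xi>) \<partial>Q))"
  proof (rule D_KL_le[OF prP Q.prob_space_axioms sP[symmetric]])
    show "w \<in> borel_measurable Q" unfolding w_def by measurable
    show "AE \<xi> in Q. 0 < w \<xi>" using pos spQ by (auto simp: w_def \<kappa>_def)
    have "integrable Q (\<lambda>\<xi>. mean_ln Q \<alpha> - r - ln (\<alpha> - l \<xi>))" using integrable_ln[OF Q \<alpha>] by auto
    then show "integrable Q (\<lambda>\<xi>. ln (w \<xi>))" using ln_w by (subst Bochner_Integration.integrable_cong[OF refl]) auto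
    fix B assume "B \<in> sets P"
    then have B[measurable]: "B \<in> sets Q" using sP by simp
    have "emeasure (density Q (\<lambda>\<xi>. ennreal (w \<xi>))) B = (\<integral>\<^sup>+\<xi>. ennreal (w \<xi>) * indicator B \<xi> \<partial>Q)"
      unfolding w_def by (rule emeasure_density) measurable
    also have "\<dots> = (\<integral>\<^sup>+\<xi>. ennreal s * (ennreal (1 / (i * (\<alpha> - l \<xi>))) * indicator B \<xi>) \<partial>Q)"
    proof (rule nn_integral_cong)
      fix \<xi> assume "\<xi> \<in> space Q"
      then have "0 < \<alpha> - l \<xi>" using pos spQ by simp
      then have "ennreal (w \<xi>) = ennreal s * ennreal (1 / (i * (\<alpha> - l \<xi>)))"
        using i s by (subst ennreal_mult[symmetric]) (auto simp: w_def s_eq)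
      then show "ennreal (w \<xi>) * indicator B \<xi> = ennreal s * (ennreal (1 / (i * (\<alpha> - l \<xi>))) * indicator B \<xi>)"
        by (simp add: mult.assoc)
    qed
    also have "\<dots> = ennreal s * emeasure P0 B"
      unfolding P0_def by (subst emeasure_density) (auto simp: nn_integral_cmult)
    also have "\<dots> \<le> emeasure P B" unfolding P_def by (subst emeasure_mixture[OF mix B]) simp
    finally show "emeasure (density Q (\<lambda>\<xi>. ennreal (w \<xi>))) B \<le> emeasure P B" .
  qed
  also have "(\<integral>\<xi>. ln (w \<xi>) \<partial>Q) = (\<integral>\<xi>. mean_ln Q \<alpha> - r - ln (\<alpha> - l \<xi>) \<partial>Q)"
    using ln_w by (rule Bochner_Integration.integral_cong[OF refl])
  also have "\<dots> = - r" using integrable_ln[OF Q \<alpha>] by (simp add: mean_ln_def Q.prob_space)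
  finally have "D_KL Q P \<le> ereal r" by simp
  from that[OF P this lP] show ?thesis .
qed

text \<open>At a stationary point the gap
  \<open>(1 - exp (\<phi> \<alpha> - r)) * (\<alpha> - M)\<close> vanishes. If there is none,
  continuity and the bound at a large \<alpha> keep \<phi> below \<open>r\<close> on the whole
  half-line above \<open>M\<close>. Then any \<alpha> within \<eta> of \<open>M\<close> has gap at
  most \<eta>, and the atom of the adversarial distribution carries positive mass.\<close>

lemma strong_duality:
  assumes "r > 0" "\<eta> > 0"
  obtains \<alpha> P where "\<alpha> > M" "P \<in> borel_probs \<Sigma>" "D_KL Q P \<le> ereal r" "dual r Q \<alpha> \<le> (\<integral>\<xi>. l \<xi> \<partial>P) + \<eta>"
proof (cases "\<exists>\<alpha>>M. \<phi> \<alpha> = r")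
  case True
  then obtain \<alpha> where \<alpha>: "\<alpha> > M" "\<phi> \<alpha> = r" by blast
  then have le: "\<phi> \<alpha> \<le> r" by simp
  obtain P where P: "P \<in> borel_probs \<Sigma>" "D_KL Q P \<le> ereal r"
    "(\<integral>\<xi>. l \<xi> \<partial>P) = dual r Q \<alpha> - (1 - exp (\<phi> \<alpha> - r)) * (\<alpha> - M)"
    by (rule ex_adversarial_distribution[OF \<alpha>(1) le])
  show ?thesis by (rule that[OF \<alpha>(1) P(1,2)]) (use P(3) \<alpha>(2) assms in simp)
next
  case False
  obtain \<alpha>1 where \<alpha>1: "\<alpha>1 > M" "\<phi> \<alpha>1 \<le> r" by (rule \<phi>_le_at_large[OF assms(1)])
  define \<alpha> where "\<alpha> = min \<alpha>1 (M + \<eta>)"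
  have \<alpha>: "\<alpha> > M" "\<alpha> \<le> M + \<eta>" "\<alpha> \<le> \<alpha>1" using \<alpha>1(1) assms(2) by (auto simp: \<alpha>_def)
  have le: "\<phi> \<alpha> \<le> r"
  proof (rule ccontr)
    assume "\<not> \<phi> \<alpha> \<le> r"
    then have "\<exists>x. \<alpha> \<le> x \<and> x \<le> \<alpha>1 \<and> \<phi> x = r"
      using continuous_on_subset[OF continuous_on_\<phi>[OF \<alpha>(1)], of "{\<alpha>..\<alpha>1}"] \<alpha>1(2) \<alpha>(3)
      by (intro IVT2') auto
    then obtain x where x: "\<alpha> \<le> x" "\<phi> x = r" by blast
    then have "x > M" using \<alpha>(1) by simp
    with False x(2) show False by blast
  qed
  obtain P where P: "P \<in> borel_probs \<Sigma>" "D_KL Q P \<le> ereal r"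
    "(\<integral>\<xi>. l \<xi> \<partial>P) = dual r Q \<alpha> - (1 - exp (\<phi> \<alpha> - r)) * (\<alpha> - M)"
    by (rule ex_adversarial_distribution[OF \<alpha>(1) le])
  have "(1 - exp (\<phi> \<alpha> - r)) * (\<alpha> - M) \<le> 1 * \<eta>"
    using \<alpha> le by (intro mult_mono) auto
  with P(3) have "dual r Q \<alpha> \<le> (\<integral>\<xi>. l \<xi> \<partial>P) + \<eta>" by simp
  from that[OF \<alpha>(1) P(1,2) this] show ?thesis .
qed

end

end

subsection \<open>Shrinking neighbourhoods\<close>

lemma wasserstein_self:
  fixes Q :: "'a::euclidean_space measure"
  assumes "Q \<in> borel_probs \<Sigma>"
  shows "wasserstein Q Q = 0"
proof -
  have [measurable_cong]: "sets Q = sets (restrict_space borel \<Sigma>)" using borel_probsD(2)[OF assms] .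
  let ?\<gamma> = "distr Q (Q \<Otimes>\<^sub>M Q) (\<lambda>x. (x, x))"
  have [measurable]: "(\<lambda>x. (x, x)) \<in> measurable Q (Q \<Otimes>\<^sub>M Q)" by measurable
  have "distr ?\<gamma> Q fst = Q" "distr ?\<gamma> Q snd = Q"
    by (subst distr_distr; simp add: comp_def distr_id2)+
  then have c: "?\<gamma> \<in> couplings Q Q" by (simp add: couplings_def)
  have fs: "fst \<in> measurable (Q \<Otimes>\<^sub>M Q) borel" "snd \<in> measurable (Q \<Otimes>\<^sub>M Q) (borel :: 'a measure)"
    using measurable_compose[of fst "Q \<Otimes>\<^sub>M Q" "restrict_space borel \<Sigma>" "\<lambda>x. x" borel]
      measurable_compose[of snd "Q \<Otimes>\<^sub>M Q" "restrict_space borel \<Sigma>" "\<lambda>x. x" borel]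
    by (auto simp: measurable_restrict_space1)
  note [measurable] = fs
  have m: "(\<lambda>z. ennreal (norm (fst z - snd z))) \<in> borel_measurable (Q \<Otimes>\<^sub>M Q)"
    by measurable
  have "(\<integral>\<^sup>+ (\<xi>', \<xi>). ennreal (norm (\<xi>' - \<xi>)) \<partial>?\<gamma>) = (\<integral>\<^sup>+ x. ennreal (norm (x - x)) \<partial>Q)"
    using m by (subst nn_integral_distr) (simp_all add: case_prod_unfold)
  also have "\<dots> = 0" by simp
  finally have "wasserstein Q Q \<le> 0"
    unfolding wasserstein_def by (intro INF_lower2[OF c]) simp
  then show ?thesis by simp
qed

lemma levy_prokhorov_self:
  assumes "Q \<in> borel_probs \<Sigma>"
  shows "levy_prokhorov \<Sigma> Q Q \<le> 0"
proof (rule field_le_epsilon)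
  fix e :: real assume "e > 0"
  have "emeasure Q S \<le> outer_measure_of Q (enlarge \<Sigma> e S) + ennreal e" if "S \<in> sets (restrict_space borel \<Sigma>)" for S
  proof -
    have S: "S \<in> sets Q" using that borel_probsD(2)[OF assms] by simp
    have "S \<subseteq> \<Sigma>" using sets.sets_into_space[OF S] borel_probsD(3)[OF assms] by simp
    then have "S \<subseteq> enlarge \<Sigma> e S" using \<open>e > 0\<close> by (force simp: enlarge_def)
    then have "outer_measure_of Q S \<le> outer_measure_of Q (enlarge \<Sigma> e S)" by (rule outer_measure_of_mono)
    then show ?thesis using S by (simp add: add_increasing2)
  qed
  then show "levy_prokhorov \<Sigma> Q Q \<le> 0 + e"
    unfolding levy_prokhorov_def using \<open>e > 0\<close> by (intro cInf_lower bdd_belowI[of _ 0]) auto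
qed

context
  fixes \<Sigma> :: "'a::euclidean_space set" and g :: "'a \<Rightarrow> real" and a b :: real and Q :: "'a measure" and \<eta> :: real
  assumes g: "lsc_on \<Sigma> g" "g \<in> borel_measurable (restrict_space borel \<Sigma>)"
    "\<And>x. x \<in> \<Sigma> \<Longrightarrow> a \<le> g x" "\<And>x. x \<in> \<Sigma> \<Longrightarrow> g x \<le> b"
    and Q: "Q \<in> borel_probs \<Sigma>" and \<eta>: "\<eta> > 0"
begin

text \<open>The minorant \<open>f\<close> and its constant \<open>k\<close> depend on
  \<open>Q\<close> and \<eta> only, so one \<epsilon> works for every \<open>Q'\<close> in the
  ball.\<close>

lemma wasserstein_lsc_integral:
  "\<forall>\<^sub>F \<epsilon> in at_right 0. \<forall>Q'\<in>borel_probs \<Sigma>. wasserstein Q Q' \<le> ennreal \<epsilon> \<longrightarrow>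
    (\<integral>x. g x \<partial>Q) - \<eta> < (\<integral>x. g x \<partial>Q')"
proof -
  have "\<eta> / 2 > 0" using \<eta> by simp
  obtain f k where f: "k \<ge> 0" "\<forall>x\<in>\<Sigma>. a \<le> f x" "\<forall>x\<in>\<Sigma>. f x \<le> g x"
    "\<forall>x\<in>\<Sigma>. \<forall>y\<in>\<Sigma>. f x \<le> f y + k * norm (x - y)"
    "f \<in> borel_measurable (restrict_space borel \<Sigma>)"
    "(\<integral>x. g x \<partial>Q) - \<eta> / 2 < (\<integral>x. f x \<partial>Q)"
    by (rule lsc_Lipschitz_minorant[OF Q g \<open>\<eta> / 2 > 0\<close>])
  have fb: "f x \<le> b" if "x \<in> \<Sigma>" for x using f(3) g(4)[OF that] that by fastforce
  have "((\<lambda>\<epsilon>. k * \<epsilon>) \<longlongrightarrow> k * 0) (at_right 0)" by (intro tendsto_intros)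
  then have "\<forall>\<^sub>F \<epsilon> in at_right 0. k * \<epsilon> < \<eta> / 2" using \<eta> by (intro order_tendstoD) auto
  moreover have "\<forall>\<^sub>F \<epsilon> in at_right (0::real). \<epsilon> > 0" by (rule eventually_at_right_less)
  ultimately show ?thesis
  proof eventually_elim
    case (elim \<epsilon>)
    show ?case
    proof (intro ballI impI)
      fix Q' assume Q': "Q' \<in> borel_probs \<Sigma>" "wasserstein Q Q' \<le> ennreal \<epsilon>"
      have "(\<integral>x. f x \<partial>Q) \<le> (\<integral>x. f x \<partial>Q') + k * \<epsilon>"
        by (rule wasserstein_Lipschitz_bound[OF Q Q' _ f(5), where a=a and b=b]) (use elim f fb in auto)
      moreover have "(\<integral>x. f x \<partial>Q') \<le> (\<integral>x. g x \<partial>Q')"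
        by (intro integral_mono integrable_borel_probs[OF Q'(1), of _ a b])
          (use f fb g borel_probsD(3)[OF Q'(1)] in auto)
      ultimately show "(\<integral>x. g x \<partial>Q) - \<eta> < (\<integral>x. g x \<partial>Q')" using f(6) elim by linarith
    qed
  qed
qed

lemma levy_prokhorov_lsc_integral:
  "\<forall>\<^sub>F \<epsilon> in at_right 0. \<forall>Q'\<in>borel_probs \<Sigma>. levy_prokhorov \<Sigma> Q Q' \<le> \<epsilon> \<longrightarrow>
    (\<integral>x. g x \<partial>Q) - \<eta> < (\<integral>x. g x \<partial>Q')"
proof -
  have "\<eta> / 2 > 0" using \<eta> by simp
  obtain f k where f: "k \<ge> 0" "\<forall>x\<in>\<Sigma>. a \<le> f x" "\<forall>x\<in>\<Sigma>. f x \<le> g x"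
    "\<forall>x\<in>\<Sigma>. \<forall>y\<in>\<Sigma>. f x \<le> f y + k * norm (x - y)"
    "f \<in> borel_measurable (restrict_space borel \<Sigma>)"
    "(\<integral>x. g x \<partial>Q) - \<eta> / 2 < (\<integral>x. f x \<partial>Q)"
    by (rule lsc_Lipschitz_minorant[OF Q g \<open>\<eta> / 2 > 0\<close>])
  have fb: "f x \<le> b" if "x \<in> \<Sigma>" for x using f(3) g(4)[OF that] that by fastforce
  \<comment> \<open>\<open>B\<close> is a positive bound for the shifted minorant f - a. The loss
    \<eta> is split into \<eta> / 2 for the minorant, \<eta> / 4 for the grid error 2 B / n and
    \<eta> / 4 for B (2 \<epsilon>).\<close>
  define B where "B = \<bar>b - a\<bar> + 1"
  have B: "B > 0" "\<And>x. x \<in> \<Sigma> \<Longrightarrow> f x - a \<le> B" unfolding B_def using fb by fastforce+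
  obtain n :: nat where n: "8 * B / \<eta> < real n" using reals_Archimedean2 by blast
  have "0 < 8 * B / \<eta>" using B(1) \<eta> by simp
  then have n0: "n > 0" using n by (cases n) auto
  have nB: "2 * B / n < \<eta> / 4" using n n0 \<eta> by (simp add: field_simps)
  have small: "\<forall>\<^sub>F \<epsilon> in at_right 0. c * (2 * \<epsilon>) < d" if "d > 0" for c d :: real
  proof (rule order_tendstoD(2))
    show "((\<lambda>\<epsilon>. c * (2 * \<epsilon>)) \<longlongrightarrow> c * (2 * 0)) (at_right 0)" by (intro tendsto_intros)
  qed (use that in simp)
  have "\<forall>\<^sub>F \<epsilon> in at_right 0. k * (2 * \<epsilon>) < B / n" by (rule small) (use n0 B(1) in simp)
  moreover have "\<forall>\<^sub>F \<epsilon> in at_right 0. B * (2 * \<epsilon>) < \<eta> / 4" by (rule small) (use \<eta> in simp)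
  moreover have "\<forall>\<^sub>F \<epsilon> in at_right (0::real). \<epsilon> > 0" by (rule eventually_at_right_less)
  ultimately show ?thesis
  proof eventually_elim
    case (elim \<epsilon>)
    show ?case
    proof (intro ballI impI)
      fix Q' assume Q': "Q' \<in> borel_probs \<Sigma>" "levy_prokhorov \<Sigma> Q Q' \<le> \<epsilon>"
      have i: "integrable Q f" "integrable Q' f"
        using f(2) fb by (auto intro!: integrable_borel_probs[OF Q f(5), of a b]
            integrable_borel_probs[OF Q'(1) f(5), of a b])
      interpret Q: prob_space Q using borel_probsD[OF Q] by simp
      interpret Q': prob_space Q' using borel_probsD[OF Q'(1)] by simp
      have "(\<integral>x. f x - a \<partial>Q) \<le> (\<integral>x. f x - a \<partial>Q') + 2 * B / n + B * (2 * \<epsilon>)"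
      proof (rule levy_prokhorov_Lipschitz_bound[OF Q Q'(1)])
        \<comment> \<open>The ball is given by a weak inequality, while the Lipschitz bound asks for
          a strict one; hence the doubled radius.\<close>
        show "levy_prokhorov \<Sigma> Q Q' < 2 * \<epsilon>" using Q'(2) elim by linarith
        show "(\<lambda>x. f x - a) \<in> borel_measurable (restrict_space borel \<Sigma>)" using f(5) by measurable
        show "f x - a \<le> (f y - a) + k * norm (x - y)" if "x \<in> \<Sigma>" "y \<in> \<Sigma>" for x y using f(4) that by fastforce
      qed (use f B n0 elim in auto)
      then have "(\<integral>x. f x \<partial>Q) \<le> (\<integral>x. f x \<partial>Q') + 2 * B / n + B * (2 * \<epsilon>)"
        using i by (simp add: Q.prob_space Q'.prob_space)
      moreover have "(\<integral>x. f x \<partial>Q') \<le> (\<integral>x. g x \<partial>Q')"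
        by (intro integral_mono integrable_borel_probs[OF Q'(1), of _ a b])
          (use f fb g borel_probsD(3)[OF Q'(1)] in auto)
      ultimately show "(\<integral>x. g x \<partial>Q) - \<eta> < (\<integral>x. g x \<partial>Q')" using f(6) elim nB by linarith
    qed
  qed
qed

end

section \<open>Convergence of the smoothed worst-case expectations\<close>

context usc_loss begin

definition "worst_case D r Q = (SUP P\<in>{P \<in> borel_probs \<Sigma>. D Q P \<le> ereal r}. \<integral>\<xi>. l \<xi> \<partial>P)"

lemma worst_case_ge:
  assumes "P \<in> borel_probs \<Sigma>" "D Q P \<le> ereal r"
  shows "(\<integral>\<xi>. l \<xi> \<partial>P) \<le> worst_case D r Q"
  unfolding worst_case_def
proof (rule cSUP_upper)
  show "bdd_above ((\<lambda>P. \<integral>\<xi>. l \<xi> \<partial>P) ` {P \<in> borel_probs \<Sigma>. D Q P \<le> ereal r})"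
    using integral_l_le by (intro bdd_aboveI2[where M=M]) auto
qed (use assms in simp)

lemma worst_case_le:
  assumes "P \<in> borel_probs \<Sigma>" "D Q P \<le> ereal r"
    and "\<And>P. P \<in> borel_probs \<Sigma> \<Longrightarrow> D Q P \<le> ereal r \<Longrightarrow> (\<integral>\<xi>. l \<xi> \<partial>P) \<le> K"
  shows "worst_case D r Q \<le> K"
  unfolding worst_case_def using assms by (intro cSUP_least) auto

text \<open>\<open>S \<epsilon>\<close> stands for the \<epsilon>-ball around \<open>Q\<close> in
  either metric. It contains \<open>Q\<close>, so smoothing can only increase the supremum. The
  reverse bound is weak duality at one near-optimal \<alpha>; this \<alpha> and the slack
  \<open>e\<close>, absorbed by continuity of the dual expression in \<open>r\<close>, are fixed
  before \<epsilon>.\<close>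

lemma worst_case_tendsto:
  fixes D :: "real \<Rightarrow> 'a measure \<Rightarrow> 'a measure \<Rightarrow> ereal"
  assumes Q: "Q \<in> borel_probs \<Sigma>" and "r > 0"
    and S: "\<And>\<epsilon>. \<epsilon> > 0 \<Longrightarrow> Q \<in> S \<epsilon>" "\<And>\<epsilon>. S \<epsilon> \<subseteq> borel_probs \<Sigma>"
    and D: "\<And>\<epsilon> P. D \<epsilon> Q P = (INF Q'\<in>S \<epsilon>. D_KL Q' P)"
    and ev: "\<And>\<alpha> \<eta>. \<alpha> > M \<Longrightarrow> \<eta> > 0 \<Longrightarrow> \<forall>\<^sub>F \<epsilon> in at_right 0. \<forall>Q'\<in>S \<epsilon>. mean_ln Q \<alpha> - \<eta> < mean_ln Q' \<alpha>"
  shows "((\<lambda>\<epsilon>. worst_case (D \<epsilon>) r Q) \<longlongrightarrow> worst_case D_KL r Q) (at_right 0)"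
proof -
  have pos: "\<forall>\<^sub>F \<epsilon> in at_right (0::real). \<epsilon> > 0" by (rule eventually_at_right_less)
  have D_le: "D \<epsilon> Q P \<le> D_KL Q P" if "\<epsilon> > 0" for \<epsilon> P
    unfolding D by (rule INF_lower[OF S(1)[OF that]])
  \<comment> \<open>\<open>Q\<close> itself is feasible, so the suprema are over nonempty sets; a
    real supremum over the empty set would be unspecified.\<close>
  have "D_KL Q Q \<le> 0" by (rule D_KL_self) (use borel_probsD[OF Q] in simp)
  also have "0 \<le> ereal r" using \<open>r > 0\<close> by simp
  finally have QQ: "D_KL Q Q \<le> ereal r" .
  have ge: "worst_case D_KL r Q \<le> worst_case (D \<epsilon>) r Q" if "\<epsilon> > 0" for \<epsilon>
  proof (rule worst_case_le[where D=D_KL, OF Q QQ])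
    fix P assume P: "P \<in> borel_probs \<Sigma>" "D_KL Q P \<le> ereal r"
    show "(\<integral>\<xi>. l \<xi> \<partial>P) \<le> worst_case (D \<epsilon>) r Q"
      by (rule worst_case_ge[where D="D \<epsilon>", OF P(1) order_trans[OF D_le[OF that] P(2)]])
  qed
  show ?thesis
  proof (rule order_tendstoI)
    fix a assume a: "a < worst_case D_KL r Q"
    show "\<forall>\<^sub>F \<epsilon> in at_right 0. a < worst_case (D \<epsilon>) r Q"
      using pos
    proof eventually_elim
      case (elim \<epsilon>)
      show ?case by (rule less_le_trans[OF a ge[OF elim]])
    qed
  next
    fix a assume a: "worst_case D_KL r Q < a"
    define \<eta> where "\<eta> = (a - worst_case D_KL r Q) / 2"
    have \<eta>: "\<eta> > 0" using a by (simp add: \<eta>_def)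
    obtain \<alpha> P where \<alpha>: "\<alpha> > M" "P \<in> borel_probs \<Sigma>" "D_KL Q P \<le> ereal r" "dual r Q \<alpha> \<le> (\<integral>\<xi>. l \<xi> \<partial>P) + \<eta>"
      by (rule strong_duality[OF Q \<open>r > 0\<close> \<eta>])
    have "(\<integral>\<xi>. l \<xi> \<partial>P) \<le> worst_case D_KL r Q" by (rule worst_case_ge[where D=D_KL, OF \<alpha>(2,3)])
    then have less: "dual r Q \<alpha> < a" using \<alpha>(4) \<eta> by (simp add: \<eta>_def field_simps)
    have "((\<lambda>e. dual (r + 2 * e) Q \<alpha>) \<longlongrightarrow> dual (r + 2 * 0) Q \<alpha>) (at_right 0)"
      unfolding dual_def by (intro tendsto_intros)
    then have "\<forall>\<^sub>F e in at_right 0. dual (r + 2 * e) Q \<alpha> < a" using less by (intro order_tendstoD) auto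
    then have "\<forall>\<^sub>F e in at_right 0. dual (r + 2 * e) Q \<alpha> < a \<and> e > 0" using pos by (rule eventually_conj)
    then obtain e where e: "dual (r + 2 * e) Q \<alpha> < a" "e > 0"
      using eventually_happens'[of "at_right (0::real)"] by (metis (lifting) trivial_limit_at_right_real)
    show "\<forall>\<^sub>F \<epsilon> in at_right 0. worst_case (D \<epsilon>) r Q < a"
      using ev[OF \<alpha>(1) e(2)] pos
    proof eventually_elim
      case (elim \<epsilon>)
      have "worst_case (D \<epsilon>) r Q \<le> dual (r + 2 * e) Q \<alpha>"
      proof (rule worst_case_le[where D="D \<epsilon>", OF Q order_trans[OF D_le[OF elim(2)] QQ]])
        fix P assume P: "P \<in> borel_probs \<Sigma>" "D \<epsilon> Q P \<le> ereal r"
        show "(\<integral>\<xi>. l \<xi> \<partial>P) \<le> dual (r + 2 * e) Q \<alpha>"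
          by (rule integral_l_le_dual[OF P(1) S(2) P(2)[unfolded D] \<alpha>(1) e(2)]) (use elim(1) in blast)
      qed
      with e(1) show ?case by simp
    qed
  qed
qed

lemma worst_case_W_tendsto:
  assumes Q: "Q \<in> borel_probs \<Sigma>" and "r > 0"
  shows "((\<lambda>\<epsilon>. worst_case (D_KL_W \<Sigma> \<epsilon>) r Q) \<longlongrightarrow> worst_case D_KL r Q) (at_right 0)"
proof (rule worst_case_tendsto[OF Q \<open>r > 0\<close>, where S="\<lambda>\<epsilon>. {Q' \<in> borel_probs \<Sigma>. wasserstein Q Q' \<le> ennreal \<epsilon>}"])
  fix \<alpha> \<eta> :: real assume "\<alpha> > M" "\<eta> > 0"
  have "\<forall>\<^sub>F \<epsilon> in at_right 0. \<forall>Q'\<in>borel_probs \<Sigma>. wasserstein Q Q' \<le> ennreal \<epsilon> \<longrightarrow> mean_ln Q \<alpha> - \<eta> < mean_ln Q' \<alpha>"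
    unfolding mean_ln_def
    by (rule wasserstein_lsc_integral[OF lsc_ln[OF \<open>\<alpha> > M\<close>] ln_meas ln_bounds[OF \<open>\<alpha> > M\<close>] Q \<open>\<eta> > 0\<close>])
  then show "\<forall>\<^sub>F \<epsilon> in at_right 0. \<forall>Q'\<in>{Q' \<in> borel_probs \<Sigma>. wasserstein Q Q' \<le> ennreal \<epsilon>}. mean_ln Q \<alpha> - \<eta> < mean_ln Q' \<alpha>"
    by eventually_elim blast
qed (use Q wasserstein_self[OF Q] in \<open>auto simp: D_KL_W_def\<close>)

lemma worst_case_LP_tendsto:
  assumes Q: "Q \<in> borel_probs \<Sigma>" and "r > 0"
  shows "((\<lambda>\<epsilon>. worst_case (D_KL_LP \<Sigma> \<epsilon>) r Q) \<longlongrightarrow> worst_case D_KL r Q) (at_right 0)"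
proof (rule worst_case_tendsto[OF Q \<open>r > 0\<close>, where S="\<lambda>\<epsilon>. {Q' \<in> borel_probs \<Sigma>. levy_prokhorov \<Sigma> Q Q' \<le> \<epsilon>}"])
  fix \<alpha> \<eta> :: real assume "\<alpha> > M" "\<eta> > 0"
  have "\<forall>\<^sub>F \<epsilon> in at_right 0. \<forall>Q'\<in>borel_probs \<Sigma>. levy_prokhorov \<Sigma> Q Q' \<le> \<epsilon> \<longrightarrow> mean_ln Q \<alpha> - \<eta> < mean_ln Q' \<alpha>"
    unfolding mean_ln_def
    by (rule levy_prokhorov_lsc_integral[OF lsc_ln[OF \<open>\<alpha> > M\<close>] ln_meas ln_bounds[OF \<open>\<alpha> > M\<close>] Q \<open>\<eta> > 0\<close>])
  then show "\<forall>\<^sub>F \<epsilon> in at_right 0. \<forall>Q'\<in>{Q' \<in> borel_probs \<Sigma>. levy_prokhorov \<Sigma> Q Q' \<le> \<epsilon>}. mean_ln Q \<alpha> - \<eta> < mean_ln Q' \<alpha>"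
    by eventually_elim blast
qed (use Q levy_prokhorov_self[OF Q] in \<open>auto simp: D_KL_LP_def intro: order_trans\<close>)

end

subsection \<open>Empirical distributions\<close>

text \<open>For \<open>N = 0\<close> the empirical measure is the zero measure. Hence the condition
  \<open>N > 0\<close> in what follows, which a limit superior does not notice.\<close>

lemma empirical_borel_probs:
  assumes "N > 0" "\<And>i. i < N \<Longrightarrow> \<omega> i \<in> \<Sigma>"
  shows "empirical \<Sigma> N \<omega> \<in> borel_probs \<Sigma>"
proof -
  have "prob_space (uniform_count_measure {..<N})" using assms(1) by (intro prob_space_uniform_count_measure) auto
  then have "prob_space (empirical \<Sigma> N \<omega>)"
    unfolding empirical_def using assms(2)
    by (intro prob_space.prob_space_distr) (auto simp: measurable_def space_uniform_count_measure
        sets_uniform_count_measure space_restrict_space)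
  then show ?thesis by (simp add: borel_probs_def empirical_def)
qed

lemma integral_empirical:
  fixes f :: "'a::topological_space \<Rightarrow> real"
  assumes "\<And>i. i < N \<Longrightarrow> \<omega> i \<in> \<Sigma>" "f \<in> borel_measurable (restrict_space borel \<Sigma>)"
  shows "(\<integral>x. f x \<partial>empirical \<Sigma> N \<omega>) = (\<Sum>i<N. f (\<omega> i)) / real N"
proof -
  have "(\<integral>x. f x \<partial>empirical \<Sigma> N \<omega>) = (\<integral>i. f (\<omega> i) \<partial>uniform_count_measure {..<N})"
    unfolding empirical_def using assms
    by (intro integral_distr) (auto simp: measurable_def space_uniform_count_measure
        sets_uniform_count_measure space_restrict_space)
  also have "\<dots> = (\<Sum>i<N. 1 / real N * f (\<omega> i))"
    unfolding uniform_count_measure_def by (subst lebesgue_integral_point_measure_finite) auto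
  also have "\<dots> = (\<Sum>i<N. f (\<omega> i)) / real N" by (simp add: sum_divide_distrib)
  finally show ?thesis .
qed

lemma empirical_cong: "(\<And>i. i < N \<Longrightarrow> \<omega> i = \<omega>' i) \<Longrightarrow> empirical \<Sigma> N \<omega> = empirical \<Sigma> N \<omega>'"
  unfolding empirical_def by (intro distr_cong) (auto simp: space_uniform_count_measure)

text \<open>The integrals that generate the weak topology are, at an empirical measure, finite
  averages of continuous functions of the coordinates.\<close>

lemma continuous_map_empirical:
  fixes \<Sigma> :: "'a::topological_space set"
  assumes "N > 0"
  shows "continuous_map (top_of_set {\<omega>. \<forall>i. \<omega> i \<in> \<Sigma>}) (weak_topology \<Sigma>) (empirical \<Sigma> N)"
  unfolding weak_topology_def continuous_on_generated_topo_iff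
proof (intro conjI allI impI)
  let ?S = "{\<omega> :: nat \<Rightarrow> 'a. \<forall>i. \<omega> i \<in> \<Sigma>}"
  have emp: "empirical \<Sigma> N \<omega> \<in> borel_probs \<Sigma>" if "\<omega> \<in> ?S" for \<omega>
    using that assms by (intro empirical_borel_probs) auto
  fix B assume "B \<in> {{P \<in> borel_probs \<Sigma>. (\<integral>\<xi>. f \<xi> \<partial>P) \<in> U} | (f :: 'a \<Rightarrow> real) U.
        continuous_on \<Sigma> f \<and> bounded (f ` \<Sigma>) \<and> open U}"
  then obtain f :: "'a \<Rightarrow> real" and U where B: "B = {P \<in> borel_probs \<Sigma>. (\<integral>\<xi>. f \<xi> \<partial>P) \<in> U}"
    and f: "continuous_on \<Sigma> f" and U: "open U" by blast
  have fm: "f \<in> borel_measurable (restrict_space borel \<Sigma>)" by (rule borel_measurable_continuous_on_restrict[OF f])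
  have c: "continuous_on ?S (\<lambda>\<omega>. (\<Sum>i<N. f (\<omega> i)) / real N)"
  proof (intro continuous_intros)
    fix i
    have "continuous_on UNIV (\<lambda>\<omega> :: nat \<Rightarrow> 'a. \<omega> i)" by (rule continuous_on_product_coordinates)
    then have "continuous_on ?S (\<lambda>\<omega> :: nat \<Rightarrow> 'a. \<omega> i)" by (rule continuous_on_subset) simp
    then show "continuous_on ?S (\<lambda>\<omega>. f (\<omega> i))" by (rule continuous_on_compose2[OF f]) auto
  qed (use assms in auto)
  have "empirical \<Sigma> N -` B \<inter> topspace (top_of_set ?S) = ?S \<inter> (\<lambda>\<omega>. (\<Sum>i<N. f (\<omega> i)) / real N) -` U"
    using emp integral_empirical[OF _ fm, of N] by (auto simp: B)
  then show "openin (top_of_set ?S) (empirical \<Sigma> N -` B \<inter> topspace (top_of_set ?S))"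
    using continuous_openin_preimage_gen[OF c U] by simp
next
  have "empirical \<Sigma> N ` {\<omega>. \<forall>i. \<omega> i \<in> \<Sigma>} \<subseteq> topspace (weak_topology \<Sigma>)"
    using assms by (auto intro!: empirical_borel_probs)
  then show "empirical \<Sigma> N ` topspace (top_of_set {\<omega>. \<forall>i. \<omega> i \<in> \<Sigma>}) \<subseteq>
    \<Union> {{P \<in> borel_probs \<Sigma>. (\<integral>\<xi>. f \<xi> \<partial>P) \<in> U} | (f :: 'a \<Rightarrow> real) U.
        continuous_on \<Sigma> f \<and> bounded (f ` \<Sigma>) \<and> open U}"
    unfolding weak_topology_def topology_generated_by_topspace by simp
qed

text \<open>Continuity, rather than measurability of the preimages of generating sets, covers
  uncountable unions of such sets. Second countability then identifies the Borel sets of the product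
  topology with the product sigma-algebra.\<close>

lemma sets_empirical_openin:
  fixes \<Sigma> :: "'a::second_countable_topology set"
  assumes P: "P \<in> borel_probs \<Sigma>" and U: "openin (weak_topology \<Sigma>) U" and "N > 0"
  shows "{\<omega> \<in> space (PiM UNIV (\<lambda>_::nat. P)). empirical \<Sigma> N \<omega> \<in> U} \<in> sets (PiM UNIV (\<lambda>_::nat. P))"
proof -
  note [measurable_cong] = borel_probsD(2)[OF P]
  have sp: "space (PiM UNIV (\<lambda>_::nat. P)) = {\<omega>. \<forall>i. \<omega> i \<in> \<Sigma>}"
    using borel_probsD(3)[OF P] by (auto simp: space_PiM)
  have "openin (top_of_set {\<omega>. \<forall>i. \<omega> i \<in> \<Sigma>}) {\<omega> \<in> {\<omega>. \<forall>i. \<omega> i \<in> \<Sigma>}. empirical \<Sigma> N \<omega> \<in> U}"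
    using continuous_map_empirical[OF \<open>N > 0\<close>, of \<Sigma>] U by (auto simp: continuous_map_def)
  then obtain V where V: "open V" "{\<omega> \<in> {\<omega>. \<forall>i. \<omega> i \<in> \<Sigma>}. empirical \<Sigma> N \<omega> \<in> U} = {\<omega>. \<forall>i. \<omega> i \<in> \<Sigma>} \<inter> V"
    by (auto simp: openin_open)
  have "V \<in> sets (borel :: (nat \<Rightarrow> 'a) measure)" using V(1) by simp
  then have Vs: "V \<in> sets (PiM UNIV (\<lambda>_::nat. borel :: 'a measure))" using sets_PiM_equal_borel by metis
  have id: "(\<lambda>\<omega>. \<omega>) \<in> measurable (PiM UNIV (\<lambda>_::nat. P)) (PiM UNIV (\<lambda>_::nat. borel :: 'a measure))"
  proof (rule measurable_PiM_single')
    fix i :: nat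
    have "(\<lambda>x. x) \<in> measurable P (borel :: 'a measure)"
      using measurable_restrict_space1[of "\<lambda>x. x" borel borel \<Sigma>] borel_probsD(2)[OF P] by (simp cong: measurable_cong_sets)
    then show "(\<lambda>\<omega>. \<omega> i) \<in> measurable (PiM UNIV (\<lambda>_::nat. P)) (borel :: 'a measure)"
      by (rule measurable_compose[rotated]) simp
  qed auto
  have "(\<lambda>\<omega>. \<omega>) -` V \<inter> space (PiM UNIV (\<lambda>_::nat. P)) \<in> sets (PiM UNIV (\<lambda>_::nat. P))"
    by (rule measurable_sets[OF id Vs])
  also have "(\<lambda>\<omega>. \<omega>) -` V \<inter> space (PiM UNIV (\<lambda>_::nat. P)) = {\<omega> \<in> space (PiM UNIV (\<lambda>_::nat. P)). empirical \<Sigma> N \<omega> \<in> U}"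
    using V(2) unfolding sp by blast
  finally show ?thesis .
qed

text \<open>Induction over the generation of open sets: the weak law for a generating set, the bound
  P(A) + P(B) - 1 for the probability of an intersection, and a single member containing
  \<open>Q\<close> for a union.\<close>

lemma empirical_weak_law:
  fixes \<Sigma> :: "'a::second_countable_topology set"
  assumes Q: "Q \<in> borel_probs \<Sigma>" and "openin (weak_topology \<Sigma>) U" "Q \<in> U"
  shows "(\<lambda>N. measure (PiM UNIV (\<lambda>_::nat. Q)) {\<omega> \<in> space (PiM UNIV (\<lambda>_::nat. Q)). empirical \<Sigma> N \<omega> \<in> U}) \<longlonglongrightarrow> 1"
proof -
  let ?m = "measure (PiM UNIV (\<lambda>_::nat. Q))"
  let ?E = "\<lambda>U N. {\<omega> \<in> space (PiM UNIV (\<lambda>_::nat. Q)). empirical \<Sigma> N \<omega> \<in> U}"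
  interpret prob_space Q using borel_probsD[OF Q] by simp
  interpret product_prob_space "\<lambda>_::nat. Q" UNIV by unfold_locales
  let ?B = "{{P \<in> borel_probs \<Sigma>. (\<integral>\<xi>. f \<xi> \<partial>P) \<in> U} | (f :: 'a \<Rightarrow> real) U.
        continuous_on \<Sigma> f \<and> bounded (f ` \<Sigma>) \<and> open U}"
  have op: "openin (weak_topology \<Sigma>) U" if "generate_topology_on ?B U" for U
    using that by (simp add: weak_topology_def openin_topology_generated_by_iff)
  have "generate_topology_on ?B U" using assms(2) by (simp add: weak_topology_def openin_topology_generated_by_iff)
  then show ?thesis using \<open>Q \<in> U\<close>
  proof induction
    case Empty
    then show ?case by simp
  next
    case (Int a b)
    have "(\<lambda>N. ?m (?E a N) + ?m (?E b N) - 1) \<longlonglongrightarrow> 1 + 1 - 1"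
      using Int by (intro tendsto_intros) auto
    then have l: "(\<lambda>N. ?m (?E a N) + ?m (?E b N) - 1) \<longlonglongrightarrow> 1" by simp
    show ?case
    proof (rule tendsto_sandwich[OF _ _ l tendsto_const])
      show "\<forall>\<^sub>F N in sequentially. ?m (?E a N) + ?m (?E b N) - 1 \<le> ?m (?E (a \<inter> b) N)"
        using eventually_gt_at_top[of 0]
      proof eventually_elim
        case (elim N)
        have s: "?E a N \<in> P.events" "?E b N \<in> P.events"
          using sets_empirical_openin[OF Q op elim] Int.hyps by auto
        have eq: "?E b N \<inter> ?E a N = ?E (a \<inter> b) N" by auto
        have "?m (?E a N \<union> ?E b N) = ?m (?E a N) + (?m (?E b N) - ?m (?E b N \<inter> ?E a N))"
          unfolding P.finite_measure_Union'[OF s] P.finite_measure_Diff'[OF s(2,1)] ..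
        moreover have "?m (?E a N \<union> ?E b N) \<le> 1" by (rule P.prob_le_1)
        ultimately show ?case unfolding eq by linarith
      qed
    qed auto
  next
    case (UN K)
    then obtain k where k: "k \<in> K" "Q \<in> k" by auto
    then have l: "(\<lambda>N. ?m (?E k N)) \<longlonglongrightarrow> 1" using UN.IH by blast
    show ?case
    proof (rule tendsto_sandwich[OF _ _ l tendsto_const])
      show "\<forall>\<^sub>F N in sequentially. ?m (?E k N) \<le> ?m (?E (\<Union>K) N)"
        using eventually_gt_at_top[of 0]
      proof eventually_elim
        case (elim N)
        have "openin (weak_topology \<Sigma>) (\<Union>K)" using op UN.hyps by (intro openin_Union) blast
        from sets_empirical_openin[OF Q this elim]
        show ?case by (rule P.finite_measure_mono[rotated]) (use k(1) in blast)
      qed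
    qed auto
  next
    case (Basis s)
    then obtain f :: "'a \<Rightarrow> real" and U where s: "s = {P \<in> borel_probs \<Sigma>. (\<integral>\<xi>. f \<xi> \<partial>P) \<in> U}"
      and f: "continuous_on \<Sigma> f" "bounded (f ` \<Sigma>)" and U: "open U" by blast
    have fm: "f \<in> borel_measurable (restrict_space borel \<Sigma>)" by (rule borel_measurable_continuous_on_restrict[OF f(1)])
    obtain B where B: "\<And>x. x \<in> \<Sigma> \<Longrightarrow> \<bar>f x\<bar> \<le> B" using f(2) by (auto simp: bounded_iff)
    have fQ[measurable]: "f \<in> borel_measurable Q" using fm borel_probsD(2)[OF Q] by (simp cong: measurable_cong_sets)
    have "(\<integral>\<xi>. f \<xi> \<partial>Q) \<in> U" using Basis s by simp
    then obtain \<delta> where \<delta>: "\<delta> > 0" "ball (\<integral>\<xi>. f \<xi> \<partial>Q) \<delta> \<subseteq> U" using U by (auto simp: open_contains_ball)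
    let ?C = "\<lambda>N. {\<omega> \<in> space (PiM UNIV (\<lambda>_::nat. Q)). \<delta> \<le> \<bar>(\<Sum>i<N. f (\<omega> i)) / real N - (\<integral>x. f x \<partial>Q)\<bar>}"
    have "(\<lambda>N. ?m (?C N)) \<longlonglongrightarrow> 0"
      by (rule weak_law_bounded[OF borel_probsD(1)[OF Q] fQ _ \<delta>(1)]) (use B borel_probsD(3)[OF Q] in auto)
    then have "(\<lambda>N. 1 - ?m (?C N)) \<longlonglongrightarrow> 1 - 0" by (intro tendsto_intros)
    then have l: "(\<lambda>N. 1 - ?m (?C N)) \<longlonglongrightarrow> 1" by simp
    show ?case
    proof (rule tendsto_sandwich[OF _ _ l tendsto_const])
      show "\<forall>\<^sub>F N in sequentially. 1 - ?m (?C N) \<le> ?m (?E s N)"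
        using eventually_gt_at_top[of 0]
      proof eventually_elim
        case (elim N)
        have "openin (weak_topology \<Sigma>) s" using op[OF generate_topology_on.Basis[OF Basis(1)]] .
        from sets_empirical_openin[OF Q this elim] have sE: "?E s N \<in> P.events" .
        have sC: "?C N \<in> P.events" by measurable
        have "space (PiM UNIV (\<lambda>_::nat. Q)) - ?C N \<subseteq> ?E s N"
        proof
          fix \<omega> assume "\<omega> \<in> space (PiM UNIV (\<lambda>_::nat. Q)) - ?C N"
          then have \<omega>: "\<omega> \<in> space (PiM UNIV (\<lambda>_::nat. Q))" "\<bar>(\<Sum>i<N. f (\<omega> i)) / real N - (\<integral>x. f x \<partial>Q)\<bar> < \<delta>" by auto
          then have in\<Sigma>: "\<omega> i \<in> \<Sigma>" for i using borel_probsD(3)[OF Q] by (auto simp: space_PiM)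
          have "(\<Sum>i<N. f (\<omega> i)) / real N \<in> U" using \<omega>(2) \<delta>(2) by (auto simp: dist_real_def abs_minus_commute)
          with \<omega>(1) in\<Sigma> elim show "\<omega> \<in> ?E s N"
            by (simp add: s integral_empirical[OF _ fm] empirical_borel_probs)
        qed
        then have "?m (space (PiM UNIV (\<lambda>_::nat. Q)) - ?C N) \<le> ?m (?E s N)" using sE by (rule P.finite_measure_mono)
        then show ?case using P.prob_compl[OF sC] by simp
      qed
    qed auto
  qed
qed

subsection \<open>Decay rates\<close>

text \<open>Measurability is asked of the larger events because \<open>measure\<close> is 0 on sets
  outside the sigma-algebra.\<close>

lemma decay_rate_mono:
  assumes "prob_space P" "\<And>N. N > 0 \<Longrightarrow> E N \<subseteq> F N"
    and "\<And>N. N > 0 \<Longrightarrow> F N \<in> sets (PiM UNIV (\<lambda>_::nat. P))"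
  shows "decay_rate P E \<le> decay_rate P F"
  unfolding decay_rate_def
proof (rule Limsup_mono)
  interpret prob_space P by fact
  interpret product_prob_space "\<lambda>_::nat. P" UNIV by unfold_locales
  show "\<forall>\<^sub>F N in sequentially. ereal (1 / real N) * log_prob (measure (PiM UNIV (\<lambda>_::nat. P)) (E N))
    \<le> ereal (1 / real N) * log_prob (measure (PiM UNIV (\<lambda>_::nat. P)) (F N))"
    using eventually_gt_at_top[of 0]
  proof eventually_elim
    case (elim N)
    let ?e = "measure (PiM UNIV (\<lambda>_::nat. P)) (E N)" and ?f = "measure (PiM UNIV (\<lambda>_::nat. P)) (F N)"
    have "?e \<le> ?f" using assms(2,3)[OF elim] by (rule P.finite_measure_mono)
    have "log_prob ?e \<le> log_prob ?f"
    proof (cases "?e = 0")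
      case False
      then have "?e > 0" using measure_nonneg[of "PiM UNIV (\<lambda>_::nat. P)" "E N"] by linarith
      with \<open>?e \<le> ?f\<close> show ?thesis by (simp add: log_prob_def)
    qed (simp add: log_prob_def)
    then show ?case by (intro ereal_mult_left_mono) auto
  qed
qed

lemma decay_rate_cong:
  assumes "\<And>N. N > 0 \<Longrightarrow> E N = F N"
  shows "decay_rate P E = decay_rate P F"
  unfolding decay_rate_def
proof (rule Limsup_eq)
  show "\<forall>\<^sub>F N in sequentially. ereal (1 / real N) * log_prob (measure (PiM UNIV (\<lambda>_::nat. P)) (E N))
    = ereal (1 / real N) * log_prob (measure (PiM UNIV (\<lambda>_::nat. P)) (F N))"
    using eventually_gt_at_top[of 0] by eventually_elim (simp add: assms)
qed

lemma decay_rate_le_of_exp_bound: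
  assumes "\<And>N. N > 0 \<Longrightarrow> measure (PiM UNIV (\<lambda>_::nat. P)) (E N) \<le> exp (- (real N * r))"
  shows "decay_rate P E \<le> ereal (- r)"
  unfolding decay_rate_def
proof (rule Limsup_bounded)
  show "\<forall>\<^sub>F N in sequentially. ereal (1 / real N) * log_prob (measure (PiM UNIV (\<lambda>_::nat. P)) (E N)) \<le> ereal (- r)"
    using eventually_gt_at_top[of 0]
  proof eventually_elim
    case (elim N)
    let ?p = "measure (PiM UNIV (\<lambda>_::nat. P)) (E N)"
    show ?case
    proof (cases "?p = 0")
      case True
      then show ?thesis using elim by (simp add: log_prob_def)
    next
      case False
      then have "?p > 0" using measure_nonneg[of "PiM UNIV (\<lambda>_::nat. P)" "E N"] by linarith
      then have "ln ?p \<le> - (real N * r)" using assms[OF elim] ln_le_cancel_iff[of ?p "exp (- (real N * r))"] by simp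
      then have "1 / real N * ln ?p \<le> 1 / real N * (- (real N * r))" by (intro mult_left_mono) auto
      then show ?thesis using False elim by (simp add: log_prob_def)
    qed
  qed
qed

lemma openin_predictor_less:
  assumes "c \<in> usc_predictors X \<Sigma>" "x \<in> X"
  shows "openin (weak_topology \<Sigma>) {Q \<in> borel_probs \<Sigma>. c x Q < a}"
  using assms by (auto simp: usc_predictors_def usc_map_def)

lemma space_PiM_borel_probs:
  assumes "P \<in> borel_probs \<Sigma>" "\<omega> \<in> space (PiM UNIV (\<lambda>_::nat. P))"
  shows "\<omega> i \<in> \<Sigma>"
  using assms(2) borel_probsD(3)[OF assms(1)] by (auto simp: space_PiM)

lemma uniformly_feasible_imp_pointwise_feasible:
  fixes \<Sigma> :: "'a::second_countable_topology set"
  assumes c: "c \<in> usc_predictors X \<Sigma>" and u: "uniformly_feasible X \<Sigma> loss r c"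
  shows "pointwise_feasible X \<Sigma> loss r c"
  unfolding pointwise_feasible_def
proof (rule SUP_least, clarify)
  fix P x assume P: "P \<in> borel_probs \<Sigma>" and x: "x \<in> X"
  let ?F = "\<lambda>N. {\<omega> \<in> space (PiM UNIV (\<lambda>_::nat. P)). \<exists>x\<in>X. expected_loss loss x P > c x (empirical \<Sigma> N \<omega>)}"
  have "decay_rate P (\<lambda>N. {\<omega> \<in> space (PiM UNIV (\<lambda>_::nat. P)). expected_loss loss x P > c x (empirical \<Sigma> N \<omega>)})
      \<le> decay_rate P ?F"
  proof (rule decay_rate_mono)
    fix N :: nat assume "N > 0"
    \<comment> \<open>\<open>X\<close> may be uncountable. The union over the decisions gives a
      measurable event because it is an open condition on the empirical distribution.\<close>
    let ?U = "\<Union>x\<in>X. {Q \<in> borel_probs \<Sigma>. c x Q < expected_loss loss x P}"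
    have "openin (weak_topology \<Sigma>) ?U" by (intro openin_Union) (auto intro: openin_predictor_less[OF c])
    from sets_empirical_openin[OF P this \<open>N > 0\<close>]
    have "{\<omega> \<in> space (PiM UNIV (\<lambda>_::nat. P)). empirical \<Sigma> N \<omega> \<in> ?U} \<in> sets (PiM UNIV (\<lambda>_::nat. P))" .
    also have "{\<omega> \<in> space (PiM UNIV (\<lambda>_::nat. P)). empirical \<Sigma> N \<omega> \<in> ?U} = ?F N"
      using empirical_borel_probs[OF \<open>N > 0\<close>] space_PiM_borel_probs[OF P] by auto
    finally show "?F N \<in> sets (PiM UNIV (\<lambda>_::nat. P))" .
  qed (use borel_probsD(1)[OF P] x in auto)
  also have "\<dots> \<le> ereal (- r)"
    using u P unfolding uniformly_feasible_def by (auto simp: SUP_le_iff)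
  finally show "decay_rate P (\<lambda>N. {\<omega> \<in> space (PiM UNIV (\<lambda>_::nat. P)).
      expected_loss loss x P > c x (empirical \<Sigma> N \<omega>)}) \<le> ereal (- r)" .
qed

section \<open>Lower bound on feasible predictors, and feasibility of the dual expressions\<close>

context usc_loss begin

text \<open>Mixing a bit of \<open>Q\<close> into \<open>P\<close> makes the divergence strictly smaller than \<open>r\<close>, so that the event
  that the empirical distribution is near \<open>Q\<close> decays too slowly.\<close>

lemma worst_case_le_of_decay:
  assumes Q: "Q \<in> borel_probs \<Sigma>" and "r > 0"
    and op: "\<And>a. openin (weak_topology \<Sigma>) {Q \<in> borel_probs \<Sigma>. C Q < a}"
    and feas: "\<And>P. P \<in> borel_probs \<Sigma> \<Longrightarrow> decay_rate P (\<lambda>N. {\<omega> \<in> space (PiM UNIV (\<lambda>_::nat. P)).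
        (\<integral>\<xi>. l \<xi> \<partial>P) > C (empirical \<Sigma> N \<omega>)}) \<le> ereal (- r)"
  shows "worst_case D_KL r Q \<le> C Q"
proof (rule worst_case_le[where D=D_KL, OF Q])
  show "D_KL Q Q \<le> ereal r"
    using order_trans[OF D_KL_self[OF borel_probsD(1)[OF Q]], of "ereal r"] \<open>r > 0\<close> by simp
  fix P assume P: "P \<in> borel_probs \<Sigma>" "D_KL Q P \<le> ereal r"
  show "(\<integral>\<xi>. l \<xi> \<partial>P) \<le> C Q"
  proof (rule ccontr)
    assume "\<not> (\<integral>\<xi>. l \<xi> \<partial>P) \<le> C Q"
    then have less: "C Q < (\<integral>\<xi>. l \<xi> \<partial>P)" by simp
    \<comment> \<open>\<open>?h t\<close> is the expected loss under the mixture with weight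
      \<open>t\<close> on \<open>Q\<close>; a small \<open>t\<close> keeps it above
      \<open>C Q\<close>.\<close>
    let ?h = "\<lambda>t. t * (\<integral>\<xi>. l \<xi> \<partial>Q) + (1 - t) * (\<integral>\<xi>. l \<xi> \<partial>P)"
    have "(?h \<longlongrightarrow> ?h 0) (at_right 0)" by (intro tendsto_intros)
    then have "\<forall>\<^sub>F t in at_right 0. C Q < ?h t" using less by (intro order_tendstoD) auto
    moreover have "\<forall>\<^sub>F t in at_right (0::real). 0 < t" by (rule eventually_at_right_less)
    moreover have "\<forall>\<^sub>F t in at_right (0::real). t < 1"
      by (rule order_tendstoD(2)[OF tendsto_ident_at]) simp
    ultimately have "\<forall>\<^sub>F t in at_right 0. C Q < ?h t \<and> 0 < t \<and> t < 1" by eventually_elim simp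
    then have "\<exists>t. C Q < ?h t \<and> 0 < t \<and> t < 1"
      by (rule eventually_happens'[rotated]) simp
    then obtain t where t: "C Q < ?h t" "0 < t" "t < 1" by blast
    have t': "0 \<le> t" "t \<le> 1" using t by auto
    note sQ = borel_probsD(2)[OF Q] and sP = borel_probsD(2)[OF P(1)]
    note mix = t' borel_probsD(1)[OF Q] sQ borel_probsD(1)[OF P(1)] sP
    define R where "R = mixture t Q P"
    have sR: "sets R = sets (restrict_space borel \<Sigma>)" unfolding R_def by (rule sets_mixture[OF mix])
    have pR: "prob_space R" unfolding R_def by (rule prob_space_mixture[OF mix])
    have R: "R \<in> borel_probs \<Sigma>" using sR pR by (simp add: borel_probs_def)
    have lR: "(\<integral>\<xi>. l \<xi> \<partial>R) = ?h t"
      unfolding R_def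
    proof (rule integral_mixture[OF mix l_meas])
      show "\<bar>l \<xi>\<bar> \<le> \<bar>b\<bar> + \<bar>M\<bar>" if "\<xi> \<in> space (restrict_space borel \<Sigma>)" for \<xi>
        using lb[of \<xi>] ub[of \<xi>] that by (auto simp: space_restrict_space)
    qed
    have "D_KL Q R \<le> ereal ((1 - t) * r)"
      unfolding R_def by (rule D_KL_mixture_le) (use borel_probsD(1)[OF Q] borel_probsD(1)[OF P(1)] sQ sP P t in auto)
    \<comment> \<open>The rate (1 - t / 2) r lies strictly between the divergence bound and r: the
      lower bound on the decay needs room above the divergence, the contradiction needs room below
      r.\<close>
    also have "(1 - t) * r < (1 - t / 2) * r" using t \<open>r > 0\<close> by (intro mult_strict_right_mono) auto
    finally have D: "D_KL Q R < ereal ((1 - t / 2) * r)" by simp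
    define U where "U = {Q' \<in> borel_probs \<Sigma>. C Q' < (\<integral>\<xi>. l \<xi> \<partial>R)}"
    have U: "openin (weak_topology \<Sigma>) U" unfolding U_def by (rule op)
    have QU: "Q \<in> U" using Q t(1) lR by (simp add: U_def)
    let ?E = "\<lambda>N. {\<omega> \<in> space (PiM UNIV (\<lambda>_::nat. R)). empirical \<Sigma> N \<omega> \<in> U}"
    have sp: "space (PiM UNIV (\<lambda>_::nat. Q)) = space (PiM UNIV (\<lambda>_::nat. R))"
      using borel_probsD(3)[OF Q] borel_probsD(3)[OF R] by (simp add: space_PiM)
    have "ereal (- ((1 - t / 2) * r)) \<le> decay_rate R ?E"
    proof (rule decay_rate_ge_of_D_KL_less[OF pR borel_probsD(1)[OF Q] _ D])
      show "sets Q = sets R" using sQ sR by simp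
      show "?E N \<in> sets (PiM UNIV (\<lambda>_::nat. R))" if "N > 0" for N by (rule sets_empirical_openin[OF R U that])
      show "(\<lambda>N. measure (PiM UNIV (\<lambda>_::nat. Q)) (?E N)) \<longlonglongrightarrow> 1"
        using empirical_weak_law[OF Q U QU] unfolding sp .
      fix N \<omega> \<omega>' assume \<omega>: "\<omega> \<in> ?E N" "\<omega>' \<in> space (PiM UNIV (\<lambda>_::nat. R))" "\<And>i. i < N \<Longrightarrow> \<omega> i = \<omega>' i"
      then show "\<omega>' \<in> ?E N" using empirical_cong[of N \<omega> \<omega>' \<Sigma>] by simp
    qed
    also have "\<dots> = decay_rate R (\<lambda>N. {\<omega> \<in> space (PiM UNIV (\<lambda>_::nat. R)). (\<integral>\<xi>. l \<xi> \<partial>R) > C (empirical \<Sigma> N \<omega>)})"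
    proof (rule decay_rate_cong)
      fix N :: nat assume "N > 0"
      then show "?E N = {\<omega> \<in> space (PiM UNIV (\<lambda>_::nat. R)). (\<integral>\<xi>. l \<xi> \<partial>R) > C (empirical \<Sigma> N \<omega>)}"
        using empirical_borel_probs[of N _ \<Sigma>] space_PiM_borel_probs[OF R] by (auto simp: U_def)
    qed
    also have "\<dots> \<le> ereal (- r)" by (rule feas[OF R])
    finally have "r \<le> (1 - t / 2) * r" by simp
    moreover have "(1 - t / 2) * r < 1 * r" using t \<open>r > 0\<close> by (intro mult_strict_right_mono) auto
    ultimately show False by linarith
  qed
qed

text \<open>The expectation of \<open>\<Prod>i<N. (\<alpha> - l (\<xi> i)) / (\<alpha> - \<integral>l dP)\<close> is 1, so Markov's inequality applies.\<close>

lemma decay_rate_dual_le: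
  assumes P: "P \<in> borel_probs \<Sigma>" and \<alpha>: "\<alpha> > M"
  shows "decay_rate P (\<lambda>N. {\<omega> \<in> space (PiM UNIV (\<lambda>_::nat. P)).
        (\<integral>\<xi>. l \<xi> \<partial>P) > dual r (empirical \<Sigma> N \<omega>) \<alpha>}) \<le> ereal (- r)"
proof (rule decay_rate_le_of_exp_bound)
  fix N :: nat assume N: "N > 0"
  interpret P: prob_space P using borel_probsD[OF P] by simp
  interpret PP: product_prob_space "\<lambda>_::nat. P" UNIV by unfold_locales
  have spP: "space P = \<Sigma>" using borel_probsD(3)[OF P] .
  have lm[measurable]: "l \<in> borel_measurable P" using integrable_l[OF P] by auto
  define G where "G = \<alpha> - (\<integral>\<xi>. l \<xi> \<partial>P)"
  have G: "G > 0" using integral_l_le[OF P] \<alpha> by (simp add: G_def)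
  define g where "g \<xi> = (\<alpha> - l \<xi>) / G" for \<xi>
  have [measurable]: "g \<in> borel_measurable P" unfolding g_def by measurable
  have gi: "integrable P g" unfolding g_def using integrable_l[OF P] by auto
  have g1: "(\<integral>\<xi>. g \<xi> \<partial>P) = 1"
    unfolding g_def using integrable_l[OF P] G by (simp add: P.prob_space G_def)
  have gpos: "g \<xi> > 0" if "\<xi> \<in> \<Sigma>" for \<xi> using ub[OF that] \<alpha> G by (simp add: g_def)
  let ?S = "PiM UNIV (\<lambda>_::nat. P)"
  let ?Z = "\<lambda>\<omega>. \<Prod>i<N. g (\<omega> i)"
  have ind: "PP.P.indep_vars (\<lambda>_. borel) (\<lambda>i \<omega>. g (\<omega> i)) {..<N}"
    by (rule indep_vars_PiM_coordinates[OF P.prob_space_axioms]) measurable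
  have ci: "integrable ?S (\<lambda>\<omega>. g (\<omega> i))" for i by (rule integrable_PiM_coordinate[OF P.prob_space_axioms gi])
  have Zi: "integrable ?S ?Z" using ind ci by (intro PP.P.indep_vars_integrable) auto
  have "(\<integral>\<omega>. ?Z \<omega> \<partial>?S) = (\<Prod>i<N. \<integral>\<omega>. g (\<omega> i) \<partial>?S)" using ind ci by (intro PP.P.indep_vars_lebesgue_integral) auto
  also have "\<dots> = 1" by (simp add: integral_PiM_coordinate[OF P.prob_space_axioms gi] g1)
  finally have Z1: "(\<integral>\<omega>. ?Z \<omega> \<partial>?S) = 1" .
  \<comment> \<open>The event says ln G + r < \<open>mean_ln\<close>, and N times this inequality
    bounds the product of the ratios below by exp (N r). The resulting estimate holds for every N >
    0, not only asymptotically.\<close>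
  have sub: "{\<omega> \<in> space ?S. (\<integral>\<xi>. l \<xi> \<partial>P) > dual r (empirical \<Sigma> N \<omega>) \<alpha>} \<subseteq> {\<omega> \<in> space ?S. exp (real N * r) \<le> ?Z \<omega>}"
  proof clarify
    fix \<omega> assume \<omega>: "\<omega> \<in> space ?S" "dual r (empirical \<Sigma> N \<omega>) \<alpha> < (\<integral>\<xi>. l \<xi> \<partial>P)"
    have in\<Sigma>: "\<omega> i \<in> \<Sigma>" for i by (rule space_PiM_borel_probs[OF P \<omega>(1)])
    have "G < exp (mean_ln (empirical \<Sigma> N \<omega>) \<alpha> - r)" using \<omega>(2) by (simp add: dual_def G_def)
    then have "ln G < mean_ln (empirical \<Sigma> N \<omega>) \<alpha> - r" using G ln_less_cancel_iff[of G "exp (mean_ln (empirical \<Sigma> N \<omega>) \<alpha> - r)"] by simp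
    also have "mean_ln (empirical \<Sigma> N \<omega>) \<alpha> = (\<Sum>i<N. ln (\<alpha> - l (\<omega> i))) / real N"
      unfolding mean_ln_def by (rule integral_empirical[OF in\<Sigma> ln_meas])
    finally have "ln G + r \<le> (\<Sum>i<N. ln (\<alpha> - l (\<omega> i))) / real N" by simp
    then have "real N * r \<le> (\<Sum>i<N. ln (\<alpha> - l (\<omega> i))) - real N * ln G" using N by (simp add: field_simps)
    also have "\<dots> = (\<Sum>i<N. ln (g (\<omega> i)))"
    proof -
      have "ln (g (\<omega> i)) = ln (\<alpha> - l (\<omega> i)) - ln G" for i
        using ub[OF in\<Sigma>[of i]] \<alpha> G by (simp add: g_def ln_div)
      then show ?thesis by (simp add: sum_subtractf)
    qed
    also have "\<dots> = ln (?Z \<omega>)"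
    proof (rule ln_prod[symmetric])
      show "g (\<omega> i) \<noteq> 0" for i using gpos[OF in\<Sigma>[of i]] by simp
    qed simp
    finally have "exp (real N * r) \<le> exp (ln (?Z \<omega>))" by simp
    moreover have "?Z \<omega> > 0" using gpos[OF in\<Sigma>] by (intro prod_pos) auto
    ultimately show "exp (real N * r) \<le> ?Z \<omega>" by simp
  qed
  have "measure ?S {\<omega> \<in> space ?S. (\<integral>\<xi>. l \<xi> \<partial>P) > dual r (empirical \<Sigma> N \<omega>) \<alpha>}
      \<le> measure ?S {\<omega> \<in> space ?S. exp (real N * r) \<le> ?Z \<omega>}"
    by (rule PP.P.finite_measure_mono[OF sub]) measurable
  also have "\<dots> \<le> (\<integral>\<omega>. ?Z \<omega> \<partial>?S) / exp (real N * r)"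
  proof (rule integral_Markov_inequality_measure[OF Zi, where A="{}"])
    show "AE \<omega> in ?S. 0 \<le> ?Z \<omega>"
      using gpos space_PiM_borel_probs[OF P] by (intro AE_I2 prod_nonneg) (auto simp: less_imp_le)
  qed auto
  also have "\<dots> = exp (- (real N * r))" unfolding Z1 by (simp add: exp_minus field_simps)
  finally show "measure ?S {\<omega> \<in> space ?S. (\<integral>\<xi>. l \<xi> \<partial>P) > dual r (empirical \<Sigma> N \<omega>) \<alpha>} \<le> exp (- (real N * r))" .
qed

end

section \<open>From a single loss to predictors\<close>

lemma usc_lossI:
  fixes \<Sigma> :: "'a::euclidean_space set"
  assumes "compact \<Sigma>" "\<Sigma> \<noteq> {}" "usc_map (top_of_set \<Sigma>) l" "\<forall>\<xi>\<in>\<Sigma>. b \<le> l \<xi>"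
  obtains M \<xi>\<^sub>0 where "usc_loss \<Sigma> l b M \<xi>\<^sub>0"
proof -
  obtain \<xi>\<^sub>0 where "\<xi>\<^sub>0 \<in> \<Sigma>" "\<And>\<xi>. \<xi> \<in> \<Sigma> \<Longrightarrow> l \<xi> \<le> l \<xi>\<^sub>0" using usc_map_attains_sup[OF assms(1-3)] by blast
  then have "usc_loss \<Sigma> l b (l \<xi>\<^sub>0) \<xi>\<^sub>0" using assms by unfold_locales auto
  then show ?thesis by (rule that)
qed

lemma dro_predictor_eq_worst_case:
  assumes "usc_loss \<Sigma> (loss x) b M \<xi>\<^sub>0"
  shows "dro_predictor \<Sigma> loss D r x Q = usc_loss.worst_case \<Sigma> (loss x) D r Q"
  by (simp add: dro_predictor_def expected_loss_def usc_loss.worst_case_def[OF assms])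

text \<open>Predictors are total functions, while a least conservative one is determined only on X
  \<times> \<open>borel_probs \<Sigma>\<close>. Its properties pass to \<open>c_KL\<close> through
  such congruences.\<close>

lemma usc_predictors_cong:
  assumes "\<And>x Q. x \<in> X \<Longrightarrow> Q \<in> borel_probs \<Sigma> \<Longrightarrow> c x Q = c' x Q"
  shows "c \<in> usc_predictors X \<Sigma> \<longleftrightarrow> c' \<in> usc_predictors X \<Sigma>"
proof -
  have "{Q \<in> borel_probs \<Sigma>. c x Q < a} = {Q \<in> borel_probs \<Sigma>. c' x Q < a}" if "x \<in> X" for x a
    using assms[OF that] by auto
  then show ?thesis by (simp add: usc_predictors_def usc_map_def)
qed

lemma
  assumes eq: "\<And>x Q. x \<in> X \<Longrightarrow> Q \<in> borel_probs \<Sigma> \<Longrightarrow> c x Q = c' x Q"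
  shows pointwise_feasible_cong: "pointwise_feasible X \<Sigma> loss r c \<longleftrightarrow> pointwise_feasible X \<Sigma> loss r c'"
    and uniformly_feasible_cong: "uniformly_feasible X \<Sigma> loss r c \<longleftrightarrow> uniformly_feasible X \<Sigma> loss r c'"
proof -
  have emp: "c x (empirical \<Sigma> N \<omega>) = c' x (empirical \<Sigma> N \<omega>)"
    if "N > 0" "P \<in> borel_probs \<Sigma>" "x \<in> X" "\<omega> \<in> space (PiM UNIV (\<lambda>_::nat. P))" for N P x \<omega>
    by (intro eq that(3) empirical_borel_probs that(1) space_PiM_borel_probs[OF that(2,4)])
  have "decay_rate P (\<lambda>N. {\<omega> \<in> space (PiM UNIV (\<lambda>_::nat. P)). expected_loss loss x P > c x (empirical \<Sigma> N \<omega>)})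
      = decay_rate P (\<lambda>N. {\<omega> \<in> space (PiM UNIV (\<lambda>_::nat. P)). expected_loss loss x P > c' x (empirical \<Sigma> N \<omega>)})"
    if "P \<in> borel_probs \<Sigma>" "x \<in> X" for P x
  proof (rule decay_rate_cong, rule Collect_cong, rule conj_cong[OF refl])
    fix N :: nat and \<omega> assume "N > 0" "\<omega> \<in> space (PiM UNIV (\<lambda>_::nat. P))"
    then show "(expected_loss loss x P > c x (empirical \<Sigma> N \<omega>)) = (expected_loss loss x P > c' x (empirical \<Sigma> N \<omega>))"
      using emp[OF _ that] by simp
  qed
  then show "pointwise_feasible X \<Sigma> loss r c \<longleftrightarrow> pointwise_feasible X \<Sigma> loss r c'"
    unfolding pointwise_feasible_def by (intro arg_cong[where f="\<lambda>z. z \<le> _"] SUP_cong refl) auto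
  have "decay_rate P (\<lambda>N. {\<omega> \<in> space (PiM UNIV (\<lambda>_::nat. P)). \<exists>x\<in>X. expected_loss loss x P > c x (empirical \<Sigma> N \<omega>)})
      = decay_rate P (\<lambda>N. {\<omega> \<in> space (PiM UNIV (\<lambda>_::nat. P)). \<exists>x\<in>X. expected_loss loss x P > c' x (empirical \<Sigma> N \<omega>)})"
    if "P \<in> borel_probs \<Sigma>" for P
  proof (rule decay_rate_cong, rule Collect_cong, rule conj_cong[OF refl], rule bex_cong[OF refl])
    fix N :: nat and \<omega> x assume "N > 0" "\<omega> \<in> space (PiM UNIV (\<lambda>_::nat. P))" "x \<in> X"
    then show "(expected_loss loss x P > c x (empirical \<Sigma> N \<omega>)) = (expected_loss loss x P > c' x (empirical \<Sigma> N \<omega>))"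
      using emp[OF _ that] by simp
  qed
  then show "uniformly_feasible X \<Sigma> loss r c \<longleftrightarrow> uniformly_feasible X \<Sigma> loss r c'"
    unfolding uniformly_feasible_def by (intro arg_cong[where f="\<lambda>z. z \<le> _"] SUP_cong refl) auto
qed

subsection \<open>Least conservative predictors\<close>

text \<open>Uniform feasibility of the dual predictor is trivial once it is used at a single decision only
  and the predictor is maximally conservative at all other decisions.\<close>

lemma uniformly_feasible_single_dual:
  fixes r :: real and \<Sigma> :: "'a::euclidean_space set"
  assumes ul: "\<And>x. x \<in> X \<Longrightarrow> usc_loss \<Sigma> (loss x) b (M x) (\<xi> x)"
    and z: "z \<in> X" and \<alpha>: "\<alpha> > M z"
  defines "C \<equiv> \<lambda>x Q. if x = z then usc_loss.dual (loss z) r Q \<alpha> else M x"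
  shows "C \<in> usc_predictors X \<Sigma>" "uniformly_feasible X \<Sigma> loss r C"
proof -
  interpret L: usc_loss \<Sigma> "loss z" b "M z" "\<xi> z" by (rule ul[OF z])
  show "C \<in> usc_predictors X \<Sigma>"
    unfolding usc_predictors_def
  proof (intro CollectI ballI)
    fix x assume "x \<in> X"
    have const: "usc_map (weak_topology \<Sigma>) (\<lambda>_. m)" for m
    proof -
      have "{Q \<in> topspace (weak_topology \<Sigma>). m < a} = {} \<or>
          {Q \<in> topspace (weak_topology \<Sigma>). m < a} = topspace (weak_topology \<Sigma>)" for a
        by auto
      then show ?thesis unfolding usc_map_def by (metis openin_empty openin_topspace)
    qed
    show "usc_map (weak_topology \<Sigma>) (C x)"
      using L.usc_map_dual[OF \<alpha>, of r] const[of "M x"] by (cases "x = z") (simp_all add: C_def)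
  qed
  show "uniformly_feasible X \<Sigma> loss r C"
    unfolding uniformly_feasible_def
  proof (rule SUP_least)
    fix P assume P: "P \<in> borel_probs \<Sigma>"
    have le: "expected_loss loss x P \<le> M x" if "x \<in> X" for x
      unfolding expected_loss_def by (rule usc_loss.integral_l_le[OF ul[OF that] P])
    have "(\<exists>x\<in>X. expected_loss loss x P > C x Q) \<longleftrightarrow>
        (\<integral>\<xi>. loss z \<xi> \<partial>P) > L.dual r Q \<alpha>" for Q
    proof
      assume "\<exists>x\<in>X. expected_loss loss x P > C x Q"
      then obtain x where x: "x \<in> X" "expected_loss loss x P > C x Q" by blast
      then have "x = z" using le[OF x(1)] by (cases "x = z") (auto simp: C_def)
      then show "(\<integral>\<xi>. loss z \<xi> \<partial>P) > L.dual r Q \<alpha>" using x(2) by (simp add: C_def expected_loss_def)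
    next
      assume "(\<integral>\<xi>. loss z \<xi> \<partial>P) > L.dual r Q \<alpha>"
      then show "\<exists>x\<in>X. expected_loss loss x P > C x Q"
        using z by (intro bexI[of _ z]) (simp_all add: C_def expected_loss_def)
    qed
    then show "decay_rate P (\<lambda>N. {\<omega> \<in> space (PiM UNIV (\<lambda>_::nat. P)).
        \<exists>x\<in>X. expected_loss loss x P > C x (empirical \<Sigma> N \<omega>)}) \<le> ereal (- r)"
      using L.decay_rate_dual_le[OF P \<alpha>, of r] by simp
  qed
qed

lemma pointwise_feasible_imp_c_KL_le:
  assumes ul: "usc_loss \<Sigma> (loss x) b M \<xi>" and "r > 0" and x: "x \<in> X"
    and c: "c \<in> usc_predictors X \<Sigma>" "pointwise_feasible X \<Sigma> loss r c" and Q: "Q \<in> borel_probs \<Sigma>"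
  shows "c_KL \<Sigma> loss r x Q \<le> c x Q"
proof -
  interpret L: usc_loss \<Sigma> "loss x" b M \<xi> by fact
  have feas: "decay_rate P (\<lambda>N. {\<omega> \<in> space (PiM UNIV (\<lambda>_::nat. P)).
      (\<integral>\<xi>. loss x \<xi> \<partial>P) > c x (empirical \<Sigma> N \<omega>)}) \<le> ereal (- r)" if P: "P \<in> borel_probs \<Sigma>" for P
  proof -
    have "\<forall>p\<in>borel_probs \<Sigma> \<times> X. (case p of (P, x) \<Rightarrow> decay_rate P (\<lambda>N. {\<omega> \<in> space (PiM UNIV (\<lambda>_::nat. P)).
        expected_loss loss x P > c x (empirical \<Sigma> N \<omega>)})) \<le> ereal (- r)"
      using c(2) unfolding pointwise_feasible_def SUP_le_iff .
    from bspec[OF this, of "(P, x)"] show ?thesis using P x by (simp add: expected_loss_def)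
  qed
  have "L.worst_case D_KL r Q \<le> c x Q"
    by (rule L.worst_case_le_of_decay[OF Q \<open>r > 0\<close> openin_predictor_less[OF c(1) x] feas])
  then show ?thesis by (simp add: c_KL_def dro_predictor_eq_worst_case[where loss=loss and x=x, OF ul])
qed

text \<open>The comparison is made at the single point (z, Q), so the \<alpha> of the competing
  predictor may depend on \<open>Q\<close> and \<eta>. A uniformly feasible competitor serves both
  notions, since uniform feasibility is the stronger one.\<close>

lemma le_c_KL_of_least_conservative:
  fixes X :: "'x set" and \<Sigma> :: "'a::euclidean_space set"
  assumes ul: "\<And>x. x \<in> X \<Longrightarrow> usc_loss \<Sigma> (loss x) b (M x) (\<xi> x)"
    and feasible: "feasible \<in> {pointwise_feasible X \<Sigma> loss r, uniformly_feasible X \<Sigma> loss r}"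
    and lc: "least_conservative X \<Sigma> feasible c" and "r > 0" and z: "z \<in> X" and Q: "Q \<in> borel_probs \<Sigma>"
  shows "c z Q \<le> c_KL \<Sigma> loss r z Q"
proof (rule field_le_epsilon)
  fix \<eta> :: real assume "\<eta> > 0"
  interpret L: usc_loss \<Sigma> "loss z" b "M z" "\<xi> z" by (rule ul[OF z])
  obtain \<alpha> P where \<alpha>: "\<alpha> > M z" and P: "P \<in> borel_probs \<Sigma>" "D_KL Q P \<le> ereal r"
    "L.dual r Q \<alpha> \<le> (\<integral>\<xi>. loss z \<xi> \<partial>P) + \<eta>"
    by (rule L.strong_duality[OF Q \<open>r > 0\<close> \<open>\<eta> > 0\<close>])
  let ?C = "\<lambda>x Q. if x = z then L.dual r Q \<alpha> else M x"
  have C: "?C \<in> usc_predictors X \<Sigma>" "uniformly_feasible X \<Sigma> loss r ?C"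
    by (rule uniformly_feasible_single_dual[where loss=loss and M=M and \<xi>=\<xi> and X=X and z=z, OF ul z \<alpha>];
        assumption)+
  then have "feasible ?C" using feasible uniformly_feasible_imp_pointwise_feasible[OF C] by auto
  then have "c z Q \<le> ?C z Q" using lc C(1) z Q unfolding least_conservative_def by blast
  also have "\<dots> \<le> (\<integral>\<xi>. loss z \<xi> \<partial>P) + \<eta>" using P(3) by simp
  also have "(\<integral>\<xi>. loss z \<xi> \<partial>P) \<le> L.worst_case D_KL r Q" by (rule L.worst_case_ge[where D=D_KL, OF P(1,2)])
  finally show "c z Q \<le> c_KL \<Sigma> loss r z Q + \<eta>"
    by (simp add: c_KL_def dro_predictor_eq_worst_case[where loss=loss and x=z, OF ul[OF z]])
qed

theorem theorem5p4:
  fixes X :: "(real ^ 'm) set" and \<Sigma> :: "(real ^ 'd) set"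
    and loss :: "real ^ 'm \<Rightarrow> real ^ 'd \<Rightarrow> real" and r :: real
  assumes "X \<noteq> {}"
    and "\<exists>b. \<forall>x\<in>X. \<forall>\<xi>\<in>\<Sigma>. b \<le> loss x \<xi>"
    and "compact \<Sigma>"
    and "\<forall>x\<in>X. usc_map (top_of_set \<Sigma>) (loss x)"
    and "r > 0"
  shows "(\<forall>c\<in>usc_predictors X \<Sigma>. pointwise_feasible X \<Sigma> loss r c \<or> uniformly_feasible X \<Sigma> loss r c \<longrightarrow>
           (\<forall>x\<in>X. \<forall>Q\<in>borel_probs \<Sigma>.
             ((\<lambda>\<epsilon>. c_KL_W \<Sigma> loss \<epsilon> r x Q) \<longlongrightarrow> c_KL \<Sigma> loss r x Q) (at_right 0) \<and>
             ((\<lambda>\<epsilon>. c_KL_LP \<Sigma> loss \<epsilon> r x Q) \<longlongrightarrow> c_KL \<Sigma> loss r x Q) (at_right 0) \<and>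
             c_KL \<Sigma> loss r x Q \<le> c x Q))
       \<and> (\<forall>feasible \<in> {pointwise_feasible X \<Sigma> loss r, uniformly_feasible X \<Sigma> loss r}.
           (\<exists>c. least_conservative X \<Sigma> feasible c) \<longleftrightarrow>
           feasible (c_KL \<Sigma> loss r) \<and> least_conservative X \<Sigma> feasible (c_KL \<Sigma> loss r))"
proof -
  obtain b where b: "\<forall>x\<in>X. \<forall>\<xi>\<in>\<Sigma>. b \<le> loss x \<xi>" using assms(2) by blast
  \<comment> \<open>The measure \<open>Q\<close> witnesses that \<Sigma> is nonempty, so that the
    loss has a maximiser; for empty \<Sigma> the claims over all \<open>Q\<close> are
    vacuous.\<close>
  have ex: "\<exists>M \<xi>. usc_loss \<Sigma> (loss x) b M \<xi>" if x: "x \<in> X" and Q: "Q \<in> borel_probs \<Sigma>" for x Q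
  proof -
    interpret prob_space Q using borel_probsD(1)[OF Q] .
    have "\<Sigma> \<noteq> {}" using not_empty borel_probsD(3)[OF Q] by simp
    then show ?thesis
      using assms(4) b x by (elim usc_lossI[OF assms(3), of "loss x" b]) auto
  qed
  have pf: "pointwise_feasible X \<Sigma> loss r c"
    if "c \<in> usc_predictors X \<Sigma>" "pointwise_feasible X \<Sigma> loss r c \<or> uniformly_feasible X \<Sigma> loss r c" for c
    using that uniformly_feasible_imp_pointwise_feasible[of c X \<Sigma> loss r] by blast
  have le: "c_KL \<Sigma> loss r x Q \<le> c x Q"
    if c: "c \<in> usc_predictors X \<Sigma>" "pointwise_feasible X \<Sigma> loss r c \<or> uniformly_feasible X \<Sigma> loss r c"
      and x: "x \<in> X" and Q: "Q \<in> borel_probs \<Sigma>" for c x Q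
  proof -
    obtain M \<xi> where ul: "usc_loss \<Sigma> (loss x) b M \<xi>" using ex[OF x Q] by blast
    show ?thesis by (rule pointwise_feasible_imp_c_KL_le[where loss=loss and x=x, OF ul \<open>r > 0\<close> x c(1) pf[OF c] Q])
  qed
  have lim: "((\<lambda>\<epsilon>. c_KL_W \<Sigma> loss \<epsilon> r x Q) \<longlongrightarrow> c_KL \<Sigma> loss r x Q) (at_right 0)"
    "((\<lambda>\<epsilon>. c_KL_LP \<Sigma> loss \<epsilon> r x Q) \<longlongrightarrow> c_KL \<Sigma> loss r x Q) (at_right 0)"
    if x: "x \<in> X" and Q: "Q \<in> borel_probs \<Sigma>" for x Q
  proof -
    obtain M \<xi> where ul: "usc_loss \<Sigma> (loss x) b M \<xi>" using ex[OF x Q] by blast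
    show "((\<lambda>\<epsilon>. c_KL_W \<Sigma> loss \<epsilon> r x Q) \<longlongrightarrow> c_KL \<Sigma> loss r x Q) (at_right 0)"
      unfolding c_KL_W_def c_KL_def dro_predictor_eq_worst_case[where loss=loss and x=x, OF ul]
      by (rule usc_loss.worst_case_W_tendsto[OF ul Q \<open>r > 0\<close>])
    show "((\<lambda>\<epsilon>. c_KL_LP \<Sigma> loss \<epsilon> r x Q) \<longlongrightarrow> c_KL \<Sigma> loss r x Q) (at_right 0)"
      unfolding c_KL_LP_def c_KL_def dro_predictor_eq_worst_case[where loss=loss and x=x, OF ul]
      by (rule usc_loss.worst_case_LP_tendsto[OF ul Q \<open>r > 0\<close>])
  qed
  have equiv: "feasible (c_KL \<Sigma> loss r) \<and> least_conservative X \<Sigma> feasible (c_KL \<Sigma> loss r)"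
    if f: "feasible \<in> {pointwise_feasible X \<Sigma> loss r, uniformly_feasible X \<Sigma> loss r}"
      and lc: "least_conservative X \<Sigma> feasible c" for feasible c
  proof -
    have c: "c \<in> usc_predictors X \<Sigma>" "feasible c" using lc by (auto simp: least_conservative_def)
    then have c': "pointwise_feasible X \<Sigma> loss r c \<or> uniformly_feasible X \<Sigma> loss r c" using f by auto
    have eq: "c x Q = c_KL \<Sigma> loss r x Q" if x: "x \<in> X" and Q: "Q \<in> borel_probs \<Sigma>" for x Q
    proof (rule antisym)
      have "\<forall>x\<in>X. \<exists>M \<xi>. usc_loss \<Sigma> (loss x) b M \<xi>" using ex Q by blast
      then obtain M \<xi> where ul: "\<And>x. x \<in> X \<Longrightarrow> usc_loss \<Sigma> (loss x) b (M x) (\<xi> x)" by metis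
      show "c x Q \<le> c_KL \<Sigma> loss r x Q"
        by (rule le_c_KL_of_least_conservative[where loss=loss and M=M and \<xi>=\<xi>, OF ul f lc \<open>r > 0\<close> x Q])
    qed (rule le[OF c(1) c' x Q])
    have u: "c_KL \<Sigma> loss r \<in> usc_predictors X \<Sigma>"
      using c(1) usc_predictors_cong[of X \<Sigma> c "c_KL \<Sigma> loss r", OF eq] by simp
    have "pointwise_feasible X \<Sigma> loss r c = pointwise_feasible X \<Sigma> loss r (c_KL \<Sigma> loss r)"
      by (rule pointwise_feasible_cong[OF eq])
    moreover have "uniformly_feasible X \<Sigma> loss r c = uniformly_feasible X \<Sigma> loss r (c_KL \<Sigma> loss r)"
      by (rule uniformly_feasible_cong[OF eq])
    ultimately have fe: "feasible (c_KL \<Sigma> loss r)" using f c(2) by auto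
    moreover have "least_conservative X \<Sigma> feasible (c_KL \<Sigma> loss r)"
      unfolding least_conservative_def
    proof (intro conjI ballI impI)
      fix c' x Q assume *: "c' \<in> usc_predictors X \<Sigma>" "feasible c'" "x \<in> X" "Q \<in> borel_probs \<Sigma>"
      show "c_KL \<Sigma> loss r x Q \<le> c' x Q" by (rule le[OF *(1) _ *(3,4)]) (use *(2) f in auto)
    qed (rule u, rule fe)
    ultimately show ?thesis by blast
  qed
  show ?thesis
  proof (intro conjI ballI impI iffI)
    fix feasible assume f: "feasible \<in> {pointwise_feasible X \<Sigma> loss r, uniformly_feasible X \<Sigma> loss r}"
    {
      assume "\<exists>c. least_conservative X \<Sigma> feasible c"
      then obtain c where "least_conservative X \<Sigma> feasible c" ..
      from equiv[OF f this]
      show "feasible (c_KL \<Sigma> loss r)" "least_conservative X \<Sigma> feasible (c_KL \<Sigma> loss r)" by auto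
    next
      assume "feasible (c_KL \<Sigma> loss r) \<and> least_conservative X \<Sigma> feasible (c_KL \<Sigma> loss r)"
      then show "\<exists>c. least_conservative X \<Sigma> feasible c" by blast
    }
  qed (use le lim in auto)
qed

end
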